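(* Let $K_+/k_+$ be a finite Galois extension of totally real number fields, let $k$ be a totally imaginary quadratic extension of $k_+$, and put $K=K_+k$, assumed of degree $[K:k]=[K_+:k_+]$, so that $\mathrm{Gal}(K/k)\simeq\mathrm{Gal}(K_+/k_+)$ and complex conjugation $\tau$ (the generator of $\mathrm{Gal}(K/K_+)$) commutes with $\mathrm{Gal}(K/k)$. Assume that every prime of $k$ which is ramified in $K/k$ is fixed by $\tau$ (in particular this holds if $K/k$ is unramified). Then there is an isomorphism $$\widehat{\mathrm{Cap}}_{K/k}^{\,-}\simeq H^1(\mathrm{Gal}(K/k),\hat\mu_K),$$ where $\hat\mu_K$ is the group of roots of unity of odd order in $K$.
   Context: $\hat{\mathbb Z}=\prod_{p \text{ odd}}\mathbb Z_p$ (profinite completion of $\mathbb Z$ with respect to subgroups of odd index). Since $2$ is invertible in $\hat{\mathbb Z}$, every $\hat{\mathbb Z}[\langle\tau\rangle]$-module $M$ decomposes as $M=M^+\oplus M^-$ with $M^\pm=e_\pm M$, $e_\pm=\tfrac12(1\pm\tau)$. $\mathrm{Cap}_{K/k}=\ker(j_{K/k}:\mathrm{Cl}_k\to\mathrm{Cl}_K)$ where $j_{K/k}$ is induced by extension of ideals; $\widehat{\mathrm{Cap}}_{K/k}$ is its subgroup of classes of odd order (a $\hat{\mathbb Z}[\langle\tau\rangle]$-module, $\tau$ acting as complex conjugation of $k$), and $\widehat{\mathrm{Cap}}_{K/k}^{\,-}$ is its minus component. *)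

theory Defs
  imports Complex_Main "HOL-Computational_Algebra.Polynomial" "HOL-Algebra.Group"
begin

definition subfield_C :: "complex set \<Rightarrow> bool" where
  "subfield_C K \<longleftrightarrow> 0 \<in> K \<and> 1 \<in> K \<and> (\<forall>x\<in>K. \<forall>y\<in>K. x + y \<in> K \<and> x * y \<in> K)
     \<and> (\<forall>x\<in>K. - x \<in> K) \<and> (\<forall>x\<in>K. x \<noteq> 0 \<longrightarrow> inverse x \<in> K)"

definition spans :: "complex set \<Rightarrow> complex set \<Rightarrow> nat \<Rightarrow> bool" where
  "spans L F n \<longleftrightarrow> (\<exists>b :: nat \<Rightarrow> complex. (\<forall>i<n. b i \<in> L) \<and>
       L = {(\<Sum>i<n. c i * b i) | c. \<forall>i<n. c i \<in> F})"

definition field_deg :: "complex set \<Rightarrow> complex set \<Rightarrow> nat" where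
  "field_deg L F = (LEAST n. spans L F n)"

definition number_field :: "complex set \<Rightarrow> bool" where
  "number_field K \<longleftrightarrow> subfield_C K \<and> (\<exists>n. spans K \<rat> n)"

definition embedding :: "complex set \<Rightarrow> (complex \<Rightarrow> complex) \<Rightarrow> bool" where
  "embedding K \<sigma> \<longleftrightarrow> \<sigma> 1 = 1 \<and> (\<forall>x\<in>K. \<forall>y\<in>K. \<sigma> (x + y) = \<sigma> x + \<sigma> y \<and> \<sigma> (x * y) = \<sigma> x * \<sigma> y)"

definition totally_real :: "complex set \<Rightarrow> bool" where
  "totally_real K \<longleftrightarrow> (\<forall>\<sigma>. embedding K \<sigma> \<longrightarrow> \<sigma> ` K \<subseteq> \<real>)"

definition totally_imaginary :: "complex set \<Rightarrow> bool" where
  "totally_imaginary K \<longleftrightarrow> (\<forall>\<sigma>. embedding K \<sigma> \<longrightarrow> \<not> \<sigma> ` K \<subseteq> \<real>)"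

definition compositum :: "complex set \<Rightarrow> complex set \<Rightarrow> complex set" where
  "compositum A B = \<Inter> {L. subfield_C L \<and> A \<subseteq> L \<and> B \<subseteq> L}"

definition Gal :: "complex set \<Rightarrow> complex set \<Rightarrow> (complex \<Rightarrow> complex) set" where
  "Gal L F = {\<sigma>. embedding L \<sigma> \<and> bij_betw \<sigma> L L \<and> (\<forall>x\<in>F. \<sigma> x = x) \<and> (\<forall>x. x \<notin> L \<longrightarrow> \<sigma> x = x)}"

definition galois_ext :: "complex set \<Rightarrow> complex set \<Rightarrow> bool" where
  "galois_ext L F \<longleftrightarrow> F \<subseteq> L \<and> finite (Gal L F) \<and> card (Gal L F) = field_deg L F"

definition alg_integer :: "complex \<Rightarrow> bool" where
  "alg_integer x \<longleftrightarrow> (\<exists>p :: int poly. lead_coeff p = 1 \<and> poly (map_poly of_int p) x = 0)"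

definition OK :: "complex set \<Rightarrow> complex set" where
  "OK K = {x \<in> K. alg_integer x}"

definition ideal_prod :: "complex set \<Rightarrow> complex set \<Rightarrow> complex set" where
  "ideal_prod I J = {(\<Sum>i<n. x i * y i) | (n::nat) x y. \<forall>i<n. x i \<in> I \<and> y i \<in> J}"

definition frac_ideal :: "complex set \<Rightarrow> complex set \<Rightarrow> bool" where
  "frac_ideal K I \<longleftrightarrow> I \<subseteq> K \<and> 0 \<in> I \<and> I \<noteq> {0} \<and> (\<forall>x\<in>I. \<forall>y\<in>I. x + y \<in> I)
     \<and> (\<forall>r\<in>OK K. \<forall>x\<in>I. r * x \<in> I) \<and> (\<exists>d\<in>OK K. d \<noteq> 0 \<and> (\<forall>x\<in>I. d * x \<in> OK K))"

definition principal_ideal :: "complex set \<Rightarrow> complex \<Rightarrow> complex set" where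
  "principal_ideal K a = (\<lambda>r. a * r) ` OK K"

definition is_principal :: "complex set \<Rightarrow> complex set \<Rightarrow> bool" where
  "is_principal K I \<longleftrightarrow> (\<exists>a\<in>K. a \<noteq> 0 \<and> I = principal_ideal K a)"

definition ext_ideal :: "complex set \<Rightarrow> complex set \<Rightarrow> complex set" where
  "ext_ideal K I = ideal_prod (OK K) I"

definition prime_ideal :: "complex set \<Rightarrow> complex set \<Rightarrow> bool" where
  "prime_ideal K P \<longleftrightarrow> frac_ideal K P \<and> P \<subseteq> OK K \<and> P \<noteq> OK K \<and>
     (\<forall>x\<in>OK K. \<forall>y\<in>OK K. x * y \<in> P \<longrightarrow> x \<in> P \<or> y \<in> P)"

text \<open>P (prime of k) ramifies in K: some prime Q of K above P has Q^2 | P O_K.\<close>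
definition ramified :: "complex set \<Rightarrow> complex set \<Rightarrow> complex set \<Rightarrow> bool" where
  "ramified k K P \<longleftrightarrow> (\<exists>Q. prime_ideal K Q \<and> P \<subseteq> Q \<and> ext_ideal K P \<subseteq> ideal_prod Q Q)"

definition ideal_class :: "complex set \<Rightarrow> complex set \<Rightarrow> complex set set" where
  "ideal_class K I = {J. frac_ideal K J \<and> (\<exists>a\<in>K. a \<noteq> 0 \<and> J = (\<lambda>x. a * x) ` I)}"

definition Cl :: "complex set \<Rightarrow> complex set set monoid" where
  "Cl K = \<lparr> carrier = {ideal_class K I | I. frac_ideal K I},
            mult = (\<lambda>C D. ideal_class K (ideal_prod (SOME I. I \<in> C) (SOME J. J \<in> D))),
            one = ideal_class K (OK K) \<rparr>"

definition Cap :: "complex set \<Rightarrow> complex set \<Rightarrow> complex set set set" where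
  "Cap k K = {C \<in> carrier (Cl k). \<exists>I\<in>C. is_principal K (ext_ideal K I)}"

definition Cap_hat :: "complex set \<Rightarrow> complex set \<Rightarrow> complex set set set" where
  "Cap_hat k K = {C \<in> Cap k K. \<exists>n::nat. odd n \<and> C [^]\<^bsub>Cl k\<^esub> n = \<one>\<^bsub>Cl k\<^esub>}"

definition tau_class :: "complex set \<Rightarrow> complex set set \<Rightarrow> complex set set" where
  "tau_class k C = ideal_class k (cnj ` (SOME I. I \<in> C))"

text \<open>Minus component e_- M = (1 - tau) M (2 is invertible on odd-order groups).\<close>
definition Cap_hat_minus :: "complex set \<Rightarrow> complex set \<Rightarrow> complex set set monoid" where
  "Cap_hat_minus k K = (Cl k) \<lparr> carrier :=
      {C \<otimes>\<^bsub>Cl k\<^esub> inv\<^bsub>Cl k\<^esub> (tau_class k C) | C. C \<in> Cap_hat k K} \<rparr>"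

definition mu_hat :: "complex set \<Rightarrow> complex set" where
  "mu_hat K = {z \<in> K. \<exists>n::nat. odd n \<and> z ^ n = 1}"

definition cocycles :: "(complex \<Rightarrow> complex) set \<Rightarrow> complex set \<Rightarrow> ((complex \<Rightarrow> complex) \<Rightarrow> complex) set" where
  "cocycles G M = {f. (\<forall>\<sigma>\<in>G. f \<sigma> \<in> M) \<and> (\<forall>\<sigma>. \<sigma> \<notin> G \<longrightarrow> f \<sigma> = 1) \<and>
      (\<forall>\<sigma>\<in>G. \<forall>\<rho>\<in>G. f (\<sigma> \<circ> \<rho>) = f \<sigma> * \<sigma> (f \<rho>))}"

definition coboundaries :: "(complex \<Rightarrow> complex) set \<Rightarrow> complex set \<Rightarrow> ((complex \<Rightarrow> complex) \<Rightarrow> complex) set" where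
  "coboundaries G M = {(\<lambda>\<sigma>. if \<sigma> \<in> G then \<sigma> a / a else 1) | a. a \<in> M}"

definition H1 :: "(complex \<Rightarrow> complex) set \<Rightarrow> complex set \<Rightarrow> ((complex \<Rightarrow> complex) \<Rightarrow> complex) set monoid" where
  "H1 G M = \<lparr> carrier = {{g \<in> cocycles G M. \<exists>b\<in>coboundaries G M. g = (\<lambda>\<sigma>. f \<sigma> * b \<sigma>)} | f. f \<in> cocycles G M},
             mult = (\<lambda>C D. {h \<in> cocycles G M. \<exists>f\<in>C. \<exists>g\<in>D. \<exists>b\<in>coboundaries G M. h = (\<lambda>\<sigma>. f \<sigma> * g \<sigma> * b \<sigma>)}),
             one = coboundaries G M \<rparr>"

end

theory Submission
  imports Defs "Jordan_Normal_Form.Char_Poly"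
begin

text \<open>
  Let \<open>G\<close> be the Galois group of \<open>K/k\<close>. By Hilbert 90 a cocycle \<open>f\<close> of \<open>G\<close> with values in the roots of unity
  of odd order is \<open>f \<sigma> = \<sigma> a / a\<close> for some nonzero \<open>a\<close> in \<open>K\<close>, and \<open>f\<close> is sent to the class of the ideal
  of \<open>k\<close> which generates the ideal \<open>(a / cnj a)\<close> of \<open>K\<close>. The existence of this ideal is the point where
  ramification enters. The ideal \<open>(a)\<close> is stable under \<open>G\<close>. Locally at a prime that is unramified in \<open>K/k\<close>
  the maximal ideal is generated by an element of \<open>k\<close>, hence so is \<open>(a / cnj a)\<close>. At a prime \<open>Q\<close> above a
  ramified prime of \<open>k\<close>, some \<open>g\<close> in \<open>G\<close> composed with conjugation fixes \<open>Q\<close>, which makes \<open>a / cnj a\<close> a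
  unit at \<open>Q\<close>.

  Injectivity and surjectivity rest on Kronecker's theorem: complex conjugation commutes with all
  embeddings of \<open>K\<close>, so \<open>u / cnj u\<close> is a root of unity for every unit \<open>u\<close> of \<open>K\<close>. The factors 2 and 4
  which appear on the way are invertible because all groups involved have odd exponent.

  No theory of Dedekind domains is needed: the localizations at primes are shown directly to be
  valuation rings.
\<close>

subsection \<open>Algebraic integers\<close>

text \<open>The ideal \<open>(a)\<close> itself need not come from \<open>k\<close>: its exponent at
  a prime ramified in \<open>K/k\<close> need not be a multiple of the ramification index. Dividing
  by the conjugate removes this exponent, and it is also the source of the constants. Conjugation
  inverts roots of unity, so \<open>\<sigma> (a / cnj a) = f \<sigma> ^ 2 * (a / cnj a)\<close>;
  comparing two such quotients through \<open>x ^ 2 = x / cnj x\<close> doubles once more.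

  The root of unity \<open>u / cnj u\<close> may have even order. Powers are therefore taken with
  exponents of the form \<open>2 ^ s * t\<close>: the factor \<open>2 ^ s\<close> removes the 2-part
  of that order, and \<open>t\<close> is chosen so that the total power of 2 is inverted modulo an
  odd exponent, which restores the original class or cocycle.

  Kronecker's theorem needs all conjugates of an element as images under embeddings of
  \<open>K\<close>. Capitulating classes are handled through the elements \<open>b\<close> that
  generate their extensions, by the map \<open>kappa\<close>; this turns statements on ideal classes
  into equations up to units of \<open>K\<close> and elements of \<open>k\<close>.\<close>

lemma alg_integer_of_stable_family:
  fixes w :: "'i \<Rightarrow> complex"
  assumes fin: "finite I" and i0: "i0 \<in> I" "w i0 \<noteq> 0"
    and st: "\<And>i. i \<in> I \<Longrightarrow> \<exists>c :: 'i \<Rightarrow> int. x * w i = (\<Sum>j\<in>I. of_int (c j) * w j)"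
  shows "alg_integer x"
proof -
  from st have "\<forall>i. \<exists>c :: 'i \<Rightarrow> int. i \<in> I \<longrightarrow> x * w i = (\<Sum>j\<in>I. of_int (c j) * w j)"
    by blast
  from choice[OF this] obtain C :: "'i \<Rightarrow> 'i \<Rightarrow> int"
    where C: "\<And>i. i \<in> I \<Longrightarrow> x * w i = (\<Sum>j\<in>I. of_int (C i j) * w j)" by blast
  from ex_bij_betw_nat_finite[OF fin] obtain h where h: "bij_betw h {0..<card I} I" by blast
  define n where "n = card I"
  define A where "A = mat n n (\<lambda>(i,j). C (h i) (h j))"
  define v where "v = vec n (\<lambda>i. w (h i))"
  have A: "A \<in> carrier_mat n n" by (simp add: A_def)
  have cA: "map_mat of_int A \<in> carrier_mat n n" using A by simp
  \<comment> \<open>Stability of the family says that \<open>x\<close> is an eigenvalue of an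
    integer matrix, hence a root of its monic characteristic polynomial.\<close>
  have "map_mat of_int A *\<^sub>v v = x \<cdot>\<^sub>v v"
  proof (rule eq_vecI)
    fix i assume "i < dim_vec (x \<cdot>\<^sub>v v)"
    then have i: "i < n" by (simp add: v_def)
    then have hi: "h i \<in> I" using h n_def by (auto simp: bij_betw_def)
    have "(map_mat of_int A *\<^sub>v v) $ i = (\<Sum>j = 0..<n. of_int (C (h i) (h j)) * w (h j))"
      using i by (simp add: A_def v_def scalar_prod_def)
    also have "\<dots> = (\<Sum>j\<in>I. of_int (C (h i) j) * w j)"
      by (rule sum.reindex_bij_betw) (use h n_def in auto)
    also have "\<dots> = x * w (h i)" using C[OF hi] by simp
    finally show "(map_mat of_int A *\<^sub>v v) $ i = (x \<cdot>\<^sub>v v) $ i" using i by (simp add: v_def)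
  qed (simp add: A_def v_def)
  moreover have "v \<noteq> 0\<^sub>v n"
  proof
    assume v0: "v = 0\<^sub>v n"
    from i0 h obtain i where "i < n" "h i = i0" unfolding bij_betw_def n_def by (metis atLeastLessThan_iff imageE)
    then have "v $ i = w i0" by (simp add: v_def)
    with v0 \<open>i < n\<close> i0 show False by simp
  qed
  ultimately have "eigenvector (map_mat of_int A) v x"
    unfolding eigenvector_def using A by (simp add: v_def)
  then have "eigenvalue (map_mat of_int A) x" unfolding eigenvalue_def by blast
  then have "poly (char_poly (map_mat of_int A)) x = 0"
    using eigenvalue_root_char_poly[OF cA, of x] by blast
  then have "poly (map_poly of_int (char_poly A)) x = 0"
    using of_int_hom.char_poly_hom[OF A] by metis
  moreover have "lead_coeff (char_poly A) = 1"
    using degree_monic_char_poly[OF A] by simp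
  ultimately show ?thesis unfolding alg_integer_def by blast
qed

definition zspan :: "complex set \<Rightarrow> complex set" where
  "zspan W = {\<Sum>w\<in>W. of_int (c w) * w | c :: complex \<Rightarrow> int. True}"

lemma zspan_add: "x \<in> zspan W \<Longrightarrow> y \<in> zspan W \<Longrightarrow> x + y \<in> zspan W"
proof -
  assume "x \<in> zspan W" "y \<in> zspan W"
  then obtain c d :: "complex \<Rightarrow> int" where "x = (\<Sum>w\<in>W. of_int (c w) * w)" "y = (\<Sum>w\<in>W. of_int (d w) * w)"
    by (auto simp: zspan_def)
  then have "x + y = (\<Sum>w\<in>W. of_int (c w + d w) * w)"
    by (simp add: sum.distrib distrib_right)
  then show ?thesis unfolding zspan_def by (auto intro!: exI[of _ "\<lambda>w. c w + d w"])
qed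

lemma zspan_scale: "x \<in> zspan W \<Longrightarrow> of_int n * x \<in> zspan W"
proof -
  assume "x \<in> zspan W"
  then obtain c :: "complex \<Rightarrow> int" where "x = (\<Sum>w\<in>W. of_int (c w) * w)"
    by (auto simp: zspan_def)
  then have "of_int n * x = (\<Sum>w\<in>W. of_int (n * c w) * w)"
    by (simp add: sum_distrib_left mult_ac)
  then show ?thesis unfolding zspan_def by (auto intro!: exI[of _ "\<lambda>w. n * c w"])
qed

lemma zspan_0: "0 \<in> zspan W"
  unfolding zspan_def by (auto intro!: exI[of _ "\<lambda>w. 0"])

lemma zspan_sum: "(\<And>i. i \<in> I \<Longrightarrow> f i \<in> zspan W) \<Longrightarrow> sum f I \<in> zspan W"
  by (induction I rule: infinite_finite_induct) (auto simp: zspan_0 zspan_add)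

lemma zspan_base: assumes "finite W" "w \<in> W" shows "w \<in> zspan W"
proof -
  have "w = (\<Sum>v\<in>W. of_int (if v = w then 1 else 0) * v)"
    using assms by (simp add: if_distrib if_distribR sum.delta cong: if_cong)
  then show ?thesis unfolding zspan_def by (auto intro!: exI[of _ "\<lambda>v. if v = w then 1 else 0"])
qed

lemma zspan_stable:
  assumes "\<And>w. w \<in> W \<Longrightarrow> x * w \<in> zspan W" "y \<in> zspan W"
  shows "x * y \<in> zspan W"
proof -
  obtain c :: "complex \<Rightarrow> int" where "y = (\<Sum>w\<in>W. of_int (c w) * w)"
    using assms(2) by (auto simp: zspan_def)
  then have "x * y = (\<Sum>w\<in>W. of_int (c w) * (x * w))"
    by (simp add: sum_distrib_left mult_ac)
  then show ?thesis using assms(1) by (auto intro!: zspan_sum zspan_scale)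
qed

lemma alg_integer_of_zspan:
  assumes "finite W" "w0 \<in> W" "w0 \<noteq> 0" "\<And>w. w \<in> W \<Longrightarrow> x * w \<in> zspan W"
  shows "alg_integer x"
  by (rule alg_integer_of_stable_family[of W w0 "\<lambda>w. w"]) (use assms in \<open>auto simp: zspan_def\<close>)

lemma alg_integer_power_eq:
  assumes "alg_integer x"
  obtains n c where "n > 0" "x ^ n = (\<Sum>i<n. of_int (c i) * x ^ i)"
proof -
  from assms obtain p :: "int poly" where p: "lead_coeff p = 1" "poly (map_poly of_int p) x = 0"
    unfolding alg_integer_def by blast
  define n where "n = degree p"
  have "(\<Sum>i\<le>n. of_int (coeff p i) * x ^ i) = 0"
    using p(2) by (simp add: poly_altdef n_def)
  then have "(\<Sum>i<n. of_int (coeff p i) * x ^ i) + x ^ n = 0"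
    using p(1) by (simp add: n_def lessThan_Suc_atMost[symmetric])
  then have eq: "x ^ n = (\<Sum>i<n. of_int (- coeff p i) * x ^ i)"
    by (simp add: sum_negf add_eq_0_iff)
  have "n > 0"
  proof (rule ccontr)
    assume "\<not> n > 0"
    with eq show False by simp
  qed
  then show ?thesis using eq by (rule that)
qed

text \<open>The monomials \<open>x ^ i * y ^ j\<close> below the degrees of the two monic relations
  span a lattice stable under both numbers, since an overflowing power is rewritten by its relation.
  Having one lattice for both gives sum and product together.\<close>

lemma alg_integer_common_span:
  assumes "alg_integer x" "alg_integer y"
  obtains W where "finite W" "1 \<in> W" "\<And>w. w \<in> W \<Longrightarrow> x * w \<in> zspan W" "\<And>w. w \<in> W \<Longrightarrow> y * w \<in> zspan W"
proof -
  obtain n c where n: "n > 0" "x ^ n = (\<Sum>i<n. of_int (c i) * x ^ i)"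
    using alg_integer_power_eq[OF assms(1)] by blast
  obtain m d where m: "m > 0" "y ^ m = (\<Sum>i<m. of_int (d i) * y ^ i)"
    using alg_integer_power_eq[OF assms(2)] by blast
  define W where "W = (\<lambda>(i,j). x ^ i * y ^ j) ` ({..<n} \<times> {..<m})"
  have fin: "finite W" by (simp add: W_def)
  have base: "x ^ i * y ^ j \<in> zspan W" if "i < n" "j < m" for i j
    using that by (intro zspan_base fin) (auto simp: W_def)
  have one: "1 \<in> W" unfolding W_def using n m by (auto intro!: image_eqI[of _ _ "(0,0)"])
  have x1: "x ^ Suc i * y ^ j \<in> zspan W" if "i < n" "j < m" for i j
  proof (cases "Suc i < n")
    case False
    then have "Suc i = n" using that by simp
    then have "x ^ Suc i * y ^ j = (\<Sum>l<n. of_int (c l) * (x ^ l * y ^ j))"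
      unfolding \<open>Suc i = n\<close> n(2) sum_distrib_right by (simp add: mult_ac)
    then show ?thesis using base that by (auto intro!: zspan_sum zspan_scale)
  qed (use base that in blast)
  have y1: "x ^ i * y ^ Suc j \<in> zspan W" if "i < n" "j < m" for i j
  proof (cases "Suc j < m")
    case False
    then have "Suc j = m" using that by simp
    then have "x ^ i * y ^ Suc j = (\<Sum>l<m. of_int (d l) * (x ^ i * y ^ l))"
      unfolding \<open>Suc j = m\<close> m(2) sum_distrib_left by (simp add: mult_ac)
    then show ?thesis using base that by (auto intro!: zspan_sum zspan_scale)
  qed (use base that in blast)
  show ?thesis
  proof (rule that[OF fin one])
    fix w assume "w \<in> W"
    then obtain i j where "i < n" "j < m" "w = x ^ i * y ^ j" unfolding W_def by auto
    then show "x * w \<in> zspan W" "y * w \<in> zspan W"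
      using x1[of i j] y1[of i j] by (simp_all add: algebra_simps)
  qed
qed

lemma alg_integer_add: assumes "alg_integer x" "alg_integer y" shows "alg_integer (x + y)"
  and alg_integer_mult: "alg_integer (x * y)"
proof -
  obtain W where W: "finite W" "1 \<in> W" "\<And>w. w \<in> W \<Longrightarrow> x * w \<in> zspan W" "\<And>w. w \<in> W \<Longrightarrow> y * w \<in> zspan W"
    using alg_integer_common_span[OF assms] by blast
  show "alg_integer (x + y)"
    by (rule alg_integer_of_zspan[of W 1]) (use W in \<open>auto simp: distrib_right intro: zspan_add\<close>)
  show "alg_integer (x * y)"
    by (rule alg_integer_of_zspan[of W 1]) (use W in \<open>auto simp: mult.assoc intro: zspan_stable\<close>)
qed

lemma alg_integer_of_int: "alg_integer (of_int n)"
  unfolding alg_integer_def by (intro exI[of _ "[:-n, 1:]"]) (simp add: map_poly_pCons)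

lemma alg_integer_0: "alg_integer 0" and alg_integer_1: "alg_integer 1"
  using alg_integer_of_int[of 0] alg_integer_of_int[of 1] by simp_all

lemma alg_integer_uminus: "alg_integer x \<Longrightarrow> alg_integer (- x)"
  using alg_integer_mult[OF alg_integer_of_int[of "-1"]] by simp

lemma alg_integer_iff_algebraic_int: "alg_integer x \<longleftrightarrow> algebraic_int x"
  unfolding alg_integer_def algebraic_int_altdef_ipoly by blast

lemma alg_integer_Rats_imp_Ints: "alg_integer x \<Longrightarrow> x \<in> \<rat> \<Longrightarrow> x \<in> \<int>"
  using rational_algebraic_int_is_int alg_integer_iff_algebraic_int by blast

text \<open>These are the coefficients of the quotient of the polynomial by \<open>X - x\<close>.\<close>

lemma alg_integer_quotient_coeff:
  fixes a :: "nat \<Rightarrow> int"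
  assumes eq: "(\<Sum>i\<le>n. of_int (a i) * x ^ i) = 0"
  shows "alg_integer (\<Sum>i=m..n. of_int (a i) * x ^ (i - m))" (is "alg_integer ?b")
proof (cases "m = 0 \<or> n < m")
  case True
  then show ?thesis using eq by (auto simp: atMost_atLeast0 alg_integer_0)
next
  case False
  then have m: "0 < m" "m \<le> n" by auto
  \<comment> \<open>The relation need not be monic, so the lattice of powers below \<open>n\<close>
    may fail to be stable under \<open>x\<close>, but it is stable under \<open>?b\<close>. For
    \<open>j < m\<close> the degrees of \<open>?b * x ^ j\<close> stay below \<open>n\<close>; for
    \<open>j \<ge> m\<close> the relation replaces \<open>x ^ m * ?b\<close> by its part of degree
    below \<open>m\<close>.\<close>
  define W where "W = (\<lambda>i. x ^ i) ` {..<n}"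
  have fin: "finite W" by (simp add: W_def)
  have base: "x ^ i \<in> zspan W" if "i < n" for i
    using that by (intro zspan_base fin) (auto simp: W_def)
  have one: "1 \<in> W" unfolding W_def using m by (auto intro!: image_eqI[of _ _ 0])
  have shift: "x ^ m * ?b = - (\<Sum>i<m. of_int (a i) * x ^ i)"
  proof -
    have "x ^ m * ?b = (\<Sum>i=m..n. of_int (a i) * x ^ i)"
      unfolding sum_distrib_left
    proof (rule sum.cong[OF refl])
      fix i assume "i \<in> {m..n}"
      then have "x ^ i = x ^ m * x ^ (i - m)" by (simp flip: power_add)
      then show "x ^ m * (of_int (a i) * x ^ (i - m)) = of_int (a i) * x ^ i" by simp
    qed
    moreover have "{..n} = {..<m} \<union> {m..n}" using m by auto
    then have "(\<Sum>i\<le>n. of_int (a i) * x ^ i) = (\<Sum>i<m. of_int (a i) * x ^ i) + (\<Sum>i=m..n. of_int (a i) * x ^ i)"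
      by (simp add: sum.union_disjoint ivl_disj_int)
    ultimately show ?thesis using eq by (simp add: add_eq_0_iff)
  qed
  show ?thesis
  proof (rule alg_integer_of_zspan[OF fin one])
    fix w assume "w \<in> W"
    then obtain j where j: "j < n" "w = x ^ j" by (auto simp: W_def)
    show "?b * w \<in> zspan W"
    proof (cases "j < m")
      case True
      have "?b * w = (\<Sum>i=m..n. of_int (a i) * x ^ (i - m + j))"
        unfolding j(2) sum_distrib_right by (simp only: power_add mult_ac)
      also have "\<dots> \<in> zspan W"
        using True by (intro zspan_sum zspan_scale base) auto
      finally show ?thesis .
    next
      case False
      then have "w = x ^ (j - m) * x ^ m" by (simp add: j flip: power_add)
      then have "?b * w = x ^ (j - m) * (x ^ m * ?b)" by (simp only: mult_ac)
      also have "\<dots> = (\<Sum>i<m. of_int (- a i) * x ^ (j - m + i))"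
        unfolding shift by (simp add: sum_distrib_left sum_negf power_add mult_ac)
      also have "\<dots> \<in> zspan W"
        using False j by (intro zspan_sum zspan_scale base) auto
      finally show ?thesis .
    qed
  qed simp
qed

subsection \<open>Number fields and their rings of integers\<close>

locale complex_field =
  fixes K :: "complex set"
  assumes subfield: "subfield_C K"
begin

lemma zero_mem [simp, intro]: "0 \<in> K" and one_mem [simp, intro]: "1 \<in> K"
  and add_mem [intro]: "x \<in> K \<Longrightarrow> y \<in> K \<Longrightarrow> x + y \<in> K"
  and mult_mem [intro]: "x \<in> K \<Longrightarrow> y \<in> K \<Longrightarrow> x * y \<in> K"
  and uminus_mem [intro]: "x \<in> K \<Longrightarrow> - x \<in> K"
  using subfield unfolding subfield_C_def by auto

lemma inverse_mem [intro]: "x \<in> K \<Longrightarrow> inverse x \<in> K"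
  using subfield unfolding subfield_C_def by (cases "x = 0") auto

lemma diff_mem [intro]: "x \<in> K \<Longrightarrow> y \<in> K \<Longrightarrow> x - y \<in> K"
  using add_mem[of x "- y"] uminus_mem[of y] by simp

lemma divide_mem [intro]: "x \<in> K \<Longrightarrow> y \<in> K \<Longrightarrow> x / y \<in> K"
  using mult_mem[of x "inverse y"] inverse_mem[of y] by (simp add: divide_inverse)

lemma power_mem [intro]: "x \<in> K \<Longrightarrow> x ^ n \<in> K"
  by (induction n) auto

lemma sum_mem [intro]: "(\<And>i. i \<in> I \<Longrightarrow> f i \<in> K) \<Longrightarrow> sum f I \<in> K"
  by (induction I rule: infinite_finite_induct) auto

lemma prod_mem [intro]: "(\<And>i. i \<in> I \<Longrightarrow> f i \<in> K) \<Longrightarrow> prod f I \<in> K"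
  by (induction I rule: infinite_finite_induct) auto

lemma of_nat_mem [simp, intro]: "of_nat n \<in> K"
  by (induction n) auto

lemma of_int_mem [simp, intro]: "of_int n \<in> K"
  by (cases n rule: int_cases2) (auto simp: uminus_mem)

lemma Rats_subset: "\<rat> \<subseteq> K"
proof
  fix x :: complex assume "x \<in> \<rat>"
  then obtain a b :: int where "x = of_int a / of_int b" by (auto elim: Rats_cases')
  then show "x \<in> K" by auto
qed

lemma OK_mem_field: "x \<in> OK K \<Longrightarrow> x \<in> K"
  and OK_add [intro]: "x \<in> OK K \<Longrightarrow> y \<in> OK K \<Longrightarrow> x + y \<in> OK K"
  and OK_mult [intro]: "x \<in> OK K \<Longrightarrow> y \<in> OK K \<Longrightarrow> x * y \<in> OK K"
  and OK_uminus [intro]: "x \<in> OK K \<Longrightarrow> - x \<in> OK K"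
  and OK_of_int [simp, intro]: "of_int n \<in> OK K"
  and OK_0 [simp, intro]: "0 \<in> OK K" and OK_1 [simp, intro]: "1 \<in> OK K"
  by (auto simp: OK_def alg_integer_add alg_integer_mult alg_integer_uminus alg_integer_of_int
      alg_integer_0 alg_integer_1)

lemma OK_diff [intro]: "x \<in> OK K \<Longrightarrow> y \<in> OK K \<Longrightarrow> x - y \<in> OK K"
  using OK_add[of x "- y"] OK_uminus[of y] by simp

lemma OK_power [intro]: "x \<in> OK K \<Longrightarrow> x ^ n \<in> OK K"
  by (induction n) auto

lemma OK_sum [intro]: "(\<And>i. i \<in> I \<Longrightarrow> f i \<in> OK K) \<Longrightarrow> sum f I \<in> OK K"
  by (induction I rule: infinite_finite_induct) auto

lemma OK_prod [intro]: "(\<And>i. i \<in> I \<Longrightarrow> f i \<in> OK K) \<Longrightarrow> prod f I \<in> OK K"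
  by (induction I rule: infinite_finite_induct) auto

end

locale num_field =
  fixes K :: "complex set"
  assumes number_field: "number_field K"

sublocale num_field \<subseteq> complex_field K
  by unfold_locales (use number_field in \<open>simp add: number_field_def\<close>)

context num_field
begin

text \<open>The degree is the length of a spanning family and so does not depend on
  \<open>x\<close>; Kronecker's finiteness argument needs one bound for all powers of an element.
  The polynomial is the characteristic polynomial of a matrix of multiplication by \<open>x\<close>,
  reached through an eigenvector because the family may be dependent.\<close>

lemma char_poly_rat:
  obtains n where "\<And>x. x \<in> K \<Longrightarrow> \<exists>p :: rat poly. lead_coeff p = 1 \<and> degree p = n \<and> poly (map_poly of_rat p) x = 0"
proof -
  from number_field obtain n where "spans K \<rat> n" unfolding number_field_def by blast
  then obtain b where b: "\<And>i. i < n \<Longrightarrow> b i \<in> K" "K = {\<Sum>i<n. c i * b i | c. \<forall>i<n. c i \<in> \<rat>}"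
    unfolding spans_def by blast
  have "\<exists>p :: rat poly. lead_coeff p = 1 \<and> degree p = n \<and> poly (map_poly of_rat p) x = 0" if x: "x \<in> K" for x
  proof -
    have "\<exists>c :: nat \<Rightarrow> rat. x * b i = (\<Sum>j<n. of_rat (c j) * b j)" if "i < n" for i
    proof -
      have "x * b i \<in> K" using x b(1) that by blast
      then obtain c where c: "\<forall>i<n. c i \<in> \<rat>" "x * b i = (\<Sum>j<n. c j * b j)"
        using b(2) by blast
      have "\<forall>j. \<exists>r. j < n \<longrightarrow> c j = of_rat r" using c(1) by (auto elim!: Rats_cases)
      then obtain r where "\<And>j. j < n \<Longrightarrow> c j = of_rat (r j)" using choice[of "\<lambda>j r. j < n \<longrightarrow> c j = of_rat r"] by blast
      then have "x * b i = (\<Sum>j<n. of_rat (r j) * b j)" using c(2) by simp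
      then show ?thesis by blast
    qed
    then have "\<forall>i. \<exists>c :: nat \<Rightarrow> rat. i < n \<longrightarrow> x * b i = (\<Sum>j<n. of_rat (c j) * b j)" by blast
    from choice[OF this] obtain C :: "nat \<Rightarrow> nat \<Rightarrow> rat"
      where C: "\<And>i. i < n \<Longrightarrow> x * b i = (\<Sum>j<n. of_rat (C i j) * b j)" by blast
    define A where "A = mat n n (\<lambda>(i,j). C i j)"
    define v where "v = vec n b"
    have A: "A \<in> carrier_mat n n" by (simp add: A_def)
    have cA: "map_mat of_rat A \<in> carrier_mat n n" using A by simp
    have "map_mat of_rat A *\<^sub>v v = x \<cdot>\<^sub>v v"
      by (rule eq_vecI) (auto simp: A_def v_def scalar_prod_def C atLeast0LessThan)
    moreover have "v \<noteq> 0\<^sub>v n"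
    proof
      assume v0: "v = 0\<^sub>v n"
      have "b i = 0" if "i < n" for i
      proof -
        have "v $ i = b i" using that by (simp add: v_def)
        then show ?thesis using v0 that by simp
      qed
      moreover have "1 \<in> K" by simp
      then obtain c where "1 = (\<Sum>j<n. c j * b j)" using b(2) by blast
      ultimately show False by simp
    qed
    ultimately have "eigenvector (map_mat of_rat A) v x"
      unfolding eigenvector_def using A by (simp add: v_def)
    then have "eigenvalue (map_mat of_rat A) x" unfolding eigenvalue_def by blast
    then have "poly (char_poly (map_mat of_rat A)) x = 0"
      using eigenvalue_root_char_poly[OF cA, of x] by blast
    then have "poly (map_poly of_rat (char_poly A)) x = 0"
      using of_rat_hom.char_poly_hom[OF A] by metis
    then show ?thesis using degree_monic_char_poly[OF A] by auto
  qed
  then show ?thesis by (rule that)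
qed

lemma algebraic: assumes "x \<in> K" shows "algebraic x"
proof -
  obtain p :: "rat poly" where "lead_coeff p = 1" "poly (map_poly of_rat p) x = 0"
    using char_poly_rat assms by metis
  then show ?thesis
    by (intro algebraicI'[of "map_poly of_rat p"]) (auto simp: coeff_map_poly)
qed

text \<open>Primitivity is the property that matters later: no prime number divides all
  coefficients, which is what \<open>loc_valuation\<close> contradicts.\<close>

lemma primitive_poly:
  assumes "x \<in> K"
  obtains p :: "int poly" where "content p = 1" "poly (map_poly of_int p) x = 0"
proof -
  obtain q :: "complex poly" where q: "\<forall>i. coeff q i \<in> \<int>" "q \<noteq> 0" "poly q x = 0"
    using algebraic[OF assms] unfolding algebraic_def by blast
  define c where "c i = (SOME m. coeff q i = of_int m)" for i
  have c: "coeff q i = of_int (c i)" for i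
    unfolding c_def by (rule someI_ex) (use q(1) in \<open>auto elim: Ints_cases\<close>)
  have "\<forall>\<^sub>\<infinity>n. c n = 0" using MOST_coeff_eq_0[of q] by (simp add: c)
  then have co: "coeff (Abs_poly c) = c" by (rule Abs_poly_inverse[OF CollectI])
  define r where "r = Abs_poly c"
  have qr: "q = map_poly of_int r"
    by (rule poly_eqI) (simp add: coeff_map_poly c co r_def)
  then have r0: "r \<noteq> 0" using q(2) by auto
  have "r = Polynomial.smult (content r) (primitive_part r)" by simp
  then have "q = Polynomial.smult (of_int (content r)) (map_poly of_int (primitive_part r))"
    using qr by (metis of_int_hom.map_poly_hom_smult)
  then have "of_int (content r) * poly (map_poly of_int (primitive_part r)) x = (0 :: complex)"
    using q(3) by (metis poly_smult)
  then have "poly (map_poly of_int (primitive_part r)) x = (0 :: complex)"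
    using r0 by simp
  moreover have "content (primitive_part r) = 1" using r0 by simp
  ultimately show ?thesis using that by blast
qed

lemma primitive_poly_degree:
  assumes "content (p :: int poly) = 1" "poly (map_poly of_int p) (x :: complex) = 0"
  shows "degree p > 0"
proof (rule ccontr)
  assume "\<not> degree p > 0"
  then obtain a where "p = [:a:]" by (metis degree_eq_zeroE gr0I)
  then have "poly (map_poly of_int p) x = (of_int a :: complex)" by (cases "a = 0") (auto simp: map_poly_pCons)
  with assms \<open>p = [:a:]\<close> show False by auto
qed

lemma int_multiple_integral:
  assumes "x \<in> K"
  obtains m :: int where "m \<noteq> 0" "of_int m * x \<in> OK K"
proof -
  obtain p :: "int poly" where p: "content p = 1" "poly (map_poly of_int p) x = 0"
    using primitive_poly[OF assms] by blast
  define n where "n = degree p"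
  have n: "n > 0" using primitive_poly_degree[OF p] by (simp add: n_def)
  have eq: "(\<Sum>i\<le>n. of_int (coeff p i) * x ^ i) = 0"
    using p(2) by (simp add: poly_altdef n_def)
  \<comment> \<open>The quotient coefficient at \<open>n - 1\<close> is
    \<open>coeff p (n-1) + coeff p n * x\<close>, so the leading coefficient clears the denominator
    of \<open>x\<close>.\<close>
  have "alg_integer (\<Sum>i=n-1..n. of_int (coeff p i) * x ^ (i - (n-1)))"
    by (rule alg_integer_quotient_coeff[OF eq])
  moreover have "{n-1..n} = {n-1, n}" using n by auto
  ultimately have "alg_integer (of_int (coeff p (n-1)) + of_int (coeff p n) * x)"
    using n by simp
  from alg_integer_add[OF this alg_integer_of_int[of "- coeff p (n-1)"]]
  have "alg_integer (of_int (coeff p n) * x)" by simp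
  moreover have "coeff p n \<noteq> 0" using n by (auto simp: n_def)
  ultimately show ?thesis using that[of "coeff p n"] assms by (auto simp: OK_def)
qed

text \<open>A substitute for the norm: it puts a nonzero rational integer into every nonzero
  integral ideal.\<close>

lemma integer_divides_int:
  assumes "z \<in> OK K" "z \<noteq> 0"
  obtains w and N :: int where "w \<in> OK K" "N \<noteq> 0" "z * w = of_int N"
proof -
  have "inverse z \<in> K" using assms OK_mem_field by blast
  then obtain m :: int where "m \<noteq> 0" "of_int m * inverse z \<in> OK K"
    using int_multiple_integral by blast
  then show ?thesis using that[of "of_int m * inverse z" m] assms by simp
qed

subsection \<open>Prime ideals and localizations\<close>

definition loc :: "complex set \<Rightarrow> complex set" where
  "loc Q = {x \<in> K. \<exists>s\<in>OK K - Q. s * x \<in> OK K}"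

lemma frac_idealD:
  assumes "frac_ideal K I"
  shows "I \<subseteq> K" "0 \<in> I" "\<And>x y. x \<in> I \<Longrightarrow> y \<in> I \<Longrightarrow> x + y \<in> I"
    "\<And>r x. r \<in> OK K \<Longrightarrow> x \<in> I \<Longrightarrow> r * x \<in> I" "\<exists>x\<in>I. x \<noteq> 0"
    "\<exists>d\<in>OK K. d \<noteq> 0 \<and> (\<forall>x\<in>I. d * x \<in> OK K)"
  using assms unfolding frac_ideal_def by auto

lemma frac_ideal_uminus: "frac_ideal K I \<Longrightarrow> x \<in> I \<Longrightarrow> - x \<in> I"
  using frac_idealD(4)[of I "-1" x] OK_uminus[OF OK_1] by simp

lemma frac_ideal_diff: "frac_ideal K I \<Longrightarrow> x \<in> I \<Longrightarrow> y \<in> I \<Longrightarrow> x - y \<in> I"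
  using frac_idealD(3)[of I x "- y"] frac_ideal_uminus[of I y] by simp

lemma frac_ideal_sum: "frac_ideal K I \<Longrightarrow> (\<And>i. i \<in> S \<Longrightarrow> f i \<in> I) \<Longrightarrow> sum f S \<in> I"
  by (induction S rule: infinite_finite_induct) (auto simp: frac_idealD)

text \<open>Zorn's lemma yields a maximal ideal, which is prime. This is the local-global device of
  the development: to show that a set of denominators contains 1, suppose that it does not, place it
  in a prime and work at that prime.\<close>

lemma exists_prime_ideal_above:
  assumes A: "A \<subseteq> OK K" "0 \<in> A" "1 \<notin> A" "a \<in> A" "a \<noteq> 0"
    and add: "\<And>x y. x \<in> A \<Longrightarrow> y \<in> A \<Longrightarrow> x + y \<in> A"
    and mul: "\<And>r x. r \<in> OK K \<Longrightarrow> x \<in> A \<Longrightarrow> r * x \<in> A"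
  shows "\<exists>P. prime_ideal K P \<and> A \<subseteq> P"
proof -
  define idl where "idl I \<longleftrightarrow> A \<subseteq> I \<and> I \<subseteq> OK K \<and> 1 \<notin> I \<and> (\<forall>x\<in>I. \<forall>y\<in>I. x + y \<in> I) \<and> (\<forall>r\<in>OK K. \<forall>x\<in>I. r * x \<in> I)" for I
  have "\<exists>M\<in>Collect idl. \<forall>X\<in>Collect idl. M \<subseteq> X \<longrightarrow> X = M"
  proof (rule subset_Zorn_nonempty)
    have "idl A" unfolding idl_def by (intro conjI ballI) (use A add mul in auto)
    then show "Collect idl \<noteq> {}" by blast
  next
    fix C assume C: "C \<noteq> {}" "subset.chain (Collect idl) C"
    then have sub: "\<And>X. X \<in> C \<Longrightarrow> idl X" and tot: "\<And>X Y. X \<in> C \<Longrightarrow> Y \<in> C \<Longrightarrow> X \<subseteq> Y \<or> Y \<subseteq> X"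
      by (auto simp: subset.chain_def)
    have "x + y \<in> \<Union>C" if xy: "x \<in> \<Union>C" "y \<in> \<Union>C" for x y
    proof -
      obtain X Y where "X \<in> C" "x \<in> X" "Y \<in> C" "y \<in> Y" using xy by blast
      then obtain Z where "Z \<in> C" "x \<in> Z" "y \<in> Z" using tot[of X Y] by blast
      then show ?thesis using sub[of Z] unfolding idl_def by blast
    qed
    then have "idl (\<Union>C)" using C(1) sub unfolding idl_def by blast
    then show "\<Union>C \<in> Collect idl" by simp
  qed
  then obtain M where M: "idl M" and max: "\<And>X. idl X \<Longrightarrow> M \<subseteq> X \<Longrightarrow> X = M" by blast
  have Ma: "\<And>x y. x \<in> M \<Longrightarrow> y \<in> M \<Longrightarrow> x + y \<in> M" and Mm: "\<And>r x. r \<in> OK K \<Longrightarrow> x \<in> M \<Longrightarrow> r * x \<in> M"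
    and MO: "M \<subseteq> OK K" and M1: "1 \<notin> M" and AM: "A \<subseteq> M"
    using M unfolding idl_def by blast+
  have M0: "0 \<in> M" using AM A by blast
  \<comment> \<open>\<open>X\<close> is the ideal generated by \<open>M\<close> and
    \<open>x\<close>; maximality forces 1 into it. Primality of \<open>M\<close> follows from these
    inverses.\<close>
  have inv: "\<exists>y\<in>OK K. 1 - x * y \<in> M" if x: "x \<in> OK K" "x \<notin> M" for x
  proof -
    define X where "X = {m + x * y | m y. m \<in> M \<and> y \<in> OK K}"
    have MX: "M \<subseteq> X"
    proof
      fix m assume "m \<in> M"
      then have "m = m + x * 0 \<and> m \<in> M \<and> 0 \<in> OK K" by simp
      then show "m \<in> X" unfolding X_def by blast
    qed
    have "x \<in> X" unfolding X_def using M0 OK_1 by (intro CollectI exI[of _ 0] exI[of _ 1]) auto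
    then have "\<not> idl X" using max[OF _ MX] x(2) by auto
    moreover have "X \<subseteq> OK K" using MO x unfolding X_def by auto
    moreover have "u + v \<in> X" if "u \<in> X" "v \<in> X" for u v
    proof -
      from that obtain m y m' y' where "u = m + x * y" "v = m' + x * y'" "m \<in> M" "m' \<in> M" "y \<in> OK K" "y' \<in> OK K"
        unfolding X_def by blast
      then have "u + v = (m + m') + x * (y + y')" "m + m' \<in> M" "y + y' \<in> OK K"
        using Ma by (auto simp: algebra_simps)
      then show ?thesis unfolding X_def by blast
    qed
    moreover have "r * u \<in> X" if "r \<in> OK K" "u \<in> X" for r u
    proof -
      from that obtain m y where "u = m + x * y" "m \<in> M" "y \<in> OK K"
        unfolding X_def by blast
      then have "r * u = r * m + x * (r * y)" "r * m \<in> M" "r * y \<in> OK K"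
        using Mm[of r m] that by (auto simp: algebra_simps)
      then show ?thesis unfolding X_def by blast
    qed
    ultimately have "1 \<in> X" using MX AM unfolding idl_def by blast
    then obtain m y where "1 = m + x * y" "m \<in> M" "y \<in> OK K" unfolding X_def by blast
    then show ?thesis by (metis add_diff_cancel_right')
  qed
  have "x \<in> M \<or> y \<in> M" if xy: "x \<in> OK K" "y \<in> OK K" "x * y \<in> M" for x y
  proof (rule ccontr)
    assume "\<not> (x \<in> M \<or> y \<in> M)"
    then obtain u where u: "u \<in> OK K" "1 - x * u \<in> M" using inv xy by blast
    have "y * (1 - x * u) + u * (x * y) \<in> M" using Ma Mm u xy by blast
    then have "y \<in> M" by (simp add: algebra_simps)
    with \<open>\<not> (x \<in> M \<or> y \<in> M)\<close> show False by blast
  qed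
  moreover have "frac_ideal K M"
    unfolding frac_ideal_def using MO OK_mem_field M0 AM A Ma Mm
    by (auto intro!: bexI[of _ 1])
  ultimately have "prime_ideal K M" unfolding prime_ideal_def using MO M1 OK_1 by auto
  then show ?thesis using AM by blast
qed

end

section \<open>Residue fields, and the localization at a prime as a discrete valuation ring\<close>

locale num_field_prime = num_field +
  fixes Q :: "complex set"
  assumes prime: "prime_ideal K Q"
begin

lemma Q_frac_ideal: "frac_ideal K Q" and Q_subset: "Q \<subseteq> OK K"
  and Q_prime: "\<And>x y. x \<in> OK K \<Longrightarrow> y \<in> OK K \<Longrightarrow> x * y \<in> Q \<Longrightarrow> x \<in> Q \<or> y \<in> Q"
  using prime unfolding prime_ideal_def by blast+

lemma Q_0 [simp]: "0 \<in> Q"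
  and Q_add: "x \<in> Q \<Longrightarrow> y \<in> Q \<Longrightarrow> x + y \<in> Q"
  and Q_diff: "x \<in> Q \<Longrightarrow> y \<in> Q \<Longrightarrow> x - y \<in> Q"
  and Q_uminus: "x \<in> Q \<Longrightarrow> - x \<in> Q"
  and Q_mult: "r \<in> OK K \<Longrightarrow> x \<in> Q \<Longrightarrow> r * x \<in> Q"
  and Q_mult': "r \<in> OK K \<Longrightarrow> x \<in> Q \<Longrightarrow> x * r \<in> Q"
  using frac_idealD[OF Q_frac_ideal] frac_ideal_uminus[OF Q_frac_ideal] frac_ideal_diff[OF Q_frac_ideal]
  by (auto simp: mult.commute)

lemma Q_1 [simp]: "1 \<notin> Q"
proof
  assume "1 \<in> Q"
  then have "OK K \<subseteq> Q" using Q_mult[of _ 1] by auto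
  then show False using prime unfolding prime_ideal_def by blast
qed

lemma Q_power: "x \<in> OK K \<Longrightarrow> x ^ n \<in> Q \<Longrightarrow> x \<in> Q"
  by (induction n) (auto dest: Q_prime)

lemma Q_prod: "finite I \<Longrightarrow> (\<And>i. i \<in> I \<Longrightarrow> f i \<in> OK K) \<Longrightarrow> prod f I \<in> Q \<Longrightarrow> \<exists>i\<in>I. f i \<in> Q"
proof (induction I rule: finite_induct)
  case (insert i I)
  then have "f i * prod f I \<in> Q" by simp
  then have "f i \<in> Q \<or> prod f I \<in> Q" using insert by (intro Q_prime) auto
  then show ?case using insert by auto
qed simp

text \<open>Some multiple of a nonzero element of \<open>Q\<close> is a nonzero integer. The least
  positive integer in \<open>Q\<close> generates the intersection with the integers by division with
  remainder, and it inherits primality from \<open>Q\<close>.\<close>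

lemma residue_char:
  obtains p :: int where "prime p" "\<And>m. of_int m \<in> Q \<longleftrightarrow> p dvd m"
proof -
  obtain z where "z \<in> Q" "z \<noteq> 0" using frac_idealD[OF Q_frac_ideal] by blast
  then obtain w N where wN: "w \<in> OK K" "(N :: int) \<noteq> 0" "z * w = of_int N"
    using integer_divides_int[of z] Q_subset by blast
  then have "of_int N \<in> Q" using Q_mult'[OF wN(1) \<open>z \<in> Q\<close>] by simp
  then have "of_int \<bar>N\<bar> \<in> Q" using Q_uminus by (cases "N \<ge> 0") auto
  then have ex: "\<exists>n>0. (of_nat n :: complex) \<in> Q"
    using wN(2) by (intro exI[of _ "nat \<bar>N\<bar>"]) (simp add: of_nat_nat)
  define n where "n = (LEAST n. n > 0 \<and> (of_nat n :: complex) \<in> Q)"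
  have n: "n > 0" "(of_nat n :: complex) \<in> Q"
    using LeastI_ex[OF ex] unfolding n_def by blast+
  have min: "n \<le> m" if "m > 0" "(of_nat m :: complex) \<in> Q" for m
    unfolding n_def using that by (intro Least_le) auto
  have iff: "of_int m \<in> Q \<longleftrightarrow> int n dvd m" for m
  proof
    assume m: "of_int m \<in> Q"
    have "of_int m - of_int (m div int n) * of_nat n \<in> Q"
      using m n by (intro Q_diff Q_mult) auto
    also have "of_int m - of_int (m div int n) * of_nat n = (of_int (m mod int n) :: complex)"
      by (simp add: minus_div_mult_eq_mod[symmetric])
    also have "\<dots> = of_nat (nat (m mod int n))" using n(1) by (simp add: of_nat_nat)
    finally have "(of_nat (nat (m mod int n)) :: complex) \<in> Q" .
    moreover have "nat (m mod int n) < n" using n(1) by (simp add: nat_less_iff)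
    ultimately have "nat (m mod int n) = 0" using min[of "nat (m mod int n)"] by linarith
    moreover have "m mod int n \<ge> 0" using n(1) by simp
    ultimately show "int n dvd m" by (auto simp: dvd_eq_mod_eq_0)
  next
    assume "int n dvd m"
    then obtain c where "m = int n * c" by (auto simp: dvd_def)
    then show "of_int m \<in> Q" using Q_mult'[OF OK_of_int n(2), of c] by simp
  qed
  have "n \<noteq> 1" using n Q_1 by auto
  have "prime n"
  proof (rule prime_natI)
    show "n \<ge> 2" using n(1) \<open>n \<noteq> 1\<close> by linarith
  next
    fix a b assume ab: "n dvd a * b"
    then have "of_int (int a * int b) \<in> Q" unfolding iff by (metis of_nat_dvd_iff of_nat_mult)
    then have "of_int (int a) * of_int (int b) \<in> Q" by simp
    then have "of_int (int a) \<in> Q \<or> of_int (int b) \<in> Q" by (intro Q_prime OK_of_int)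
    then show "n dvd a \<or> n dvd b" unfolding iff by simp
  qed
  then have "prime (int n)" by simp
  then show ?thesis using iff by (rule that)
qed

text \<open>This is maximality of \<open>Q\<close>. Take a monic integer polynomial of least degree
  whose value at \<open>x\<close> lies in \<open>Q\<close>. If \<open>p\<close> divided its constant
  coefficient, \<open>x\<close> could be cancelled modulo \<open>Q\<close> and the degree would
  drop; so the constant is invertible modulo \<open>p\<close>, and solving the relation for it
  inverts \<open>x\<close>.\<close>

lemma residue_inverse:
  assumes x: "x \<in> OK K" "x \<notin> Q"
  shows "\<exists>y\<in>OK K. 1 - x * y \<in> Q"
proof -
  obtain p :: int where p: "prime p" "\<And>m. of_int m \<in> Q \<longleftrightarrow> p dvd m" using residue_char by blast
  define D where "D d \<longleftrightarrow> (\<exists>f :: int poly. lead_coeff f = 1 \<and> degree f = d \<and> poly (map_poly of_int f) x \<in> Q)" for d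
  have ex: "\<exists>d. D d"
  proof -
    from x(1) obtain f :: "int poly" where "lead_coeff f = 1" "poly (map_poly of_int f) x = 0"
      unfolding OK_def alg_integer_def by blast
    then have "D (degree f)" unfolding D_def by (intro exI[of _ f]) simp
    then show ?thesis by blast
  qed
  define d where "d = (LEAST d. D d)"
  have "D d" unfolding d_def by (rule LeastI_ex[OF ex])
  then obtain f :: "int poly" where f: "lead_coeff f = 1" "degree f = d" "poly (map_poly of_int f) x \<in> Q"
    unfolding D_def by blast
  have min: "d \<le> e" if "D e" for e unfolding d_def using that by (rule Least_le)
  obtain c g where fg: "f = pCons c g" by (cases f)
  have poly_in: "poly (map_poly of_int h) x \<in> OK K" for h :: "int poly"
    using x(1) by (auto simp: poly_altdef coeff_map_poly)
  have g0: "g \<noteq> 0"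
  proof
    assume "g = 0"
    then have "f = 1" using fg f(1) by simp
    then show False using f(3) by simp
  qed
  then have f': "of_int c + x * poly (map_poly of_int g) x \<in> Q"
    using f(3) fg by (simp add: map_poly_pCons)
  have "\<not> p dvd c"
  proof
    assume "p dvd c"
    then have "of_int c \<in> Q" using p by blast
    then have "x * poly (map_poly of_int g) x \<in> Q" using Q_diff[OF f', of "of_int c"] by simp
    then have "poly (map_poly of_int g) x \<in> Q" using Q_prime x poly_in by blast
    moreover have "lead_coeff g = 1" using f(1) fg g0 by simp
    ultimately have "D (degree g)" unfolding D_def by blast
    then have "d \<le> degree g" by (rule min)
    then show False using f(2) fg g0 by simp
  qed
  then have "coprime c p" using p(1) by (metis prime_imp_coprime coprime_commute)
  then obtain u v where uv: "u * c + v * p = 1" using bezout_int[of c p] by auto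
  have "of_int u * (of_int c + x * poly (map_poly of_int g) x) \<in> Q" using f' by (rule Q_mult[rotated]) simp
  moreover have "of_int v * of_int p \<in> Q" using p(2)[of p] by (intro Q_mult) auto
  ultimately have "of_int u * (of_int c + x * poly (map_poly of_int g) x) + of_int v * of_int p \<in> Q" by (rule Q_add)
  also have "of_int u * (of_int c + x * poly (map_poly of_int g) x) + of_int v * of_int p
      = of_int (u * c + v * p) + of_int u * x * poly (map_poly of_int g) x"
    by (simp add: algebra_simps)
  also have "\<dots> = 1 - x * (- of_int u * poly (map_poly of_int g) x)" unfolding uv by simp
  finally show ?thesis using poly_in by (intro bexI[of _ "- of_int u * poly (map_poly of_int g) x"]) auto
qed

lemma loc_mem_field: "x \<in> loc Q \<Longrightarrow> x \<in> K" unfolding loc_def by blast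

lemma loc_of_OK: "x \<in> OK K \<Longrightarrow> x \<in> loc Q"
  unfolding loc_def using OK_mem_field by (auto intro!: bexI[of _ 1])

lemma loc_mult: assumes "x \<in> loc Q" "y \<in> loc Q" shows "x * y \<in> loc Q"
proof -
  obtain s t where "s \<in> OK K - Q" "s * x \<in> OK K" "t \<in> OK K - Q" "t * y \<in> OK K"
    using assms unfolding loc_def by blast
  then have "s * t \<in> OK K - Q" "(s * t) * (x * y) \<in> OK K"
    using Q_prime[of s t] OK_mult[of "s * x" "t * y"] by (auto simp: mult_ac)
  then show ?thesis using assms unfolding loc_def by blast
qed

lemma loc_add: assumes "x \<in> loc Q" "y \<in> loc Q" shows "x + y \<in> loc Q"
proof -
  obtain s t where st: "s \<in> OK K - Q" "s * x \<in> OK K" "t \<in> OK K - Q" "t * y \<in> OK K"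
    using assms unfolding loc_def by blast
  then have "s * t \<in> OK K - Q" using Q_prime by blast
  moreover have "t * (s * x) + s * (t * y) \<in> OK K" using st by auto
  then have "(s * t) * (x + y) \<in> OK K" by (simp add: algebra_simps)
  moreover have "x + y \<in> K" using assms loc_mem_field by auto
  ultimately show ?thesis unfolding loc_def by blast
qed

lemma inverse_in_loc: assumes "x \<in> OK K" "x \<notin> Q" shows "inverse x \<in> loc Q"
proof -
  have "x \<noteq> 0" using assms(2) by auto
  then have "x \<in> OK K - Q" "x * inverse x \<in> OK K" using assms by auto
  then show ?thesis unfolding loc_def using assms OK_mem_field by blast
qed

lemma inverse_notin_loc: assumes "x \<in> Q" "x \<noteq> 0" shows "inverse x \<notin> loc Q"
proof
  assume "inverse x \<in> loc Q"
  then obtain s where s: "s \<in> OK K - Q" "s * inverse x \<in> OK K" unfolding loc_def by blast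
  then have "x * (s * inverse x) \<in> Q" using Q_mult'[OF s(2) assms(1)] by simp
  also have "x * (s * inverse x) = s" using assms(2) by (simp add: field_simps)
  finally have "s \<in> Q" .
  then show False using s by blast
qed

text \<open>Otherwise all quotient coefficients of a primitive polynomial of \<open>x\<close> lie in \<open>Q\<close>, and with
  them the coefficients of the polynomial itself.\<close>

lemma loc_valuation:
  assumes x: "x \<in> K"
  shows "x \<in> loc Q \<or> inverse x \<in> loc Q"
proof (rule ccontr)
  assume neg: "\<not> (x \<in> loc Q \<or> inverse x \<in> loc Q)"
  obtain p :: "int poly" where p: "content p = 1" "poly (map_poly of_int p) x = 0"
    using primitive_poly[OF x] by blast
  define n where "n = degree p"
  define b where "b m = (\<Sum>i=m..n. of_int (coeff p i) * x ^ (i - m))" for m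
  have eq: "(\<Sum>i\<le>n. of_int (coeff p i) * x ^ i) = 0"
    using p(2) by (simp add: poly_altdef n_def)
  have b_int: "b m \<in> OK K" for m
    using alg_integer_quotient_coeff[OF eq, of m] x unfolding b_def OK_def by auto
  have rec: "b m = of_int (coeff p m) + x * b (Suc m)" for m
  proof (cases "m \<le> n")
    case True
    have "b m = of_int (coeff p m) + (\<Sum>i=Suc m..n. of_int (coeff p i) * x ^ (i - m))"
      unfolding b_def using True by (subst sum.atLeast_Suc_atMost) auto
    also have "(\<Sum>i=Suc m..n. of_int (coeff p i) * x ^ (i - m)) = x * b (Suc m)"
      unfolding b_def sum_distrib_left
    proof (rule sum.cong[OF refl])
      fix i assume "i \<in> {Suc m..n}"
      then have "i - m = Suc (i - Suc m)" by auto
      then show "of_int (coeff p i) * x ^ (i - m) = x * (of_int (coeff p i) * x ^ (i - Suc m))" by simp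
    qed
    finally show ?thesis .
  next
    case False
    then show ?thesis unfolding b_def by (auto simp: n_def coeff_eq_0)
  qed
  have xb_int: "x * b (Suc m) \<in> OK K" for m
    using OK_diff[OF b_int[of m] OK_of_int[of "coeff p m"]] rec[of m] by simp
  have bQ: "b (Suc m) \<in> Q" for m
  proof (rule ccontr)
    assume "b (Suc m) \<notin> Q"
    then have "x \<in> loc Q" unfolding loc_def using b_int xb_int[of m] x by (auto simp: mult.commute)
    with neg show False by blast
  qed
  have xbQ: "x * b (Suc m) \<in> Q" for m
  proof (rule ccontr)
    assume nQ: "x * b (Suc m) \<notin> Q"
    then have "inverse (x * b (Suc m)) \<in> loc Q" using inverse_in_loc xb_int by blast
    then have "b (Suc m) * inverse (x * b (Suc m)) \<in> loc Q" using loc_mult loc_of_OK b_int by blast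
    moreover have "b (Suc m) \<noteq> 0" using nQ by auto
    then have "b (Suc m) * inverse (x * b (Suc m)) = inverse x" by (simp add: field_simps)
    ultimately have "inverse x \<in> loc Q" by metis
    with neg show False by blast
  qed
  have b0: "b 0 = 0" using eq by (simp add: b_def atMost_atLeast0)
  obtain r :: int where r: "prime r" "\<And>m. of_int m \<in> Q \<longleftrightarrow> r dvd m" using residue_char by blast
  have "r dvd coeff p m" for m
  proof -
    have "b m \<in> Q"
    proof (cases m)
      case 0
      then show ?thesis using b0 by simp
    next
      case (Suc l)
      then show ?thesis using bQ by simp
    qed
    then have "b m - x * b (Suc m) \<in> Q" using xbQ by (rule Q_diff)
    then have "of_int (coeff p m) \<in> Q" unfolding rec[of m] by (simp only: add_diff_cancel_right')
    then show ?thesis unfolding r(2) .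
  qed
  then have "[:r:] dvd p" by (simp add: const_poly_dvd_iff)
  then have "r dvd content p" by (simp add: const_poly_dvd_iff_dvd_content)
  then show False using p r by auto
qed

lemma loc_total:
  assumes "x \<in> K" "y \<in> K"
  shows "(\<exists>r\<in>loc Q. x = r * y) \<or> (\<exists>r\<in>loc Q. y = r * x)"
proof (cases "x = 0 \<or> y = 0")
  case True
  then show ?thesis using loc_of_OK[OF OK_0] by auto
next
  case False
  then have "x / y \<in> loc Q \<or> inverse (x / y) \<in> loc Q" using assms by (intro loc_valuation) auto
  then show ?thesis
  proof
    assume "x / y \<in> loc Q"
    then show ?thesis using False by (intro disjI1 bexI[of _ "x / y"]) auto
  next
    assume "inverse (x / y) \<in> loc Q"
    then show ?thesis using False by (intro disjI2 bexI[of _ "inverse (x / y)"]) auto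
  qed
qed

text \<open>Divisibility in the valuation ring is total, so one member of a finite family divides
  all others: finitely generated ideals are locally principal.\<close>

lemma dominating:
  assumes "\<And>i. i < (n :: nat) \<Longrightarrow> a i \<in> K" "0 < n"
  shows "\<exists>j<n. \<forall>i<n. \<exists>r\<in>loc Q. a i = r * a j"
  using assms
proof (induction n)
  case (Suc n)
  show ?case
  proof (cases "n = 0")
    case True
    then show ?thesis using loc_of_OK[OF OK_1] by (intro exI[of _ 0]) auto
  next
    case False
    then obtain j where j: "j < n" "\<And>i. i < n \<Longrightarrow> \<exists>r\<in>loc Q. a i = r * a j" using Suc by auto
    have "(\<exists>r\<in>loc Q. a n = r * a j) \<or> (\<exists>r\<in>loc Q. a j = r * a n)"
      using Suc.prems j(1) by (intro loc_total) auto
    then show ?thesis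
    proof
      assume "\<exists>r\<in>loc Q. a n = r * a j"
      then show ?thesis using j by (intro exI[of _ j]) (auto simp: less_Suc_eq)
    next
      assume "\<exists>r\<in>loc Q. a j = r * a n"
      then obtain r where r: "r \<in> loc Q" "a j = r * a n" by blast
      have "\<exists>r\<in>loc Q. a i = r * a n" if i: "i < Suc n" for i
      proof (cases "i = n")
        case True
        then show ?thesis using loc_of_OK[OF OK_1] by (intro bexI[of _ 1]) auto
      next
        case False
        then obtain t where "t \<in> loc Q" "a i = t * a j" using j(2)[of i] i by auto
        then show ?thesis using r loc_mult[of t r] by (intro bexI[of _ "t * r"]) auto
      qed
      then show ?thesis by blast
    qed
  qed
qed simp

lemma common_denominator:
  assumes "\<And>i. i < (n :: nat) \<Longrightarrow> r i \<in> loc Q"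
  shows "\<exists>s\<in>OK K - Q. \<forall>i<n. s * r i \<in> OK K"
  using assms
proof (induction n)
  case 0
  then show ?case by (intro bexI[of _ 1]) auto
next
  case (Suc n)
  have "\<exists>s\<in>OK K - Q. \<forall>i<n. s * r i \<in> OK K" using Suc.prems by (intro Suc.IH) simp
  then obtain s where s: "s \<in> OK K - Q" "\<And>i. i < n \<Longrightarrow> s * r i \<in> OK K" by blast
  have "r n \<in> loc Q" using Suc.prems by simp
  then obtain t where t: "t \<in> OK K - Q" "t * r n \<in> OK K" unfolding loc_def by blast
  have "(s * t) * r i \<in> OK K" if "i < Suc n" for i
  proof (cases "i = n")
    case True
    then show ?thesis using OK_mult[OF _ t(2), of s] s by (auto simp: mult_ac)
  next
    case False
    then show ?thesis using OK_mult[OF _ s(2), of t i] t that by (auto simp: mult_ac)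
  qed
  moreover have "s * t \<in> OK K - Q" using s t Q_prime by auto
  ultimately show ?case by blast
qed

definition loc_unit :: "complex \<Rightarrow> bool" where
  "loc_unit x \<longleftrightarrow> x \<in> loc Q \<and> inverse x \<in> loc Q"

lemma loc_unit_mult: "loc_unit x \<Longrightarrow> loc_unit y \<Longrightarrow> loc_unit (x * y)"
  unfolding loc_unit_def by (auto simp: loc_mult)

lemma loc_unit_inverse: "loc_unit (inverse x) \<longleftrightarrow> loc_unit x"
  unfolding loc_unit_def by auto

text \<open>An element of \<open>Q\<close> outside the square of \<open>Q\<close> generates the
  maximal ideal of the localization. If \<open>t / \<pi>\<close> is not local, then
  \<open>\<pi> / t\<close> is local and not a unit, so \<open>\<pi> = t * (\<pi> / t)\<close> is a
  product of two nonunits; clearing denominators puts \<open>\<pi>\<close> into the square.\<close>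

lemma divide_uniformizer:
  assumes pi: "\<pi> \<in> Q" "\<pi> \<notin> ideal_prod Q Q" and t: "t \<in> loc Q" "\<not> loc_unit t"
  shows "t / \<pi> \<in> loc Q"
proof (cases "t = 0")
  case True
  then show ?thesis using loc_of_OK[OF OK_0] by simp
next
  case t0: False
  have QQ: "x * y \<in> ideal_prod Q Q" if "x \<in> Q" "y \<in> Q" for x y
    unfolding ideal_prod_def using that
    by (intro CollectI exI[of _ 1] exI[of _ "\<lambda>_. x"] exI[of _ "\<lambda>_. y"]) auto
  have QQ2: "x * y + u * v \<in> ideal_prod Q Q" if "x \<in> Q" "y \<in> Q" "u \<in> Q" "v \<in> Q" for x y u v
    unfolding ideal_prod_def using that
    by (intro CollectI exI[of _ 2] exI[of _ "\<lambda>i. if i = 0 then x else u"] exI[of _ "\<lambda>i. if i = 0 then y else v"])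
      (auto simp: numeral_2_eq_2)
  have pi0: "\<pi> \<noteq> 0" using pi QQ[of 0 0] by auto
  show ?thesis
  proof (rule ccontr)
    assume n: "t / \<pi> \<notin> loc Q"
    have "t / \<pi> \<in> K" using t pi Q_subset loc_mem_field OK_mem_field by blast
    from loc_valuation[OF this] n have "\<pi> / t \<in> loc Q" by simp
    then obtain s' where s': "s' \<in> OK K" "s' \<notin> Q" "s' * (\<pi> / t) \<in> OK K" unfolding loc_def by blast
    obtain s where s: "s \<in> OK K" "s \<notin> Q" "s * t \<in> OK K" using t(1) unfolding loc_def by blast
    have stQ: "s * t \<in> Q"
    proof (rule ccontr)
      assume "s * t \<notin> Q"
      then have "s * inverse (s * t) \<in> loc Q" using s inverse_in_loc loc_mult loc_of_OK by blast
      moreover have "s \<noteq> 0" using s(2) by auto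
      then have "s * inverse (s * t) = inverse t" by (simp add: field_simps)
      ultimately have "inverse t \<in> loc Q" by metis
      then show False using t by (simp add: loc_unit_def)
    qed
    have "s' * (\<pi> / t) \<in> Q"
    proof (rule ccontr)
      assume "s' * (\<pi> / t) \<notin> Q"
      then have "s' * inverse (s' * (\<pi> / t)) \<in> loc Q" using s' inverse_in_loc loc_mult loc_of_OK by blast
      moreover have "s' \<noteq> 0" using s'(2) by auto
      then have "s' * inverse (s' * (\<pi> / t)) = t / \<pi>" by (simp add: field_simps)
      ultimately show False using n by metis
    qed
    obtain y where y: "y \<in> OK K" "1 - (s * s') * y \<in> Q"
      using residue_inverse[of "s * s'"] s s' Q_prime by blast
    \<comment> \<open>The denominators \<open>s\<close>, \<open>s'\<close> are removed by an inverse
      \<open>y\<close> of \<open>s * s'\<close> modulo \<open>Q\<close>: the first product is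
      \<open>s * s' * y * \<pi>\<close> and the second is the remaining part of
      \<open>\<pi>\<close>.\<close>
    have "(s * t) * (y * (s' * (\<pi> / t))) + \<pi> * (1 - (s * s') * y) \<in> ideal_prod Q Q"
      by (rule QQ2[OF stQ Q_mult[OF y(1) \<open>s' * (\<pi> / t) \<in> Q\<close>] pi(1) y(2)])
    also have "(s * t) * (y * (s' * (\<pi> / t))) + \<pi> * (1 - (s * s') * y) = \<pi>"
      using t0 by (simp add: field_simps)
    finally show False using pi by blast
  qed
qed

text \<open>Finiteness of the valuation comes from the maximality of primes. If no power of
  \<open>\<pi>\<close> matches \<open>z\<close>, then the elements divisible by every power of
  \<open>\<pi>\<close> form a nonzero prime ideal \<open>J\<close> inside \<open>Q\<close> that
  misses \<open>\<pi>\<close>; but then \<open>\<pi>\<close> would be invertible modulo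
  \<open>J\<close>, and so modulo \<open>Q\<close>.\<close>

lemma uniformizer_power:
  assumes pi: "\<pi> \<in> Q" "\<pi> \<notin> ideal_prod Q Q" and z: "z \<in> OK K" "z \<noteq> 0"
  shows "\<exists>n. loc_unit (z / \<pi> ^ n)"
proof (rule ccontr)
  assume neg: "\<nexists>n. loc_unit (z / \<pi> ^ n)"
  have piO: "\<pi> \<in> OK K" using pi Q_subset by blast
  have "0 \<in> ideal_prod Q Q" unfolding ideal_prod_def by (intro CollectI exI[of _ 0]) auto
  then have pi0: "\<pi> \<noteq> 0" using pi by auto
  have pinv: "inverse \<pi> \<notin> loc Q" using inverse_notin_loc pi pi0 by blast
  define J where "J = {y \<in> OK K. \<forall>n. y / \<pi> ^ n \<in> loc Q}"
  have "z / \<pi> ^ n \<in> loc Q" for n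
  proof (induction n)
    case 0
    then show ?case using z loc_of_OK by simp
  next
    case (Suc n)
    then show ?case using divide_uniformizer[OF pi Suc] neg by (simp add: field_simps)
  qed
  then have zJ: "z \<in> J" using z by (simp add: J_def)
  have J_unit: "\<exists>n. loc_unit (a / \<pi> ^ n)" if a: "a \<in> OK K" "a \<notin> J" for a
  proof (rule ccontr)
    assume nega: "\<nexists>n. loc_unit (a / \<pi> ^ n)"
    have "a / \<pi> ^ n \<in> loc Q" for n
    proof (induction n)
      case 0
      then show ?case using a loc_of_OK by simp
    next
      case (Suc n)
      then show ?case using divide_uniformizer[OF pi Suc] nega by (simp add: field_simps)
    qed
    then show False using a by (simp add: J_def)
  qed
  have J_prime: "a \<in> J \<or> b \<in> J" if ab: "a \<in> OK K" "b \<in> OK K" "a * b \<in> J" for a b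
  proof (rule ccontr)
    assume "\<not> (a \<in> J \<or> b \<in> J)"
    then obtain n m where nm: "loc_unit (a / \<pi> ^ n)" "loc_unit (b / \<pi> ^ m)" using J_unit ab by blast
    then have "loc_unit (a / \<pi> ^ n * (b / \<pi> ^ m))" by (rule loc_unit_mult)
    then have u: "inverse (a * b / \<pi> ^ (n + m)) \<in> loc Q"
      by (simp add: loc_unit_def power_add)
    have "a * b / \<pi> ^ Suc (n + m) \<in> loc Q" using ab unfolding J_def by blast
    from loc_mult[OF u this] have "inverse (a * b / \<pi> ^ (n + m)) * (a * b / \<pi> ^ Suc (n + m)) \<in> loc Q" .
    moreover have "a * b \<noteq> 0" using nm pinv ab \<open>\<not> (a \<in> J \<or> b \<in> J)\<close> loc_of_OK[OF OK_0] by (auto simp: J_def)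
    ultimately show False using pi0 pinv by (simp add: field_simps)
  qed
  have J_frac: "frac_ideal K J"
    unfolding frac_ideal_def
  proof (intro conjI ballI)
    show "J \<subseteq> K" using OK_mem_field by (auto simp: J_def)
    show "0 \<in> J" using loc_of_OK[OF OK_0] by (simp add: J_def)
    show "J \<noteq> {0}" using zJ z by blast
    show "x + y \<in> J" if "x \<in> J" "y \<in> J" for x y
      using that unfolding J_def by (auto simp: add_divide_distrib intro: loc_add)
    show "r * x \<in> J" if "r \<in> OK K" "x \<in> J" for r x
      using that loc_mult[OF loc_of_OK[of r], of "x / \<pi> ^ _"] unfolding J_def by auto
    show "\<exists>d\<in>OK K. d \<noteq> 0 \<and> (\<forall>x\<in>J. d * x \<in> OK K)"
      by (intro bexI[of _ 1]) (auto simp: J_def)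
  qed
  have JQ: "J \<subseteq> Q"
  proof
    fix y assume y: "y \<in> J"
    show "y \<in> Q"
    proof (rule ccontr)
      assume "y \<notin> Q"
      then have "inverse y \<in> loc Q" "y \<noteq> 0" using inverse_in_loc y by (auto simp: J_def)
      moreover have "y / \<pi> ^ 1 \<in> loc Q" using y unfolding J_def by blast
      ultimately have "inverse y * (y / \<pi> ^ 1) \<in> loc Q" by (intro loc_mult)
      then show False using pinv \<open>y \<noteq> 0\<close> by (simp add: field_simps)
    qed
  qed
  have "prime_ideal K J"
    unfolding prime_ideal_def
  proof (intro conjI ballI impI)
    show "J \<subseteq> OK K" by (auto simp: J_def)
    show "J \<noteq> OK K" using JQ Q_1 OK_1 by blast
  qed (use J_frac J_prime in auto)
  then interpret J: num_field_prime K J by unfold_locales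
  have "\<pi> / \<pi> ^ 2 \<notin> loc Q" using pinv pi0 by (simp add: power2_eq_square field_simps)
  then have "\<pi> \<notin> J" unfolding J_def by blast
  then obtain y where y: "y \<in> OK K" "1 - \<pi> * y \<in> J" using J.residue_inverse[OF piO] by blast
  then have "(1 - \<pi> * y) + \<pi> * y \<in> Q" using JQ pi by (intro Q_add Q_mult') auto
  then show False by simp
qed

end

subsection \<open>Extension and contraction of ideals\<close>

locale num_field_ext = base: num_field k + top: num_field K for k K +
  assumes k_subset: "k \<subseteq> K"
begin

lemma OK_base_iff: "x \<in> OK k \<longleftrightarrow> x \<in> OK K \<and> x \<in> k"
  using k_subset by (auto simp: OK_def)

text \<open>An ideal of \<open>k\<close> can be recovered from its extension. Locally at a prime of
  \<open>k\<close> the finitely many generators occurring in \<open>x\<close> are multiples of one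
  \<open>a j\<close>, so \<open>x / a j\<close> becomes integral over \<open>k\<close> after a
  denominator, and it lies in \<open>k\<close>.\<close>

lemma ext_ideal_contract:
  assumes I: "frac_ideal k I"
  shows "ext_ideal K I \<inter> k = I"
proof
  show "I \<subseteq> ext_ideal K I \<inter> k"
  proof
    fix x assume "x \<in> I"
    then show "x \<in> ext_ideal K I \<inter> k"
      using base.frac_idealD(1)[OF I] top.OK_1 unfolding ext_ideal_def ideal_prod_def
      by (intro IntI CollectI exI[of _ 1] exI[of _ "\<lambda>_. 1"] exI[of _ "\<lambda>_. x"]) auto
  qed
next
  show "ext_ideal K I \<inter> k \<subseteq> I"
  proof (rule subsetI, rule ccontr)
    fix x assume x: "x \<in> ext_ideal K I \<inter> k" and xI: "x \<notin> I"
    then obtain n :: nat and w a where n: "\<And>i. i < n \<Longrightarrow> w i \<in> OK K" "\<And>i. i < n \<Longrightarrow> a i \<in> I"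
      and xs: "x = (\<Sum>i<n. w i * a i)"
      unfolding ext_ideal_def ideal_prod_def by blast
    have x0: "x \<noteq> 0" using xI base.frac_idealD(2)[OF I] by blast
    then have n0: "0 < n" using xs by (cases n) auto
    have ak: "a i \<in> k" if "i < n" for i using n(2)[OF that] base.frac_idealD(1)[OF I] by blast
    \<comment> \<open>The denominators that carry \<open>x\<close> into \<open>I\<close>: an ideal
      without 1 as \<open>x\<close> is not in \<open>I\<close>, and nonzero because it contains an
      integer that clears the denominator of \<open>x / b\<close>.\<close>
    define A where "A = {s \<in> OK k. s * x \<in> I}"
    obtain b where b: "b \<in> I" "b \<noteq> 0" using base.frac_idealD(5)[OF I] by blast
    have "x / b \<in> k" using x b base.frac_idealD(1)[OF I] by blast
    then obtain m :: int where m: "m \<noteq> 0" "of_int m * (x / b) \<in> OK k"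
      by (rule base.int_multiple_integral)
    have "(of_int m * (x / b)) * b \<in> I" using m b base.frac_idealD(4)[OF I] by blast
    then have mA: "of_int m \<in> A" using b(2) unfolding A_def by auto
    have "\<exists>P. prime_ideal k P \<and> A \<subseteq> P"
    proof (rule base.exists_prime_ideal_above)
      show "A \<subseteq> OK k" by (auto simp: A_def)
      show "0 \<in> A" using base.frac_idealD(2)[OF I] by (simp add: A_def)
      show "1 \<notin> A" using xI by (simp add: A_def)
      show "of_int m \<in> A" "of_int m \<noteq> (0 :: complex)" using mA m by auto
      show "u + v \<in> A" if "u \<in> A" "v \<in> A" for u v
        using that base.frac_idealD(3)[OF I] by (auto simp: A_def distrib_right)
      show "r * u \<in> A" if "r \<in> OK k" "u \<in> A" for r u
        using that base.frac_idealD(4)[OF I, of r "u * x"] by (auto simp: A_def mult.assoc)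
    qed
    then obtain P where P: "prime_ideal k P" "A \<subseteq> P" by blast
    interpret num_field_prime k P by unfold_locales (rule P)
    obtain j where j: "j < n" "\<And>i. i < n \<Longrightarrow> \<exists>r\<in>base.loc P. a i = r * a j"
      using dominating[of n a] ak n0 by blast
    define r where "r i = (SOME r. r \<in> base.loc P \<and> a i = r * a j)" for i
    have r: "r i \<in> base.loc P" "a i = r i * a j" if "i < n" for i
    proof -
      have "\<exists>r. r \<in> base.loc P \<and> a i = r * a j" using j(2)[OF that] by blast
      from someI_ex[OF this] show "r i \<in> base.loc P" "a i = r i * a j" unfolding r_def by blast+
    qed
    obtain s where s: "s \<in> OK k - P" "\<And>i. i < n \<Longrightarrow> s * r i \<in> OK k"
      using common_denominator[of n r] r(1) by blast
    have aj0: "a j \<noteq> 0"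
    proof
      assume "a j = 0"
      then have "x = 0" unfolding xs using r(2) by (intro sum.neutral) auto
      with x0 show False by blast
    qed
    define y where "y = (\<Sum>i<n. w i * (s * r i))"
    have "w i * (s * r i) \<in> OK K" if "i < n" for i
      using n(1)[OF that] s(2)[OF that] OK_base_iff by (intro top.OK_mult[of "w i" "s * r i"]) auto
    then have yK: "y \<in> OK K" unfolding y_def by (intro top.OK_sum) auto
    have sx: "s * x = y * a j"
      unfolding xs y_def sum_distrib_left sum_distrib_right
      by (rule sum.cong[OF refl]) (use r(2) in \<open>simp add: mult_ac\<close>)
    then have "y = s * x / a j" using aj0 by simp
    also have "\<dots> \<in> k" using s x ak[OF j(1)] base.OK_mem_field by blast
    finally have "y \<in> OK k" using yK OK_base_iff by blast
    then have "s * x \<in> I" unfolding sx by (rule base.frac_idealD(4)[OF I _ n(2)[OF j(1)]])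
    then have "s \<in> A" using s by (simp add: A_def)
    then show False using P(2) s by blast
  qed
qed

end

subsection \<open>Embeddings and Galois groups\<close>

context complex_field
begin

lemma emb_add: "embedding K \<sigma> \<Longrightarrow> x \<in> K \<Longrightarrow> y \<in> K \<Longrightarrow> \<sigma> (x + y) = \<sigma> x + \<sigma> y"
  and emb_mult: "embedding K \<sigma> \<Longrightarrow> x \<in> K \<Longrightarrow> y \<in> K \<Longrightarrow> \<sigma> (x * y) = \<sigma> x * \<sigma> y"
  and emb_1: "embedding K \<sigma> \<Longrightarrow> \<sigma> 1 = 1"
  unfolding embedding_def by blast+

lemma emb_0: "embedding K \<sigma> \<Longrightarrow> \<sigma> 0 = 0"
  using emb_add[of \<sigma> 0 0] by simp

lemma emb_uminus: assumes "embedding K \<sigma>" "x \<in> K" shows "\<sigma> (- x) = - \<sigma> x"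
proof -
  have "\<sigma> (- x) + \<sigma> x = 0" using emb_add[OF assms(1), of "- x" x] assms(2) emb_0[OF assms(1)] by auto
  then show ?thesis by (simp add: eq_neg_iff_add_eq_0)
qed

lemma emb_diff: assumes "embedding K \<sigma>" "x \<in> K" "y \<in> K" shows "\<sigma> (x - y) = \<sigma> x - \<sigma> y"
  using emb_add[OF assms(1,2), of "- y"] emb_uminus[OF assms(1,3)] assms by auto

lemma emb_nonzero: assumes "embedding K \<sigma>" "x \<in> K" "x \<noteq> 0" shows "\<sigma> x \<noteq> 0"
proof
  assume "\<sigma> x = 0"
  then have "\<sigma> (x * inverse x) = 0" using emb_mult[OF assms(1,2) inverse_mem[OF assms(2)]] by simp
  then show False using assms(3) emb_1[OF assms(1)] by simp
qed

lemma emb_inverse: assumes "embedding K \<sigma>" "x \<in> K" shows "\<sigma> (inverse x) = inverse (\<sigma> x)"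
proof (cases "x = 0")
  case True
  then show ?thesis using emb_0[OF assms(1)] by simp
next
  case False
  have "\<sigma> (x * inverse x) = \<sigma> x * \<sigma> (inverse x)" using emb_mult[OF assms inverse_mem[OF assms(2)]] .
  then have "\<sigma> x * \<sigma> (inverse x) = 1" using False emb_1[OF assms(1)] by simp
  then show ?thesis by (simp add: inverse_unique)
qed

lemma emb_divide: assumes "embedding K \<sigma>" "x \<in> K" "y \<in> K" shows "\<sigma> (x / y) = \<sigma> x / \<sigma> y"
  using emb_mult[OF assms(1,2) inverse_mem[OF assms(3)]] emb_inverse[OF assms(1,3)]
  by (simp add: divide_inverse)

lemma emb_power: "embedding K \<sigma> \<Longrightarrow> x \<in> K \<Longrightarrow> \<sigma> (x ^ n) = \<sigma> x ^ n"
  by (induction n) (auto simp: emb_1 emb_mult power_mem)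

lemma emb_sum: "embedding K \<sigma> \<Longrightarrow> (\<And>i. i \<in> I \<Longrightarrow> f i \<in> K) \<Longrightarrow> \<sigma> (sum f I) = (\<Sum>i\<in>I. \<sigma> (f i))"
  by (induction I rule: infinite_finite_induct) (auto simp: emb_0 emb_add sum_mem)

lemma emb_prod: "embedding K \<sigma> \<Longrightarrow> (\<And>i. i \<in> I \<Longrightarrow> f i \<in> K) \<Longrightarrow> \<sigma> (prod f I) = (\<Prod>i\<in>I. \<sigma> (f i))"
  by (induction I rule: infinite_finite_induct) (auto simp: emb_1 emb_mult prod_mem)

lemma emb_of_nat: "embedding K \<sigma> \<Longrightarrow> \<sigma> (of_nat n) = of_nat n"
  by (induction n) (auto simp: emb_0 emb_1 emb_add)

lemma emb_of_int: "embedding K \<sigma> \<Longrightarrow> \<sigma> (of_int n) = of_int n"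
  by (cases n rule: int_cases2) (auto simp: emb_of_nat emb_uminus)

lemma emb_inj_on: assumes "embedding K \<sigma>" shows "inj_on \<sigma> K"
proof (rule inj_onI)
  fix x y assume "x \<in> K" "y \<in> K" "\<sigma> x = \<sigma> y"
  then have "\<sigma> (x - y) = 0" "x - y \<in> K" using emb_diff[OF assms] by auto
  then show "x = y" using emb_nonzero[OF assms, of "x - y"] by auto
qed

lemma emb_alg_integer: assumes "embedding K \<sigma>" "x \<in> OK K" shows "alg_integer (\<sigma> x)"
proof -
  from assms(2) obtain p :: "int poly" where p: "lead_coeff p = 1" "poly (map_poly of_int p) x = 0" and x: "x \<in> K"
    unfolding OK_def alg_integer_def by blast
  have "poly (map_poly of_int p) (\<sigma> x) = (\<Sum>i\<le>degree p. of_int (coeff p i) * \<sigma> x ^ i)"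
    by (simp add: poly_altdef)
  also have "\<dots> = \<sigma> (\<Sum>i\<le>degree p. of_int (coeff p i) * x ^ i)"
  proof (subst emb_sum[OF assms(1)])
    fix i show "of_int (coeff p i) * x ^ i \<in> K" using x by blast
  next
    show "(\<Sum>i\<le>degree p. of_int (coeff p i) * \<sigma> x ^ i) = (\<Sum>i\<le>degree p. \<sigma> (of_int (coeff p i) * x ^ i))"
      using x by (simp add: emb_mult[OF assms(1)] emb_of_int[OF assms(1)] emb_power[OF assms(1)] power_mem)
  qed
  also have "(\<Sum>i\<le>degree p. of_int (coeff p i) * x ^ i) = 0" using p(2) by (simp add: poly_altdef)
  finally have "poly (map_poly of_int p) (\<sigma> x) = 0" using emb_0[OF assms(1)] by simp
  then show ?thesis using p(1) unfolding alg_integer_def by blast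
qed

text \<open>Dedekind's lemma. Distinct functions are required to differ at a point of
  \<open>K\<close>, since an embedding is unconstrained outside \<open>K\<close>.\<close>

lemma dedekind_independence:
  assumes "finite S" "\<And>\<sigma>. \<sigma> \<in> S \<Longrightarrow> embedding K \<sigma>"
    and "\<And>\<sigma> \<rho>. \<sigma> \<in> S \<Longrightarrow> \<rho> \<in> S \<Longrightarrow> \<sigma> \<noteq> \<rho> \<Longrightarrow> \<exists>x\<in>K. \<sigma> x \<noteq> \<rho> x"
    and "\<And>x. x \<in> K \<Longrightarrow> (\<Sum>\<sigma>\<in>S. c \<sigma> * \<sigma> x) = 0" "\<sigma> \<in> S"
  shows "c \<sigma> = 0"
  using assms
proof (induction S arbitrary: c \<sigma> rule: finite_induct)
  case (insert \<rho> S)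
  have main: "c \<tau> = 0" if \<tau>: "\<tau> \<in> S" for \<tau>
  proof -
    from \<tau> insert.hyps have "\<tau> \<noteq> \<rho>" by blast
    then obtain y where y: "y \<in> K" "\<tau> y \<noteq> \<rho> y" using insert.prems(2)[of \<tau> \<rho>] \<tau> by blast
    \<comment> \<open>These are the coefficients of the relation at \<open>y * x\<close> minus
      \<open>\<rho> y\<close> times the relation at \<open>x\<close>; the term of
      \<open>\<rho>\<close> cancels.\<close>
    define d where "d \<sigma> = c \<sigma> * (\<sigma> y - \<rho> y)" for \<sigma>
    have "d \<tau> = 0"
    proof (rule insert.IH[of d \<tau>])
      fix x assume x: "x \<in> K"
      have "0 = (\<Sum>\<sigma>\<in>insert \<rho> S. c \<sigma> * \<sigma> (y * x)) - \<rho> y * (\<Sum>\<sigma>\<in>insert \<rho> S. c \<sigma> * \<sigma> x)"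
        using insert.prems(3) x y by auto
      also have "\<dots> = (\<Sum>\<sigma>\<in>insert \<rho> S. c \<sigma> * \<sigma> (y * x) - \<rho> y * (c \<sigma> * \<sigma> x))"
        by (simp only: sum_distrib_left sum_subtractf)
      also have "\<dots> = (\<Sum>\<sigma>\<in>insert \<rho> S. d \<sigma> * \<sigma> x)"
        by (rule sum.cong[OF refl]) (use insert.prems(1) x y in \<open>auto simp: d_def emb_mult algebra_simps\<close>)
      also have "\<dots> = (\<Sum>\<sigma>\<in>S. d \<sigma> * \<sigma> x)" using insert.hyps by (simp add: d_def)
      finally show "(\<Sum>\<sigma>\<in>S. d \<sigma> * \<sigma> x) = 0" by simp
    qed (use insert.prems \<tau> in auto)
    then show ?thesis using y by (simp add: d_def)
  qed
  have "(\<Sum>\<sigma>\<in>insert \<rho> S. c \<sigma> * \<sigma> 1) = 0" using insert.prems(3) by blast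
  then have "c \<rho> * \<rho> 1 = 0" using main insert.hyps by simp
  then have "c \<rho> = 0" using emb_1[of \<rho>] insert.prems(1) by simp
  then show ?case using main insert.prems(4) by blast
qed simp

lemma Gal_embedding: "\<sigma> \<in> Gal K F \<Longrightarrow> embedding K \<sigma>"
  and Gal_fixes: "\<sigma> \<in> Gal K F \<Longrightarrow> x \<in> F \<Longrightarrow> \<sigma> x = x"
  and Gal_outside: "\<sigma> \<in> Gal K F \<Longrightarrow> x \<notin> K \<Longrightarrow> \<sigma> x = x"
  and Gal_bij: "\<sigma> \<in> Gal K F \<Longrightarrow> bij_betw \<sigma> K K"
  unfolding Gal_def by blast+

lemma Gal_mem: "\<sigma> \<in> Gal K F \<Longrightarrow> x \<in> K \<Longrightarrow> \<sigma> x \<in> K"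
  using Gal_bij[of \<sigma> F] by (rule bij_betw_apply)

lemma Gal_OK: "\<sigma> \<in> Gal K F \<Longrightarrow> x \<in> OK K \<Longrightarrow> \<sigma> x \<in> OK K"
  using emb_alg_integer[OF Gal_embedding] Gal_mem OK_mem_field unfolding OK_def by blast

lemma Gal_eqI: "\<sigma> \<in> Gal K F \<Longrightarrow> \<rho> \<in> Gal K F \<Longrightarrow> (\<And>x. x \<in> K \<Longrightarrow> \<sigma> x = \<rho> x) \<Longrightarrow> \<sigma> = \<rho>"
  by (rule ext) (metis Gal_outside)

lemma Gal_comp: assumes "\<sigma> \<in> Gal K F" "\<rho> \<in> Gal K F" shows "\<sigma> \<circ> \<rho> \<in> Gal K F"
  unfolding Gal_def
proof (intro CollectI conjI ballI allI impI)
  show "embedding K (\<sigma> \<circ> \<rho>)"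
    unfolding embedding_def using assms
    by (auto simp: emb_1 emb_add emb_mult Gal_embedding Gal_mem)
  show "bij_betw (\<sigma> \<circ> \<rho>) K K" using Gal_bij assms by (blast intro: bij_betw_trans)
qed (use assms in \<open>auto simp: Gal_fixes Gal_outside\<close>)

lemma Gal_comp_inj: "\<sigma> \<in> Gal K F \<Longrightarrow> inj_on (\<lambda>\<rho>. \<sigma> \<circ> \<rho>) (Gal K F)"
proof (rule inj_onI)
  fix \<rho> \<rho>' assume a: "\<sigma> \<in> Gal K F" "\<rho> \<in> Gal K F" "\<rho>' \<in> Gal K F" "\<sigma> \<circ> \<rho> = \<sigma> \<circ> \<rho>'"
  show "\<rho> = \<rho>'"
  proof (rule Gal_eqI[OF a(2,3)])
    fix x assume x: "x \<in> K"
    have "\<sigma> (\<rho> x) = \<sigma> (\<rho>' x)" using a(4) by (metis comp_apply)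
    then show "\<rho> x = \<rho>' x"
      using emb_inj_on[OF Gal_embedding[OF a(1)]] Gal_mem a x by (auto dest: inj_onD)
  qed
qed

text \<open>Left translation is an injective self-map of a finite set. The group inverses are drawn
  from this surjectivity.\<close>

lemma Gal_comp_image: "finite (Gal K F) \<Longrightarrow> \<sigma> \<in> Gal K F \<Longrightarrow> (\<lambda>\<rho>. \<sigma> \<circ> \<rho>) ` Gal K F = Gal K F"
  by (rule endo_inj_surj) (auto intro: Gal_comp Gal_comp_inj)

lemma Gal_id: assumes "F \<subseteq> K" shows "id \<in> Gal K F"
  unfolding Gal_def embedding_def by auto

lemma Gal_inverse:
  assumes "finite (Gal K F)" "F \<subseteq> K" "\<sigma> \<in> Gal K F"
  obtains \<rho> where "\<rho> \<in> Gal K F" "\<And>x. \<sigma> (\<rho> x) = x" "\<And>x. \<rho> (\<sigma> x) = x"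
proof -
  obtain \<rho> where \<rho>: "\<rho> \<in> Gal K F" "\<sigma> \<circ> \<rho> = id"
    using Gal_comp_image[OF assms(1,3)] Gal_id[OF assms(2)] by (metis imageE)
  obtain \<rho>' where \<rho>': "\<rho>' \<in> Gal K F" "\<rho> \<circ> \<rho>' = id"
    using Gal_comp_image[OF assms(1) \<rho>(1)] Gal_id[OF assms(2)] by (metis imageE)
  have "\<sigma> = \<rho>'" using \<rho>(2) \<rho>'(2) by (metis comp_assoc comp_id id_comp)
  then show ?thesis using \<rho> \<rho>' by (intro that[of \<rho>]) (metis comp_apply id_apply)+
qed

lemma Gal_separates: "\<sigma> \<in> Gal K F \<Longrightarrow> \<rho> \<in> Gal K F \<Longrightarrow> \<sigma> \<noteq> \<rho> \<Longrightarrow> \<exists>x\<in>K. \<sigma> x \<noteq> \<rho> x"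
  using Gal_eqI by blast

text \<open>Write \<open>x * b 0 = (\<Sum>j. a j * b j)\<close> in a basis \<open>b\<close> over \<open>F\<close>. The matrix of the \<open>\<sigma> (b j)\<close> is square because the
  group order equals the degree, and invertible by Dedekind's lemma. Applying all \<open>\<sigma>\<close> to the
  equation therefore forces \<open>a 0 = x\<close>.\<close>

lemma galois_fixed_field:
  assumes F: "complex_field F" and gal: "galois_ext K F" and sp: "spans K F n0"
    and x: "x \<in> K" "\<And>\<sigma>. \<sigma> \<in> Gal K F \<Longrightarrow> \<sigma> x = x"
  shows "x \<in> F"
proof -
  define n where "n = field_deg K F"
  have FK: "F \<subseteq> K" and fin: "finite (Gal K F)" and card: "card (Gal K F) = n"
    using gal unfolding galois_ext_def n_def by auto
  have "spans K F n" unfolding n_def field_deg_def by (rule LeastI[of _ n0]) (rule sp)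
  then obtain b where b: "\<And>i. i < n \<Longrightarrow> b i \<in> K" "K = {\<Sum>i<n. c i * b i | c. \<forall>i<n. c i \<in> F}"
    unfolding spans_def by blast
  have n0: "n > 0" using card fin Gal_id[OF FK] by (metis card_gt_0_iff empty_iff)
  obtain h where h: "bij_betw h {0..<n} (Gal K F)"
    using ex_bij_betw_nat_finite[OF fin] card by blast
  have hG: "h i \<in> Gal K F" if "i < n" for i using h that by (auto simp: bij_betw_def)
  define S where "S = mat n n (\<lambda>(i,j). h i (b j))"
  have S: "S \<in> carrier_mat n n" by (simp add: S_def)
  have "det S \<noteq> 0"
  proof
    assume "det S = 0"
    then have "det (transpose_mat S) = 0" using det_transpose[OF S] by simp
    then obtain v where v: "v \<in> carrier_vec n" "v \<noteq> 0\<^sub>v n" "transpose_mat S *\<^sub>v v = 0\<^sub>v n"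
      using det_0_iff_vec_prod_zero_field[of "transpose_mat S" n] S by auto
    have rel: "(\<Sum>i<n. v $ i * h i (b j)) = 0" if "j < n" for j
    proof -
      have "(transpose_mat S *\<^sub>v v) $ j = (\<Sum>i<n. h i (b j) * v $ i)"
        using that v(1) by (simp add: S_def scalar_prod_def atLeast0LessThan)
      then show ?thesis using v(3) that by (simp add: mult.commute)
    qed
    define c where "c \<sigma> = v $ (the_inv_into {0..<n} h \<sigma>)" for \<sigma>
    have ch: "c (h i) = v $ i" if "i < n" for i
      unfolding c_def using h that by (subst the_inv_into_f_f) (auto simp: bij_betw_def)
    have zero: "(\<Sum>\<sigma>\<in>Gal K F. c \<sigma> * \<sigma> y) = 0" if y: "y \<in> K" for y
    proof -
      obtain d where d: "\<And>i. i < n \<Longrightarrow> d i \<in> F" "y = (\<Sum>j<n. d j * b j)" using b(2) y by blast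
      have hy: "h i y = (\<Sum>j<n. d j * h i (b j))" if "i < n" for i
        unfolding d(2) using hG[OF that] d(1) b(1) FK
        by (subst emb_sum[OF Gal_embedding]) (auto simp: emb_mult[OF Gal_embedding] Gal_fixes subset_iff intro!: sum.cong)
      have "(\<Sum>\<sigma>\<in>Gal K F. c \<sigma> * \<sigma> y) = (\<Sum>i\<in>{0..<n}. c (h i) * h i y)"
        using sum.reindex_bij_betw[OF h, of "\<lambda>\<sigma>. c \<sigma> * \<sigma> y"] by simp
      also have "\<dots> = (\<Sum>i<n. \<Sum>j<n. d j * (v $ i * h i (b j)))"
        unfolding atLeast0LessThan by (rule sum.cong[OF refl]) (simp add: ch hy sum_distrib_left mult_ac)
      also have "\<dots> = (\<Sum>j<n. d j * (\<Sum>i<n. v $ i * h i (b j)))"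
        by (subst sum.swap) (simp add: sum_distrib_left)
      also have "\<dots> = 0" using rel by simp
      finally show ?thesis .
    qed
    have "c \<sigma> = 0" if "\<sigma> \<in> Gal K F" for \<sigma>
      by (rule dedekind_independence[OF fin Gal_embedding Gal_separates zero that])
    then have "v $ i = 0" if "i < n" for i using ch[OF that] hG[OF that] by simp
    then have "v = 0\<^sub>v n" using v(1) by (intro eq_vecI) auto
    with v(2) show False by blast
  qed
  have "x * b 0 \<in> K" using x b(1) n0 by blast
  then obtain a where a: "\<And>i. i < n \<Longrightarrow> a i \<in> F" "x * b 0 = (\<Sum>j<n. a j * b j)" using b(2) by blast
  define w where "w = vec n (\<lambda>j. (if j = 0 then x else 0) - a j)"
  have "S *\<^sub>v w = 0\<^sub>v n"
  proof (rule eq_vecI)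
    fix i assume "i < dim_vec (0\<^sub>v n :: complex vec)"
    then have i: "i < n" by simp
    have "(S *\<^sub>v w) $ i = (\<Sum>j<n. h i (b j) * ((if j = 0 then x else 0) - a j))"
      using i by (simp add: S_def w_def scalar_prod_def atLeast0LessThan)
    also have "\<dots> = (\<Sum>j<n. if j = 0 then h i (b j) * x else 0) - (\<Sum>j<n. h i (b j) * a j)"
      unfolding sum_subtractf[symmetric] by (rule sum.cong) (auto simp: algebra_simps)
    also have "(\<Sum>j<n. if j = 0 then h i (b j) * x else 0) = h i (b 0) * x"
      using n0 by (simp add: sum.delta)
    also have "h i (b 0) * x = h i (x * b 0)"
      using x(2)[OF hG[OF i]] emb_mult[OF Gal_embedding[OF hG[OF i]] x(1) b(1)[OF n0]] by simp
    also have "h i (x * b 0) = (\<Sum>j<n. h i (b j) * a j)"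
      unfolding a(2)
    proof (subst emb_sum[OF Gal_embedding[OF hG[OF i]]])
      have aj: "a j \<in> K" "b j \<in> K" "h i (a j) = a j" if "j < n" for j
        using a(1)[OF that] b(1)[OF that] FK Gal_fixes[OF hG[OF i]] by auto
      show "a j * b j \<in> K" if "j \<in> {..<n}" for j using aj that by auto
      show "(\<Sum>j<n. h i (a j * b j)) = (\<Sum>j<n. h i (b j) * a j)"
        by (rule sum.cong[OF refl]) (use aj emb_mult[OF Gal_embedding[OF hG[OF i]]] in auto)
    qed
    finally show "(S *\<^sub>v w) $ i = (0\<^sub>v n) $ i" using i by simp
  qed (simp add: S_def)
  moreover have "w \<in> carrier_vec n" by (simp add: w_def)
  ultimately have "w = 0\<^sub>v n"
    using \<open>det S \<noteq> 0\<close> unfolding det_0_iff_vec_prod_zero_field[OF S] by blast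
  then have "w $ 0 = 0" using n0 by simp
  then have "x = a 0" using n0 by (simp add: w_def)
  then show ?thesis using a(1)[OF n0] by simp
qed

text \<open>By independence the sum \<open>b\<close> of all \<open>f \<sigma> * \<sigma> c\<close>
  is nonzero for some \<open>c\<close>. The cocycle identity makes it satisfy
  \<open>f \<tau> * \<tau> b = b\<close>, so the inverse of \<open>b\<close> is the element
  sought.\<close>

lemma hilbert90:
  assumes fin: "finite (Gal K F)"
    and f: "\<And>\<sigma>. \<sigma> \<in> Gal K F \<Longrightarrow> f \<sigma> \<in> K" "\<And>\<sigma>. \<sigma> \<in> Gal K F \<Longrightarrow> f \<sigma> \<noteq> 0"
    and coc: "\<And>\<sigma> \<rho>. \<sigma> \<in> Gal K F \<Longrightarrow> \<rho> \<in> Gal K F \<Longrightarrow> f (\<sigma> \<circ> \<rho>) = f \<sigma> * \<sigma> (f \<rho>)"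
    and ne: "Gal K F \<noteq> {}"
  obtains a where "a \<in> K" "a \<noteq> 0" "\<And>\<sigma>. \<sigma> \<in> Gal K F \<Longrightarrow> f \<sigma> = \<sigma> a / a"
proof -
  have "\<exists>c\<in>K. (\<Sum>\<sigma>\<in>Gal K F. f \<sigma> * \<sigma> c) \<noteq> 0"
  proof (rule ccontr)
    assume "\<not> ?thesis"
    then have zero: "(\<Sum>\<sigma>\<in>Gal K F. f \<sigma> * \<sigma> c) = 0" if "c \<in> K" for c using that by blast
    have "f \<sigma> = 0" if "\<sigma> \<in> Gal K F" for \<sigma>
      by (rule dedekind_independence[OF fin Gal_embedding Gal_separates zero that])
    then show False using f(2) ne by blast
  qed
  then obtain c where c: "c \<in> K" "(\<Sum>\<sigma>\<in>Gal K F. f \<sigma> * \<sigma> c) \<noteq> 0" by blast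
  define b where "b = (\<Sum>\<sigma>\<in>Gal K F. f \<sigma> * \<sigma> c)"
  have fc: "f \<sigma> * \<sigma> c \<in> K" if "\<sigma> \<in> Gal K F" for \<sigma>
    using f(1)[OF that] Gal_mem[OF that c(1)] by (rule mult_mem)
  have b: "b \<in> K" "b \<noteq> 0" using c(2) fc by (auto simp: b_def intro!: sum_mem)
  have tb: "f \<tau> * \<tau> b = b" if \<tau>: "\<tau> \<in> Gal K F" for \<tau>
  proof -
    have "f \<tau> * \<tau> b = (\<Sum>\<sigma>\<in>Gal K F. f \<tau> * \<tau> (f \<sigma> * \<sigma> c))"
      unfolding b_def sum_distrib_left[symmetric]
      by (subst emb_sum[OF Gal_embedding[OF \<tau>]]) (use fc in auto)
    also have "\<dots> = (\<Sum>\<sigma>\<in>Gal K F. f (\<tau> \<circ> \<sigma>) * (\<tau> \<circ> \<sigma>) c)"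
      by (rule sum.cong[OF refl]) (use f c Gal_mem \<tau> coc in \<open>simp add: emb_mult[OF Gal_embedding]\<close>)
    also have "\<dots> = (\<Sum>\<sigma>\<in>(\<lambda>\<sigma>. \<tau> \<circ> \<sigma>) ` Gal K F. f \<sigma> * \<sigma> c)"
      by (subst sum.reindex) (use Gal_comp_inj \<tau> in auto)
    also have "\<dots> = b" unfolding Gal_comp_image[OF fin \<tau>] b_def ..
    finally show ?thesis .
  qed
  show ?thesis
  proof (rule that)
    show "inverse b \<in> K" "inverse b \<noteq> 0" using b by auto
    fix \<sigma> assume \<sigma>: "\<sigma> \<in> Gal K F"
    have "\<sigma> b \<noteq> 0" using emb_nonzero[OF Gal_embedding[OF \<sigma>]] b by blast
    then show "f \<sigma> = \<sigma> (inverse b) / inverse b"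
      using tb[OF \<sigma>] b emb_inverse[OF Gal_embedding[OF \<sigma>]] by (simp add: field_simps)
  qed
qed

end

subsection \<open>Descent of principal ideals\<close>

lemma sum_lessThan_add: "(\<Sum>i<n+m. g i) = (\<Sum>i<n. g i) + (\<Sum>i<m. g (n + i :: nat))" for g :: "nat \<Rightarrow> 'a :: comm_monoid_add"
  by (induction m) (auto simp: add.assoc)

lemma prod_add_Pow:
  fixes f g :: "'a \<Rightarrow> 'b :: comm_semiring_1"
  assumes "finite A"
  shows "(\<Prod>x\<in>A. f x + g x) = (\<Sum>S\<in>Pow A. (\<Prod>x\<in>S. f x) * (\<Prod>x\<in>A - S. g x))"
  using assms
proof (induction A rule: finite_induct)
  case (insert a A)
  have 1: "(\<Prod>x\<in>insert a S. f x) = f a * (\<Prod>x\<in>S. f x)" "insert a A - insert a S = A - S"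
    if "S \<in> Pow A" for S
    using that insert.hyps by (auto intro!: prod.insert finite_subset[of S A])
  have 2: "(\<Prod>x\<in>insert a A - S. g x) = g a * (\<Prod>x\<in>A - S. g x)" if "S \<in> Pow A" for S
  proof -
    have "insert a A - S = insert a (A - S)" using that insert.hyps by auto
    then show ?thesis using insert.hyps by simp
  qed
  have inj: "inj_on (insert a) (Pow A)" using insert.hyps by (auto simp: inj_on_def)
  have "(\<Sum>S\<in>Pow (insert a A). (\<Prod>x\<in>S. f x) * (\<Prod>x\<in>insert a A - S. g x))
      = (\<Sum>S\<in>Pow A. (\<Prod>x\<in>S. f x) * (\<Prod>x\<in>insert a A - S. g x))
        + (\<Sum>S\<in>insert a ` Pow A. (\<Prod>x\<in>S. f x) * (\<Prod>x\<in>insert a A - S. g x))"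
    unfolding Pow_insert using insert.hyps by (intro sum.union_disjoint) auto
  also have "(\<Sum>S\<in>insert a ` Pow A. (\<Prod>x\<in>S. f x) * (\<Prod>x\<in>insert a A - S. g x))
      = (\<Sum>S\<in>Pow A. f a * ((\<Prod>x\<in>S. f x) * (\<Prod>x\<in>A - S. g x)))"
    unfolding sum.reindex[OF inj] comp_def by (rule sum.cong[OF refl]) (simp only: 1 mult.assoc)
  also have "(\<Sum>S\<in>Pow A. (\<Prod>x\<in>S. f x) * (\<Prod>x\<in>insert a A - S. g x))
      = (\<Sum>S\<in>Pow A. g a * ((\<Prod>x\<in>S. f x) * (\<Prod>x\<in>A - S. g x)))"
    by (rule sum.cong[OF refl]) (simp only: 2 mult_ac)
  finally show ?case
    using insert by (simp add: sum_distrib_left[symmetric] distrib_right add.commute)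
qed simp

lemma ideal_prod_add:
  assumes "x \<in> ideal_prod I J" "y \<in> ideal_prod I J" shows "x + y \<in> ideal_prod I J"
proof -
  obtain n :: nat and a b where x: "\<forall>i<n. a i \<in> I \<and> b i \<in> J" "x = (\<Sum>i<n. a i * b i)"
    using assms(1) unfolding ideal_prod_def by blast
  obtain m :: nat and c d where y: "\<forall>i<m. c i \<in> I \<and> d i \<in> J" "y = (\<Sum>i<m. c i * d i)"
    using assms(2) unfolding ideal_prod_def by blast
  define e where "e i = (if i < n then a i else c (i - n))" for i
  define f where "f i = (if i < n then b i else d (i - n))" for i
  have "(\<Sum>i<n+m. e i * f i) = (\<Sum>i<n. e i * f i) + (\<Sum>i<m. e (n + i) * f (n + i))"
    by (rule sum_lessThan_add)
  also have "\<dots> = x + y" unfolding x(2) y(2) by (simp add: e_def f_def)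
  finally have "x + y = (\<Sum>i<n+m. e i * f i)" ..
  moreover have "\<forall>i<n+m. e i \<in> I \<and> f i \<in> J" using x(1) y(1) by (auto simp: e_def f_def)
  ultimately show ?thesis unfolding ideal_prod_def by blast
qed

lemma ideal_prod_0: "0 \<in> ideal_prod I J"
  unfolding ideal_prod_def by (intro CollectI exI[of _ 0]) auto

lemma ideal_prod_scale:
  assumes "\<And>x. x \<in> I \<Longrightarrow> r * x \<in> I" "x \<in> ideal_prod I J" shows "r * x \<in> ideal_prod I J"
proof -
  obtain n :: nat and a b where x: "\<forall>i<n. a i \<in> I \<and> b i \<in> J" "x = (\<Sum>i<n. a i * b i)"
    using assms(2) unfolding ideal_prod_def by blast
  then have "r * x = (\<Sum>i<n. (r * a i) * b i)" by (simp add: sum_distrib_left mult.assoc)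
  moreover have "\<forall>i<n. r * a i \<in> I \<and> b i \<in> J" using x(1) assms(1) by blast
  ultimately show ?thesis unfolding ideal_prod_def by (intro CollectI exI[of _ n] exI[of _ "\<lambda>i. r * a i"] exI[of _ b]) auto
qed

context num_field_ext
begin

lemma principal_ideal_iff: "b \<noteq> 0 \<Longrightarrow> x \<in> principal_ideal K b \<longleftrightarrow> x / b \<in> OK K"
  unfolding principal_ideal_def by (auto simp: image_iff intro!: bexI[of _ "x / b"])

lemma ext_idealI: "w \<in> OK K \<Longrightarrow> a \<in> I \<Longrightarrow> w * a \<in> ext_ideal K I"
  unfolding ext_ideal_def ideal_prod_def
  by (intro CollectI exI[of _ 1] exI[of _ "\<lambda>_. w"] exI[of _ "\<lambda>_. a"]) auto

lemma ext_ideal_least: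
  assumes "\<And>x. x \<in> I \<Longrightarrow> x \<in> M" "0 \<in> M" "\<And>x y. x \<in> M \<Longrightarrow> y \<in> M \<Longrightarrow> x + y \<in> M"
    and "\<And>r x. r \<in> OK K \<Longrightarrow> x \<in> M \<Longrightarrow> r * x \<in> M"
  shows "ext_ideal K I \<subseteq> M"
proof
  fix x assume "x \<in> ext_ideal K I"
  then obtain n :: nat and a b where x: "\<forall>i<n. a i \<in> OK K \<and> b i \<in> I" "x = (\<Sum>i<n. a i * b i)"
    unfolding ext_ideal_def ideal_prod_def by blast
  have "(\<Sum>i<m. a i * b i) \<in> M" if "m \<le> n" for m
    using that by (induction m) (use x(1) assms in auto)
  then show "x \<in> M" using x(2) by blast
qed

text \<open>The extension of \<open>P\<close> is proper because its contraction is \<open>P\<close>.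
  A prime containing the extension meets \<open>k\<close> in nothing larger, because
  \<open>P\<close> is maximal in \<open>OK k\<close>.\<close>

lemma prime_above:
  assumes P: "prime_ideal k P"
  obtains Q where "prime_ideal K Q" "P \<subseteq> Q" "Q \<inter> k = P"
proof -
  interpret P: num_field_prime k P by unfold_locales (rule P)
  have c: "ext_ideal K P \<inter> k = P" by (rule ext_ideal_contract[OF P.Q_frac_ideal])
  have PE: "P \<subseteq> ext_ideal K P" using c by blast
  obtain a where a: "a \<in> P" "a \<noteq> 0" using base.frac_idealD(5)[OF P.Q_frac_ideal] by blast
  have "\<exists>Q. prime_ideal K Q \<and> ext_ideal K P \<subseteq> Q"
  proof (rule top.exists_prime_ideal_above)
    show "ext_ideal K P \<subseteq> OK K"
      by (rule ext_ideal_least) (use P.Q_subset OK_base_iff in auto)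
    show "1 \<notin> ext_ideal K P" using c P.Q_1 by (metis IntI base.one_mem)
    show "a \<in> ext_ideal K P" "a \<noteq> 0" using PE a by auto
    show "0 \<in> ext_ideal K P" unfolding ext_ideal_def by (rule ideal_prod_0)
    show "x + y \<in> ext_ideal K P" if "x \<in> ext_ideal K P" "y \<in> ext_ideal K P" for x y
      using that unfolding ext_ideal_def by (rule ideal_prod_add)
    show "r * x \<in> ext_ideal K P" if "r \<in> OK K" "x \<in> ext_ideal K P" for r x
      using that(2) unfolding ext_ideal_def by (rule ideal_prod_scale[rotated]) (use that(1) in blast)
  qed
  then obtain Q where Q: "prime_ideal K Q" "ext_ideal K P \<subseteq> Q" by blast
  interpret Q: num_field_prime K Q by unfold_locales (rule Q)
  have "Q \<inter> k \<subseteq> P"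
  proof (rule subsetI, rule ccontr)
    fix x assume x: "x \<in> Q \<inter> k" "x \<notin> P"
    then have "x \<in> OK k" using Q.Q_subset OK_base_iff by blast
    then obtain y where y: "y \<in> OK k" "1 - x * y \<in> P" using P.residue_inverse x by blast
    then have "(1 - x * y) + x * y \<in> Q"
      using x PE Q(2) OK_base_iff by (intro Q.Q_add Q.Q_mult') auto
    then show False by simp
  qed
  moreover have "P \<subseteq> Q \<inter> k" using PE Q(2) P.Q_subset base.OK_mem_field by blast
  ultimately show ?thesis using that Q by blast
qed

text \<open>Expresses that the principal ideal of \<open>b\<close> is extended from
  \<open>k\<close>. By \<open>ext_ideal_contract\<close> the only candidate is the contraction, so
  no ideal of \<open>k\<close> is quantified.\<close>

definition descends :: "complex \<Rightarrow> bool" where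
  "descends b \<longleftrightarrow> b \<in> K \<and> b \<noteq> 0 \<and> ext_ideal K (principal_ideal K b \<inter> k) = principal_ideal K b"

lemma principal_ideal_add: "b \<noteq> 0 \<Longrightarrow> x \<in> principal_ideal K b \<Longrightarrow> y \<in> principal_ideal K b \<Longrightarrow> x + y \<in> principal_ideal K b"
  by (auto simp: principal_ideal_iff add_divide_distrib)

lemma principal_ideal_mult: "b \<noteq> 0 \<Longrightarrow> r \<in> OK K \<Longrightarrow> x \<in> principal_ideal K b \<Longrightarrow> r * x \<in> principal_ideal K b"
  using top.OK_mult[of r "x / b"] by (auto simp: principal_ideal_iff)

lemma nonzero_contraction:
  assumes "b \<in> K" "b \<noteq> 0"
  obtains m N :: int where "m \<noteq> 0" "N \<noteq> 0" "of_int m * b \<in> OK K" "of_int N \<in> principal_ideal K b"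
proof -
  obtain m :: int where m: "m \<noteq> 0" "of_int m * b \<in> OK K"
    using top.int_multiple_integral assms by blast
  have "inverse b \<in> K" using assms by blast
  then obtain N :: int where N: "N \<noteq> 0" "of_int N * inverse b \<in> OK K"
    using top.int_multiple_integral by blast
  have "of_int N \<in> principal_ideal K b"
    using N assms by (simp add: principal_ideal_iff divide_inverse)
  then show ?thesis using that m N by blast
qed

lemma contraction_frac_ideal:
  assumes b: "b \<in> K" "b \<noteq> 0"
  shows "frac_ideal k (principal_ideal K b \<inter> k)"
  unfolding frac_ideal_def
proof (intro conjI ballI)
  obtain m N :: int where mN: "m \<noteq> 0" "N \<noteq> 0" "of_int m * b \<in> OK K" "of_int N \<in> principal_ideal K b"
    using nonzero_contraction b by blast
  show "0 \<in> principal_ideal K b \<inter> k" using b by (simp add: principal_ideal_iff)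
  have "of_int N \<in> principal_ideal K b \<inter> k" using mN by blast
  moreover have "of_int N \<noteq> (0 :: complex)" using mN by simp
  ultimately show "principal_ideal K b \<inter> k \<noteq> {0}" by blast
  show "x + y \<in> principal_ideal K b \<inter> k"
    if "x \<in> principal_ideal K b \<inter> k" "y \<in> principal_ideal K b \<inter> k" for x y
    using that principal_ideal_add[OF b(2)] by blast
  show "r * x \<in> principal_ideal K b \<inter> k"
    if "r \<in> OK k" "x \<in> principal_ideal K b \<inter> k" for r x
    using that principal_ideal_mult[OF b(2)] OK_base_iff by blast
  show "\<exists>d\<in>OK k. d \<noteq> 0 \<and> (\<forall>x\<in>principal_ideal K b \<inter> k. d * x \<in> OK k)"
  proof (intro bexI[of _ "of_int m"] conjI ballI)
    show "of_int m \<noteq> (0 :: complex)" using mN by simp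
    fix x assume x: "x \<in> principal_ideal K b \<inter> k"
    then have "(of_int m * b) * (x / b) \<in> OK K"
      using b by (intro top.OK_mult[OF mN(3)]) (auto simp: principal_ideal_iff)
    then show "of_int m * x \<in> OK k" using b x unfolding OK_base_iff by auto
  qed simp
qed simp

end

locale galois_num_field_ext = num_field_ext +
  assumes finite_Gal: "finite (Gal K k)"
    and Gal_fixed: "\<And>x. x \<in> K \<Longrightarrow> (\<And>\<sigma>. \<sigma> \<in> Gal K k \<Longrightarrow> \<sigma> x = x) \<Longrightarrow> x \<in> k"
begin

text \<open>The numbers \<open>elem_sym j t\<close> are the coefficients of \<open>(\<Prod>\<sigma>. X - \<sigma> t)\<close>, from the top. Evaluating this polynomial at \<open>t\<close>
  shows that not all of its lower coefficients can lie in a prime ideal which does not contain \<open>t\<close>.\<close>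

definition elem_sym :: "nat \<Rightarrow> complex \<Rightarrow> complex" where
  "elem_sym j t = (\<Sum>S | S \<subseteq> Gal K k \<and> card S = j. \<Prod>\<sigma>\<in>S. - \<sigma> t)"

lemma elem_sym_base:
  assumes t: "t \<in> OK K"
  shows "elem_sym j t \<in> k"
proof (rule Gal_fixed)
  let ?S = "{S. S \<subseteq> Gal K k \<and> card S = j}"
  have finS: "finite ?S" using finite_Gal by simp
  have tK: "t \<in> K" using t top.OK_mem_field by blast
  have utK: "- \<sigma> t \<in> K" if "\<sigma> \<in> Gal K k" for \<sigma>
    using top.Gal_mem[OF that tK] by (rule top.uminus_mem)
  then have inK: "(\<Prod>\<sigma>\<in>S. - \<sigma> t) \<in> K" if "S \<in> ?S" for S
    using that by (intro top.prod_mem) auto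
  show "elem_sym j t \<in> K" unfolding elem_sym_def by (rule top.sum_mem) (rule inK)
  fix \<tau> assume \<tau>: "\<tau> \<in> Gal K k"
  note emb = top.Gal_embedding[OF \<tau>]
  have inj: "inj_on (\<lambda>\<sigma>. \<tau> \<circ> \<sigma>) (Gal K k)" by (rule top.Gal_comp_inj[OF \<tau>])
  \<comment> \<open>Translation by \<open>\<tau>\<close> permutes the subsets of size
    \<open>j\<close>, hence the summands.\<close>
  have "(\<lambda>S. (\<lambda>\<sigma>. \<tau> \<circ> \<sigma>) ` S) ` ?S = ?S"
  proof (rule endo_inj_surj[OF finS])
    show "(\<lambda>S. (\<lambda>\<sigma>. \<tau> \<circ> \<sigma>) ` S) ` ?S \<subseteq> ?S"
    proof (rule image_subsetI)
      fix S assume S: "S \<in> ?S"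
      then have "card ((\<lambda>\<sigma>. \<tau> \<circ> \<sigma>) ` S) = j" using inj by (subst card_image) (auto intro: inj_on_subset)
      then show "(\<lambda>\<sigma>. \<tau> \<circ> \<sigma>) ` S \<in> ?S" using S top.Gal_comp[OF \<tau>] by auto
    qed
    show "inj_on (\<lambda>S. (\<lambda>\<sigma>. \<tau> \<circ> \<sigma>) ` S) ?S"
      using inj_on_image_Pow[OF inj] by (rule inj_on_subset) auto
  qed
  then have img: "(\<lambda>S. (\<lambda>\<sigma>. \<tau> \<circ> \<sigma>) ` S) ` ?S = ?S" .
  have injS: "inj_on (\<lambda>S. (\<lambda>\<sigma>. \<tau> \<circ> \<sigma>) ` S) ?S"
    using inj_on_image_Pow[OF inj] by (rule inj_on_subset) auto
  have "\<tau> (elem_sym j t) = (\<Sum>S\<in>?S. \<tau> (\<Prod>\<sigma>\<in>S. - \<sigma> t))"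
    unfolding elem_sym_def by (rule top.emb_sum[OF emb inK])
  also have "\<dots> = (\<Sum>S\<in>?S. \<Prod>\<rho>\<in>(\<lambda>\<sigma>. \<tau> \<circ> \<sigma>) ` S. - \<rho> t)"
  proof (rule sum.cong[OF refl])
    fix S assume S: "S \<in> ?S"
    have "\<tau> (\<Prod>\<sigma>\<in>S. - \<sigma> t) = (\<Prod>\<sigma>\<in>S. \<tau> (- \<sigma> t))"
      using S utK by (intro top.emb_prod[OF emb]) auto
    also have "\<dots> = (\<Prod>\<sigma>\<in>S. - (\<tau> \<circ> \<sigma>) t)"
      using S top.emb_uminus[OF emb top.Gal_mem[OF _ tK]] by (intro prod.cong refl) auto
    also have "\<dots> = (\<Prod>\<rho>\<in>(\<lambda>\<sigma>. \<tau> \<circ> \<sigma>) ` S. - \<rho> t)"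
      using S by (subst prod.reindex) (auto intro: inj_on_subset[OF inj])
    finally show "\<tau> (\<Prod>\<sigma>\<in>S. - \<sigma> t) = (\<Prod>\<rho>\<in>(\<lambda>\<sigma>. \<tau> \<circ> \<sigma>) ` S. - \<rho> t)" .
  qed
  also have "\<dots> = (\<Sum>S\<in>(\<lambda>S. (\<lambda>\<sigma>. \<tau> \<circ> \<sigma>) ` S) ` ?S. \<Prod>\<rho>\<in>S. - \<rho> t)"
    by (subst sum.reindex[OF injS]) simp
  also have "\<dots> = elem_sym j t" unfolding img elem_sym_def ..
  finally show "\<tau> (elem_sym j t) = elem_sym j t" .
qed

lemma elem_sym_root:
  shows "(\<Sum>j\<le>card (Gal K k). elem_sym j t * t ^ (card (Gal K k) - j)) = 0"
proof -
  let ?G = "Gal K k" and ?n = "card (Gal K k)"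
  have "id \<in> ?G" by (rule top.Gal_id[OF k_subset])
  \<comment> \<open>The factor of the identity vanishes.\<close>
  then have "0 = (\<Prod>\<sigma>\<in>?G. - \<sigma> t + t)" using finite_Gal by (subst prod_zero) (auto intro!: bexI[of _ id])
  also have "\<dots> = (\<Sum>S\<in>Pow ?G. (\<Prod>\<sigma>\<in>S. - \<sigma> t) * (\<Prod>\<sigma>\<in>?G - S. t))"
    by (rule prod_add_Pow) (rule finite_Gal)
  also have "\<dots> = (\<Sum>S\<in>Pow ?G. (\<Prod>\<sigma>\<in>S. - \<sigma> t) * t ^ (?n - card S))"
    using finite_Gal by (intro sum.cong refl) (auto simp: card_Diff_subset finite_subset)
  also have "\<dots> = (\<Sum>j\<le>?n. \<Sum>S | S \<in> Pow ?G \<and> card S = j. (\<Prod>\<sigma>\<in>S. - \<sigma> t) * t ^ (?n - card S))"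
    by (rule sum.group[symmetric]) (use finite_Gal in \<open>auto intro: card_mono\<close>)
  also have "\<dots> = (\<Sum>j\<le>?n. elem_sym j t * t ^ (?n - j))"
    unfolding elem_sym_def sum_distrib_right by (intro sum.cong refl) auto
  finally show ?thesis by simp
qed

text \<open>Lets a denominator in \<open>K\<close> be exchanged for one in \<open>k\<close>. For
  \<open>j > 0\<close> every summand of \<open>elem_sym j t\<close> has a factor
  \<open>\<sigma> t\<close>, which lies in the stable ideal \<open>B\<close>; so these coefficients
  lie in \<open>B\<close> and in \<open>k\<close>, and one of them avoids \<open>Q\<close>.\<close>

lemma invariant_ideal_descent:
  assumes Q: "prime_ideal K Q"
    and B: "B \<subseteq> OK K" "0 \<in> B" "\<And>x y. x \<in> B \<Longrightarrow> y \<in> B \<Longrightarrow> x + y \<in> B"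
      "\<And>r x. r \<in> OK K \<Longrightarrow> x \<in> B \<Longrightarrow> r * x \<in> B"
      "\<And>\<sigma> x. \<sigma> \<in> Gal K k \<Longrightarrow> x \<in> B \<Longrightarrow> \<sigma> x \<in> B"
    and t: "t \<in> B" "t \<notin> Q"
  obtains s where "s \<in> B" "s \<in> OK k" "s \<notin> Q"
proof -
  interpret Q: num_field_prime K Q by unfold_locales (rule Q)
  define n where "n = card (Gal K k)"
  have tO: "t \<in> OK K" using t B by blast
  have inB: "elem_sym j t \<in> B" if "j > 0" for j
  proof -
    have "(\<Prod>\<sigma>\<in>S. - \<sigma> t) \<in> B" if S: "S \<subseteq> Gal K k" "card S = j" for S
    proof -
      have "S \<noteq> {}" using S \<open>j > 0\<close> by auto
      then obtain \<rho> where \<rho>: "\<rho> \<in> S" by blast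
      have fS: "finite S" using S finite_Gal finite_subset by blast
      have \<rho>t: "\<rho> t \<in> B" using B(5) S \<rho> t by blast
      have "(\<Prod>\<sigma>\<in>S - {\<rho>}. - \<sigma> t) \<in> OK K"
        using S top.OK_uminus[OF top.Gal_OK[OF _ tO]] by (intro top.OK_prod) blast
      then have "- (\<Prod>\<sigma>\<in>S - {\<rho>}. - \<sigma> t) * \<rho> t \<in> B" using \<rho>t by (intro B(4) top.OK_uminus)
      then show ?thesis using fS \<rho> by (simp add: prod.remove[of S \<rho>] mult.commute)
    qed
    then have P: "(\<Prod>\<sigma>\<in>S. - \<sigma> t) \<in> B" if "S \<in> {S. S \<subseteq> Gal K k \<and> card S = j}" for S
      using that by blast
    have sumB: "sum f T \<in> B" if "\<And>i. i \<in> T \<Longrightarrow> f i \<in> B" for f and T :: "(complex \<Rightarrow> complex) set set"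
      using that by (induction T rule: infinite_finite_induct) (auto simp: B)
    show ?thesis unfolding elem_sym_def by (rule sumB[OF P])
  qed
  have "\<exists>j. j > 0 \<and> elem_sym j t \<notin> Q"
  proof (rule ccontr)
    assume neg: "\<nexists>j. j > 0 \<and> elem_sym j t \<notin> Q"
    have e0: "elem_sym 0 t = 1"
    proof -
      have "S = {}" if "S \<subseteq> Gal K k" "card S = 0" for S
        using that finite_subset[OF that(1) finite_Gal] by simp
      then have "{S. S \<subseteq> Gal K k \<and> card S = 0} = {{}}" by auto
      then show ?thesis unfolding elem_sym_def by simp
    qed
    have "(\<Sum>j\<le>n. elem_sym j t * t ^ (n - j)) = 0" unfolding n_def by (rule elem_sym_root)
    then have "t ^ n + (\<Sum>j=1..n. elem_sym j t * t ^ (n - j)) = 0"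
      by (simp add: atMost_atLeast0 sum.atLeast_Suc_atMost e0)
    then have eq: "t ^ n = - (\<Sum>j=1..n. elem_sym j t * t ^ (n - j))" by (simp add: eq_neg_iff_add_eq_0)
    have eQ: "elem_sym j t \<in> Q" if "j > 0" for j using neg that by blast
    have "(\<Sum>j=1..n. elem_sym j t * t ^ (n - j)) \<in> Q"
      by (rule top.frac_ideal_sum[OF Q.Q_frac_ideal]) (use eQ tO in \<open>auto intro!: Q.Q_mult'\<close>)
    then have "t ^ n \<in> Q" unfolding eq by (rule Q.Q_uminus)
    then show False using Q.Q_power[OF tO] t(2) by blast
  qed
  then obtain j where j: "j > 0" "elem_sym j t \<notin> Q" by blast
  show ?thesis
  proof (rule that)
    show "elem_sym j t \<in> B" "elem_sym j t \<notin> Q" using inB j by auto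
    then show "elem_sym j t \<in> OK k" using B(1) elem_sym_base[OF tO] OK_base_iff by blast
  qed
qed

end

section \<open>Complex conjugation, and descent of the ideal of \<open>a / cnj a\<close>\<close>

locale conj_galois_ext = galois_num_field_ext +
  assumes cnj_top: "\<And>x. x \<in> K \<Longrightarrow> cnj x \<in> K"
    and cnj_base: "\<And>x. x \<in> k \<Longrightarrow> cnj x \<in> k"
    and cnj_commute: "\<And>\<sigma> x. \<sigma> \<in> Gal K k \<Longrightarrow> x \<in> K \<Longrightarrow> \<sigma> (cnj x) = cnj (\<sigma> x)"
    and ramified_cnj: "\<And>P. prime_ideal k P \<Longrightarrow> ramified k K P \<Longrightarrow> cnj ` P = P"
begin

lemma embedding_cnj: "embedding K cnj"
  unfolding embedding_def by simp

lemma OK_cnj: "x \<in> OK K \<Longrightarrow> cnj x \<in> OK K"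
  using top.emb_alg_integer[OF embedding_cnj] cnj_top top.OK_mem_field unfolding OK_def by blast

lemma Gal_emb: "\<sigma> \<in> Gal K k \<Longrightarrow> embedding K \<sigma>"
  by (rule top.Gal_embedding)

lemmas Gal_zero = top.emb_0[OF Gal_emb]
  and Gal_add = top.emb_add[OF Gal_emb]
  and Gal_mult = top.emb_mult[OF Gal_emb]
  and Gal_inverse_eq = top.emb_inverse[OF Gal_emb]
  and Gal_divide = top.emb_divide[OF Gal_emb]
  and Gal_power = top.emb_power[OF Gal_emb]
  and Gal_nonzero = top.emb_nonzero[OF Gal_emb]
  and Gal_closed = top.Gal_mem[of _ k]
  and Gal_base = top.Gal_fixes[of _ k]

text \<open>Equivalently, the fractional ideal generated by \<open>a\<close> is stable under the
  Galois group: \<open>\<sigma> a / a\<close> is a cocycle with values in the units.\<close>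

definition unit_cocycle :: "complex \<Rightarrow> bool" where
  "unit_cocycle a \<longleftrightarrow> a \<in> K \<and> a \<noteq> 0 \<and> (\<forall>\<sigma>\<in>Gal K k. \<sigma> a / a \<in> OK K \<and> a / \<sigma> a \<in> OK K)"

lemma Gal_inv:
  assumes "\<sigma> \<in> Gal K k" shows "\<exists>\<rho>\<in>Gal K k. \<forall>x. \<sigma> (\<rho> x) = x"
  by (rule top.Gal_inverse[OF finite_Gal k_subset assms]) blast

lemma unit_cocycle_mult:
  assumes "unit_cocycle a" "unit_cocycle b" shows "unit_cocycle (a * b)"
proof -
  have ab: "a \<in> K" "a \<noteq> 0" "b \<in> K" "b \<noteq> 0" using assms unfolding unit_cocycle_def by auto
  have "\<sigma> (a * b) / (a * b) \<in> OK K \<and> (a * b) / \<sigma> (a * b) \<in> OK K" if "\<sigma> \<in> Gal K k" for \<sigma>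
  proof -
    have "(\<sigma> a / a) * (\<sigma> b / b) \<in> OK K" "(a / \<sigma> a) * (b / \<sigma> b) \<in> OK K"
      using assms that unfolding unit_cocycle_def by blast+
    then show ?thesis using Gal_mult[OF that ab(1,3)] by simp
  qed
  then show ?thesis using ab unfolding unit_cocycle_def by auto
qed

lemma unit_cocycle_inverse:
  assumes "unit_cocycle a" shows "unit_cocycle (inverse a)"
  unfolding unit_cocycle_def
proof (intro conjI ballI)
  fix \<sigma> assume \<sigma>: "\<sigma> \<in> Gal K k"
  have "\<sigma> (inverse a) / inverse a = a / \<sigma> a" "inverse a / \<sigma> (inverse a) = \<sigma> a / a"
    using Gal_inverse_eq[OF \<sigma>, of a] assms by (auto simp: unit_cocycle_def divide_inverse)
  then show "\<sigma> (inverse a) / inverse a \<in> OK K" "inverse a / \<sigma> (inverse a) \<in> OK K"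
    using assms \<sigma> by (auto simp: unit_cocycle_def)
qed (use assms in \<open>auto simp: unit_cocycle_def\<close>)

lemma unit_cocycle_cnj:
  assumes "unit_cocycle a" shows "unit_cocycle (cnj a)"
proof -
  have "\<sigma> (cnj a) / cnj a \<in> OK K \<and> cnj a / \<sigma> (cnj a) \<in> OK K" if "\<sigma> \<in> Gal K k" for \<sigma>
  proof -
    have "cnj (\<sigma> a / a) \<in> OK K" "cnj (a / \<sigma> a) \<in> OK K"
      using assms that OK_cnj unfolding unit_cocycle_def by blast+
    then show ?thesis using cnj_commute[OF that] assms by (simp add: unit_cocycle_def)
  qed
  then show ?thesis using assms cnj_top unfolding unit_cocycle_def by auto
qed

lemma unit_cocycle_base: assumes "c \<in> k" "c \<noteq> 0" shows "unit_cocycle c"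
  unfolding unit_cocycle_def
proof (intro conjI ballI)
  fix \<sigma> assume "\<sigma> \<in> Gal K k"
  from Gal_base[OF this assms(1)] show "\<sigma> c / c \<in> OK K" "c / \<sigma> c \<in> OK K" using assms by auto
qed (use assms k_subset in auto)

text \<open>This is transitivity of the Galois action on the primes above \<open>Q \<inter> k\<close>, applied to \<open>Q\<close> and its conjugate.\<close>

lemma conj_transitive:
  assumes Q: "prime_ideal K Q" and fixed: "cnj ` (Q \<inter> k) = Q \<inter> k"
  obtains g where "g \<in> Gal K k" "\<And>x. x \<in> OK K \<Longrightarrow> cnj (g x) \<in> Q \<Longrightarrow> x \<in> Q"
proof -
  interpret Q: num_field_prime K Q by unfold_locales (rule Q)
  \<comment> \<open>The intersection of the preimages of \<open>Q\<close> under all maps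
    \<open>cnj \<circ> g\<close>; it is an ideal stable under the Galois group.\<close>
  define B where "B = {x \<in> OK K. \<forall>g\<in>Gal K k. cnj (g x) \<in> Q}"
  have BQ: "B \<subseteq> Q"
  proof (rule subsetI, rule ccontr)
    fix t assume t: "t \<in> B" "t \<notin> Q"
    obtain s where s: "s \<in> B" "s \<in> OK k" "s \<notin> Q"
    proof (rule invariant_ideal_descent[OF Q _ _ _ _ _ t])
      show "B \<subseteq> OK K" by (auto simp: B_def)
      have "cnj (g 0) \<in> Q" if "g \<in> Gal K k" for g using Gal_zero[OF that] by simp
      then show "0 \<in> B" by (simp add: B_def)
      show "x + y \<in> B" if x: "x \<in> B" and y: "y \<in> B" for x y
      proof -
        have "cnj (g (x + y)) \<in> Q" if g: "g \<in> Gal K k" for g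
        proof -
          have "g (x + y) = g x + g y" using x y by (intro Gal_add[OF g]) (auto simp: B_def top.OK_mem_field)
          then show ?thesis using x y g by (auto simp: B_def intro: Q.Q_add)
        qed
        then show ?thesis using x y by (auto simp: B_def)
      qed
      show "r * x \<in> B" if r: "r \<in> OK K" and x: "x \<in> B" for r x
      proof -
        have "cnj (g (r * x)) \<in> Q" if g: "g \<in> Gal K k" for g
        proof -
          have "g (r * x) = g r * g x" using r x by (intro Gal_mult[OF g]) (auto simp: B_def top.OK_mem_field)
          moreover have "cnj (g r) * cnj (g x) \<in> Q"
            using x g by (intro Q.Q_mult[OF OK_cnj[OF top.Gal_OK[OF g r]]]) (auto simp: B_def)
          ultimately show ?thesis by simp
        qed
        then show ?thesis using r x by (auto simp: B_def)
      qed
      show "\<sigma> x \<in> B" if \<sigma>: "\<sigma> \<in> Gal K k" and x: "x \<in> B" for \<sigma> x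
      proof -
        have "cnj (g (\<sigma> x)) \<in> Q" if g: "g \<in> Gal K k" for g
        proof -
          have "cnj ((g \<circ> \<sigma>) x) \<in> Q" using x top.Gal_comp[OF g \<sigma>] unfolding B_def by blast
          then show ?thesis by simp
        qed
        then show ?thesis using x top.Gal_OK[OF \<sigma>] by (simp add: B_def)
      qed
    qed
    \<comment> \<open>An element of \<open>B\<close> in \<open>k\<close> has its conjugate in
      \<open>Q \<inter> k\<close>, which is stable under conjugation, so it lies in \<open>Q\<close>
      itself.\<close>
    have "cnj (id s) \<in> Q" using s(1) top.Gal_id[OF k_subset] unfolding B_def by blast
    moreover have "cnj s \<in> k" using s(2) cnj_base base.OK_mem_field by blast
    ultimately have "cnj s \<in> cnj ` (Q \<inter> k)" unfolding fixed by simp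
    then show False using s(3) by (metis IntD1 complex_cnj_cancel_iff imageE)
  qed
  \<comment> \<open>A prime containing a finite intersection of ideals contains one of them:
    otherwise a product of elements from each, all outside \<open>Q\<close>, would lie in
    \<open>B\<close>.\<close>
  have "\<exists>g\<in>Gal K k. \<forall>x\<in>OK K. cnj (g x) \<in> Q \<longrightarrow> x \<in> Q"
  proof (rule ccontr)
    assume "\<not> ?thesis"
    then have "\<forall>g. \<exists>x. g \<in> Gal K k \<longrightarrow> x \<in> OK K \<and> cnj (g x) \<in> Q \<and> x \<notin> Q" by blast
    from choice[OF this] obtain X
      where X: "\<And>g. g \<in> Gal K k \<Longrightarrow> X g \<in> OK K \<and> cnj (g (X g)) \<in> Q \<and> X g \<notin> Q" by blast
    define t where "t = (\<Prod>g\<in>Gal K k. X g)"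
    have tO: "t \<in> OK K" unfolding t_def using X by (intro top.OK_prod) blast
    have "cnj (g t) \<in> Q" if g: "g \<in> Gal K k" for g
    proof -
      have "t = X g * (\<Prod>h\<in>Gal K k - {g}. X h)"
        unfolding t_def using prod.remove[OF finite_Gal g] .
      moreover have rest: "(\<Prod>h\<in>Gal K k - {g}. X h) \<in> OK K" using X by (intro top.OK_prod) blast
      ultimately have "cnj (g t) = cnj (g (X g)) * cnj (g (\<Prod>h\<in>Gal K k - {g}. X h))"
        using Gal_mult[OF g top.OK_mem_field top.OK_mem_field[OF rest], of "X g"] X[OF g] by simp
      also have "\<dots> \<in> Q" using X[OF g] OK_cnj[OF top.Gal_OK[OF g rest]] by (intro Q.Q_mult') auto
      finally show ?thesis .
    qed
    then have "t \<in> Q" using BQ tO unfolding B_def by blast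
    then show False using Q.Q_prod[OF finite_Gal, of X] X unfolding t_def by blast
  qed
  then show ?thesis using that by blast
qed

text \<open>Put \<open>h = cnj \<circ> g\<close>, which maps the local ring into itself, and
  \<open>y = h a / a\<close>. Then \<open>y * h y = g (g a) / a\<close> is a unit. In a valuation
  ring \<open>y\<close> or its inverse is local, and applying \<open>h\<close> to that one shows
  that both are. Finally \<open>a / cnj a\<close> is the unit \<open>cnj (g a / a)\<close> divided
  by \<open>y\<close>.\<close>

lemma ratio_local_unit_ramified:
  assumes a: "unit_cocycle a" and Q: "prime_ideal K Q" and fixed: "cnj ` (Q \<inter> k) = Q \<inter> k"
  shows "num_field_prime.loc_unit K Q (a / cnj a)"
proof -
  interpret Q: num_field_prime K Q by unfold_locales (rule Q)
  obtain g where g: "g \<in> Gal K k" "\<And>x. x \<in> OK K \<Longrightarrow> cnj (g x) \<in> Q \<Longrightarrow> x \<in> Q"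
    using conj_transitive[OF Q fixed] by blast
  have aK: "a \<in> K" "a \<noteq> 0" using a by (auto simp: unit_cocycle_def)
  have ga: "g a \<in> K" "g a \<noteq> 0" using top.Gal_mem[OF g(1) aK(1)] Gal_nonzero[OF g(1) aK] by auto
  have ca: "cnj a \<in> K" "cnj a \<noteq> 0" using aK cnj_top by auto
  have h_loc: "cnj (g x) \<in> top.loc Q" if x: "x \<in> top.loc Q" for x
  proof -
    obtain s where s: "s \<in> OK K" "s \<notin> Q" "s * x \<in> OK K" using x unfolding top.loc_def by blast
    have xK: "x \<in> K" using x Q.loc_mem_field by blast
    have "cnj (g s) * cnj (g x) = cnj (g (s * x))"
      using Gal_mult[OF g(1) top.OK_mem_field[OF s(1)] xK] by simp
    also have "\<dots> \<in> OK K" using s OK_cnj top.Gal_OK[OF g(1)] by blast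
    finally have "cnj (g s) * cnj (g x) \<in> OK K" .
    moreover have "cnj (g s) \<in> OK K - Q" using g(2) s OK_cnj top.Gal_OK[OF g(1)] by blast
    moreover have "cnj (g x) \<in> K" using xK cnj_top top.Gal_mem[OF g(1)] by blast
    ultimately show ?thesis unfolding top.loc_def by blast
  qed
  define y where "y = cnj (g a) / a"
  have y: "y \<in> K" "y \<noteq> 0" using ga aK cnj_top unfolding y_def by auto
  have gy: "cnj (g y) = g (g a) / cnj (g a)"
    unfolding y_def using ga aK cnj_top
    by (simp add: Gal_divide[OF g(1)] cnj_commute[OF g(1)])
  define w where "w = y * cnj (g y)"
  have w: "w = g (g a) / a" unfolding w_def gy unfolding y_def using ga by simp
  have gg: "(g \<circ> g) a / a \<in> OK K \<and> a / (g \<circ> g) a \<in> OK K"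
    using a top.Gal_comp[OF g(1) g(1)] unfolding unit_cocycle_def by blast
  have w_loc: "w \<in> top.loc Q" "inverse w \<in> top.loc Q"
    using gg unfolding w by (auto intro: Q.loc_of_OK)
  have w0: "w \<noteq> 0" unfolding w using aK Gal_nonzero[OF g(1) ga] by simp
  have y_unit: "Q.loc_unit y"
  proof -
    from Q.loc_valuation[OF y(1)] show ?thesis
    proof
      assume yl: "y \<in> top.loc Q"
      then have "cnj (g y) * inverse w \<in> top.loc Q" using h_loc w_loc Q.loc_mult by blast
      also have "cnj (g y) * inverse w = inverse y" using w0 y unfolding w_def by (simp add: field_simps)
      finally show ?thesis using yl unfolding Q.loc_unit_def by blast
    next
      assume yl: "inverse y \<in> top.loc Q"
      then have "w * cnj (g (inverse y)) \<in> top.loc Q" using h_loc w_loc Q.loc_mult by blast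
      also have "w * cnj (g (inverse y)) = y"
        using w0 Gal_inverse_eq[OF g(1) y(1)] unfolding w_def by (simp add: mult.assoc)
      finally show ?thesis using yl unfolding Q.loc_unit_def by blast
    qed
  qed
  have "Q.loc_unit (g a / a)" "Q.loc_unit (cnj (g a / a))"
  proof -
    have "g a / a \<in> OK K" "a / g a \<in> OK K" using a g(1) unfolding unit_cocycle_def by auto
    then show "Q.loc_unit (g a / a)" "Q.loc_unit (cnj (g a / a))"
      using OK_cnj[of "g a / a"] OK_cnj[of "a / g a"] unfolding Q.loc_unit_def
      by (auto intro: Q.loc_of_OK)
  qed
  then have "Q.loc_unit (cnj (g a / a) * inverse y)"
    using y_unit Q.loc_unit_mult Q.loc_unit_inverse by blast
  also have "cnj (g a / a) * inverse y = a / cnj a"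
    using ga aK ca unfolding y_def by (simp add: field_simps)
  finally show ?thesis .
qed

text \<open>If \<open>P\<close> were contained in the square of \<open>Q\<close>, so would be its
  extension, against unramifiedness. Hence some uniformizer at \<open>Q\<close> lies in
  \<open>P\<close>, and a quotient of its powers matches \<open>b = (m * b) / m\<close>.\<close>

lemma local_generator_unramified:
  assumes P: "prime_ideal k P" "\<not> ramified k K P" and Q: "prime_ideal K Q" "P \<subseteq> Q"
    and b: "b \<in> K" "b \<noteq> 0"
  obtains c where "c \<in> k" "c \<noteq> 0" "num_field_prime.loc_unit K Q (b / c)"
proof -
  interpret P: num_field_prime k P by unfold_locales (rule P)
  interpret Q: num_field_prime K Q by unfold_locales (rule Q)
  have "\<not> ext_ideal K P \<subseteq> ideal_prod Q Q" using P Q unfolding ramified_def by blast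
  moreover have "ext_ideal K P \<subseteq> ideal_prod Q Q" if "P \<subseteq> ideal_prod Q Q"
    by (rule ext_ideal_least) (use that ideal_prod_0 ideal_prod_add ideal_prod_scale[of Q _ _ Q] Q.Q_mult in blast)+
  ultimately obtain \<pi> where pi: "\<pi> \<in> P" "\<pi> \<notin> ideal_prod Q Q" by blast
  have piQ: "\<pi> \<in> Q" using pi Q by blast
  have pi0: "\<pi> \<noteq> 0" using pi ideal_prod_0 by blast
  have pik: "\<pi> \<in> k" using pi P.Q_subset base.OK_mem_field by blast
  obtain m :: int where m: "m \<noteq> 0" "of_int m * b \<in> OK K"
    using top.int_multiple_integral[OF b(1)] by blast
  obtain i where i: "Q.loc_unit (of_int m * b / \<pi> ^ i)"
    using Q.uniformizer_power[OF piQ pi(2) m(2)] m b by auto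
  obtain j where j: "Q.loc_unit (of_int m / \<pi> ^ j)"
    using Q.uniformizer_power[OF piQ pi(2) top.OK_of_int[of m]] m by auto
  have "Q.loc_unit ((of_int m * b / \<pi> ^ i) * inverse (of_int m / \<pi> ^ j))"
    using i j Q.loc_unit_mult Q.loc_unit_inverse by blast
  also have "(of_int m * b / \<pi> ^ i) * inverse (of_int m / \<pi> ^ j) = b / (\<pi> ^ i / \<pi> ^ j)"
    using m pi0 by (simp add: field_simps)
  finally show ?thesis using that[of "\<pi> ^ i / \<pi> ^ j"] pik pi0 by auto
qed

text \<open>The set \<open>A\<close> of denominators that put \<open>b\<close> into the extension of
  its contraction is an ideal of \<open>OK k\<close>. If it lacked 1 it would lie in a prime
  \<open>P\<close>; at one prime \<open>Q\<close> above \<open>P\<close> a generator of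
  \<open>(b)\<close> is taken from \<open>k\<close>, with the choice 1 if \<open>P\<close> ramifies,
  and Galois stability turns this into a denominator outside \<open>P\<close>.\<close>

lemma descends_ratio:
  assumes a: "unit_cocycle a"
  shows "descends (a / cnj a)"
proof -
  define b where "b = a / cnj a"
  have ub: "unit_cocycle b"
    unfolding b_def divide_inverse using a unit_cocycle_mult unit_cocycle_inverse unit_cocycle_cnj by blast
  then have b: "b \<in> K" "b \<noteq> 0" unfolding unit_cocycle_def by auto
  let ?I = "principal_ideal K b \<inter> k"
  define A where "A = {s \<in> OK k. s * b \<in> ext_ideal K ?I}"
  obtain m N :: int where mN: "m \<noteq> 0" "N \<noteq> 0" "of_int m * b \<in> OK K" "of_int N \<in> principal_ideal K b"
    using nonzero_contraction[OF b] by blast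
  have E_add: "x + y \<in> ext_ideal K ?I" if "x \<in> ext_ideal K ?I" "y \<in> ext_ideal K ?I" for x y
    using that unfolding ext_ideal_def by (rule ideal_prod_add)
  have E_mult: "r * x \<in> ext_ideal K ?I" if "r \<in> OK K" "x \<in> ext_ideal K ?I" for r x
    using that(2) unfolding ext_ideal_def by (rule ideal_prod_scale[rotated]) (use that(1) in blast)
  have "1 \<in> A"
  proof (rule ccontr)
    assume "1 \<notin> A"
    have "\<exists>P. prime_ideal k P \<and> A \<subseteq> P"
    proof (rule base.exists_prime_ideal_above)
      show "A \<subseteq> OK k" by (auto simp: A_def)
      show "0 \<in> A" unfolding A_def ext_ideal_def using ideal_prod_0 by simp
      show "1 \<notin> A" by fact
      have "(of_int m * b) * of_int N \<in> ext_ideal K ?I"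
        using mN by (intro ext_idealI) auto
      then show "of_int (m * N) \<in> A" using base.OK_of_int[of "m * N"] by (simp add: A_def mult_ac)
      show "of_int (m * N) \<noteq> (0 :: complex)" using mN by simp
      show "u + v \<in> A" if "u \<in> A" "v \<in> A" for u v
        using that E_add by (auto simp: A_def distrib_right)
      show "r * u \<in> A" if "r \<in> OK k" "u \<in> A" for r u
        using that E_mult[of r "u * b"] OK_base_iff by (auto simp: A_def mult.assoc)
    qed
    then obtain P where P: "prime_ideal k P" "A \<subseteq> P" by blast
    interpret P: num_field_prime k P by unfold_locales (rule P)
    obtain Q where Q: "prime_ideal K Q" "P \<subseteq> Q" "Q \<inter> k = P" using prime_above[OF P(1)] by blast
    interpret Q: num_field_prime K Q by unfold_locales (rule Q)
    obtain c where c: "c \<in> k" "c \<noteq> 0" "Q.loc_unit (b / c)"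
    proof (cases "ramified k K P")
      case True
      then have "cnj ` (Q \<inter> k) = Q \<inter> k" using ramified_cnj P(1) Q(3) by blast
      from ratio_local_unit_ramified[OF a Q(1) this] show ?thesis
        using that[of 1] by (simp add: b_def)
    next
      case False
      then show ?thesis using local_generator_unramified[OF P(1) _ Q(1,2) b] that by blast
    qed
    \<comment> \<open>Since \<open>d / \<sigma> d\<close> is integral, the ideal of denominators of
      \<open>d\<close> is Galois stable. It is not contained in \<open>Q\<close>, so it contains an
      element of \<open>k\<close> outside \<open>Q\<close>.\<close>
    have den: "\<exists>s\<in>OK k. s \<notin> Q \<and> s * d \<in> OK K" if d: "unit_cocycle d" "d \<in> top.loc Q" for d
    proof -
      define B where "B = {t \<in> OK K. t * d \<in> OK K}"
      have dK: "d \<in> K" "d \<noteq> 0" using d by (auto simp: unit_cocycle_def)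
      obtain t where t: "t \<in> B" "t \<notin> Q" using d(2) unfolding top.loc_def B_def by blast
      obtain s where "s \<in> B" "s \<in> OK k" "s \<notin> Q"
      proof (rule invariant_ideal_descent[OF Q(1) _ _ _ _ _ t])
        show "B \<subseteq> OK K" "0 \<in> B" by (auto simp: B_def)
        show "x + y \<in> B" if "x \<in> B" "y \<in> B" for x y using that by (auto simp: B_def distrib_right)
        show "r * x \<in> B" if "r \<in> OK K" "x \<in> B" for r x using that by (auto simp: B_def mult.assoc)
        show "\<sigma> x \<in> B" if \<sigma>: "\<sigma> \<in> Gal K k" and x: "x \<in> B" for \<sigma> x
        proof -
          have x': "x \<in> OK K" "x * d \<in> OK K" using x by (auto simp: B_def)
          have "\<sigma> (x * d) * (d / \<sigma> d) \<in> OK K"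
            using top.Gal_OK[OF \<sigma> x'(2)] d(1) \<sigma> unfolding unit_cocycle_def by (intro top.OK_mult) auto
          also have "\<sigma> (x * d) * (d / \<sigma> d) = \<sigma> x * d"
            using Gal_mult[OF \<sigma> top.OK_mem_field[OF x'(1)] dK(1)] Gal_nonzero[OF \<sigma> dK]
            by simp
          finally show ?thesis using top.Gal_OK[OF \<sigma> x'(1)] by (simp add: B_def)
        qed
      qed
      then show ?thesis unfolding B_def by blast
    qed
    have uc: "unit_cocycle (b / c)"
      unfolding divide_inverse using ub c unit_cocycle_mult unit_cocycle_inverse unit_cocycle_base by blast
    obtain s where s: "s \<in> OK k" "s \<notin> Q" "s * (b / c) \<in> OK K"
      using den[OF uc] c(3) unfolding Q.loc_unit_def by blast
    obtain s' where s': "s' \<in> OK k" "s' \<notin> Q" "s' * inverse (b / c) \<in> OK K"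
      using den[OF unit_cocycle_inverse[OF uc]] c(3) unfolding Q.loc_unit_def by blast
    \<comment> \<open>Locally \<open>b\<close> and \<open>c\<close> generate the same ideal:
      \<open>s'\<close> makes \<open>c / b\<close> integral, so \<open>s' * c\<close> is in the
      contraction, and multiplying it by the integral number \<open>s * (b / c)\<close> gives
      \<open>s * s' * b\<close>.\<close>
    have "s' * c \<in> ?I"
      using s' c b base.OK_mem_field by (auto simp: principal_ideal_iff)
    then have "(s * (b / c)) * (s' * c) \<in> ext_ideal K ?I" using s(3) by (intro ext_idealI)
    also have "(s * (b / c)) * (s' * c) = (s * s') * b" using c by simp
    finally have "s * s' \<in> A" using s s' by (auto simp: A_def)
    then have "s * s' \<in> Q" using P Q by blast
    then show False using s s' Q.Q_prime OK_base_iff by blast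
  qed
  then have bE: "b \<in> ext_ideal K ?I" by (simp add: A_def)
  have "principal_ideal K b \<subseteq> ext_ideal K ?I"
  proof
    fix x assume "x \<in> principal_ideal K b"
    then have "x / b \<in> OK K" using principal_ideal_iff[OF b(2)] by blast
    from E_mult[OF this bE] show "x \<in> ext_ideal K ?I" using b(2) by simp
  qed
  moreover have "ext_ideal K ?I \<subseteq> principal_ideal K b"
    by (rule ext_ideal_least) (use principal_ideal_add[OF b(2)] principal_ideal_mult[OF b(2)] b in \<open>auto simp: principal_ideal_iff\<close>)
  ultimately show ?thesis using b unfolding descends_def b_def by auto
qed

end

subsection \<open>Existence of embeddings and Kronecker's theorem\<close>

text \<open>The value at \<open>z\<close> of \<open>p(T) l\<close>, where \<open>T\<close> sends a
  functional \<open>l\<close> to \<open>\<lambda>z. l (x * z)\<close>. The coefficients multiply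
  outside \<open>l\<close> because they are complex numbers, while \<open>l\<close> is only additive
  on \<open>K\<close>.\<close>

definition poly_act :: "complex \<Rightarrow> (complex \<Rightarrow> complex) \<Rightarrow> complex poly \<Rightarrow> complex \<Rightarrow> complex" where
  "poly_act x l p = fold_coeffs (\<lambda>a f z. a * l z + f (x * z)) p (\<lambda>z. 0)"

lemma poly_act_0 [simp]: "poly_act x l 0 z = 0"
  by (simp add: poly_act_def)

lemma poly_act_pCons [simp]: "poly_act x l (pCons a p) z = a * l z + poly_act x l p (x * z)"
  by (cases "p = 0 \<and> a = 0") (auto simp: poly_act_def)

lemma poly_act_add: "poly_act x l (p + q) z = poly_act x l p z + poly_act x l q z"
  by (induction p q arbitrary: z rule: poly_induct2) (auto simp: algebra_simps)

lemma poly_act_smult: "poly_act x l (Polynomial.smult c p) z = c * poly_act x l p z"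
  by (induction p arbitrary: z) (auto simp: algebra_simps)

lemma poly_act_root:
  "poly_act x l ([:-c, 1:] * q) z = poly_act x l q (x * z) - c * poly_act x l q z"
proof -
  have "[:-c, 1:] * q = Polynomial.smult (- c) q + pCons 0 q" by (simp add: mult_pCons_left)
  then show ?thesis by (simp only: poly_act_add poly_act_smult poly_act_pCons) simp
qed

context complex_field
begin

text \<open>An embedding \<open>\<phi>\<close> is recovered from a nonzero additive functional \<open>l\<close> with
  \<open>l (x * z) = \<phi> x * l z\<close>, so embeddings are constructed as common eigenvectors of the
  (commuting) multiplications.\<close>

definition functional :: "(complex \<Rightarrow> complex) \<Rightarrow> bool" where
  "functional l \<longleftrightarrow> (\<forall>x\<in>K. \<forall>y\<in>K. l (x + y) = l x + l y) \<and> (\<exists>z\<in>K. l z \<noteq> 0)"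

definition eigen :: "(complex \<Rightarrow> complex) \<Rightarrow> complex \<Rightarrow> complex \<Rightarrow> bool" where
  "eigen l x c \<longleftrightarrow> (\<forall>z\<in>K. l (x * z) = c * l z)"

lemma poly_act_additive:
  assumes l: "\<And>x y. x \<in> K \<Longrightarrow> y \<in> K \<Longrightarrow> l (x + y) = l x + l y" and x: "x \<in> K"
  shows "u \<in> K \<Longrightarrow> v \<in> K \<Longrightarrow> poly_act x l p (u + v) = poly_act x l p u + poly_act x l p v"
proof (induction p arbitrary: u v)
  case (pCons a p)
  have "poly_act x l p (x * (u + v)) = poly_act x l p (x * u) + poly_act x l p (x * v)"
    using pCons.IH[of "x * u" "x * v"] pCons.prems x by (auto simp: distrib_left)
  then show ?case using l[OF pCons.prems] by (simp add: algebra_simps)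
qed simp

text \<open>Multiplications by \<open>u\<close> and \<open>x\<close> commute, so a polynomial in one
  preserves the eigenspaces of the other. Eigenvalues already obtained therefore survive later
  modifications of the functional.\<close>

lemma eigen_poly_act:
  assumes e: "eigen l u c" and u: "u \<in> K" and x: "x \<in> K"
  shows "eigen (poly_act x l p) u c"
proof -
  have "poly_act x l p (u * z) = c * poly_act x l p z" if "z \<in> K" for z
    using that
  proof (induction p arbitrary: z)
    case (pCons a p)
    have "poly_act x l p (x * (u * z)) = c * poly_act x l p (x * z)"
      using pCons.IH[of "x * z"] pCons.prems x by (auto simp: mult_ac)
    moreover have "l (u * z) = c * l z" using e pCons.prems unfolding eigen_def by blast
    ultimately show ?case by (simp add: algebra_simps)
  qed simp
  then show ?thesis unfolding eigen_def by blast
qed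

lemma additive_of_rat:
  fixes l :: "complex \<Rightarrow> complex"
  assumes add: "\<And>x y. x \<in> K \<Longrightarrow> y \<in> K \<Longrightarrow> l (x + y) = l x + l y" and u: "u \<in> K"
  shows "l (of_rat r * u) = of_rat r * l u"
proof -
  have l0: "l 0 = 0" using add[of 0 0] by simp
  have ln: "l (of_nat n * v) = of_nat n * l v" if "v \<in> K" for n v
  proof (induction n)
    case (Suc n)
    have "l (of_nat (Suc n) * v) = l (v + of_nat n * v)" by (simp add: algebra_simps)
    also have "\<dots> = l v + of_nat n * l v" using that Suc by (subst add) auto
    finally show ?case by (simp add: algebra_simps)
  qed (simp add: l0)
  have li: "l (of_int n * v) = of_int n * l v" if v: "v \<in> K" for n v
  proof (cases n rule: int_cases2)
    case (nonpos m)
    have w: "of_nat m * v \<in> K" using v by blast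
    have "l (- (of_nat m * v)) + l (of_nat m * v) = 0" using add[OF uminus_mem[OF w] w] l0 by simp
    then show ?thesis using nonpos ln[OF v] by (simp add: add_eq_0_iff)
  qed (use ln v in simp)
  obtain a b where ab: "quotient_of r = (a, b)" by (cases "quotient_of r")
  have b0: "b > 0" by (rule quotient_of_denom_pos[OF ab])
  have r: "of_rat r = (of_int a / of_int b :: complex)"
    unfolding quotient_of_div[OF ab] by (simp add: of_rat_divide)
  have rK: "of_rat r * u \<in> K" using u unfolding r by auto
  have "of_int b * l (of_rat r * u) = l (of_int b * (of_rat r * u))" by (rule li[OF rK, symmetric])
  also have "of_int b * (of_rat r * u) = of_int a * u" unfolding r using b0 by simp
  also have "l (of_int a * u) = of_int a * l u" by (rule li[OF u])
  finally show ?thesis unfolding r using b0 by (simp add: field_simps)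
qed

text \<open>An additive functional is linear over the rationals, so rational coefficients move
  inside. A rational polynomial vanishing at \<open>x\<close> thus annihilates
  \<open>l\<close>.\<close>

lemma poly_act_of_rat_poly:
  assumes add: "\<And>x y. x \<in> K \<Longrightarrow> y \<in> K \<Longrightarrow> l (x + y) = l x + l y" and x: "x \<in> K"
  shows "z \<in> K \<Longrightarrow> poly_act x l (map_poly of_rat p) z = l (poly (map_poly of_rat p) x * z)"
proof (induction p arbitrary: z)
  case 0
  show ?case using add[of 0 0] by simp
next
  case (pCons a p)
  have rat: "of_rat c \<in> K" for c using Rats_subset by auto
  have pK: "poly (map_poly of_rat p) x \<in> K"
    using x rat by (auto simp: poly_altdef coeff_map_poly)
  have "poly_act x l (map_poly of_rat (pCons a p)) z = of_rat a * l z + l (poly (map_poly of_rat p) x * (x * z))"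
    using pCons.IH[of "x * z"] pCons.prems x pCons.hyps by (auto simp: map_poly_pCons)
  also have "\<dots> = l (of_rat a * z + poly (map_poly of_rat p) x * (x * z))"
    using pCons.prems pK x rat by (subst add) (auto simp: additive_of_rat[where l=l, OF add])
  finally show ?case using pCons.hyps by (simp add: map_poly_pCons algebra_simps)
qed

text \<open>Take a nonzero complex polynomial of least degree that annihilates \<open>l\<close> and
  split off a linear factor \<open>X - c\<close>. The cofactor does not annihilate \<open>l\<close>,
  and what it produces is an eigenvector with eigenvalue \<open>c\<close>.\<close>

lemma exists_eigen:
  assumes l: "functional l" and x: "x \<in> K" and alg: "\<exists>q :: rat poly. q \<noteq> 0 \<and> poly (map_poly of_rat q) x = 0"
  obtains p c where "functional (poly_act x l p)" "eigen (poly_act x l p) x c"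
proof -
  have add: "\<And>x y. x \<in> K \<Longrightarrow> y \<in> K \<Longrightarrow> l (x + y) = l x + l y" using l unfolding functional_def by blast
  obtain z0 where z0: "z0 \<in> K" "l z0 \<noteq> 0" using l unfolding functional_def by blast
  define A where "A p \<longleftrightarrow> p \<noteq> 0 \<and> (\<forall>z\<in>K. poly_act x l p z = 0)" for p
  obtain q :: "rat poly" where "q \<noteq> 0" "poly (map_poly of_rat q) x = 0"
    using alg by blast
  then have "A (map_poly of_rat q)" unfolding A_def using poly_act_of_rat_poly[OF add x, of _ q] add[of 0 0] by auto
  then have ex: "\<exists>d. \<exists>p. A p \<and> degree p = d" by blast
  define d where "d = (LEAST d. \<exists>p. A p \<and> degree p = d)"
  obtain p where p: "A p" "degree p = d" using LeastI_ex[OF ex] unfolding d_def by blast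
  have min: "d \<le> degree r" if "A r" for r
    unfolding d_def by (rule Least_le) (use that in blast)
  have "d > 0"
  proof (rule ccontr)
    assume "\<not> d > 0"
    then obtain a where a: "p = [:a:]" using p(2) by (metis degree_eq_zeroE gr0I)
    then have "a \<noteq> 0" "a * l z0 = 0" using p(1) z0 unfolding A_def by auto
    then show False using z0 by simp
  qed
  then obtain c where c: "poly p c = 0"
    using fundamental_theorem_of_algebra p(2) by (metis constant_degree less_numeral_extra(3))
  then obtain q where q: "p = [:-c, 1:] * q" by (metis poly_eq_0_iff_dvd dvdE)
  have "q \<noteq> 0" using p(1) q unfolding A_def by auto
  then have "degree p = Suc (degree q)" unfolding q by (subst degree_mult_eq) auto
  then have "\<not> A q" using min[of q] p(2) by linarith
  then obtain z where z: "z \<in> K" "poly_act x l q z \<noteq> 0" using \<open>q \<noteq> 0\<close> unfolding A_def by blast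
  show ?thesis
  proof (rule that)
    show "functional (poly_act x l q)"
      unfolding functional_def using poly_act_additive[OF add x] z by blast
    show "eigen (poly_act x l q) x c"
      unfolding eigen_def
    proof
      fix z assume "z \<in> K"
      then have "poly_act x l p z = 0" using p(1) unfolding A_def by blast
      then show "poly_act x l q (x * z) = c * poly_act x l q z" unfolding q poly_act_root by simp
    qed
  qed
qed

lemma common_eigen:
  assumes fin: "finite B" and BK: "B \<subseteq> K" and alg: "\<And>b. b \<in> B \<Longrightarrow> \<exists>q :: rat poly. q \<noteq> 0 \<and> poly (map_poly of_rat q) b = 0"
    and l: "functional l" "eigen l y c" "y \<in> K"
  shows "\<exists>l'. functional l' \<and> eigen l' y c \<and> (\<forall>b\<in>B. \<exists>d. eigen l' b d)"
  using fin BK alg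
proof (induction B rule: finite_induct)
  case empty
  then show ?case using l by blast
next
  case (insert b B)
  then obtain l' where l': "functional l'" "eigen l' y c" "\<And>b. b \<in> B \<Longrightarrow> \<exists>d. eigen l' b d" by auto
  have b: "b \<in> K" "\<exists>q :: rat poly. q \<noteq> 0 \<and> poly (map_poly of_rat q) b = 0" using insert.prems by auto
  obtain p d where pd: "functional (poly_act b l' p)" "eigen (poly_act b l' p) b d"
    using exists_eigen[OF l'(1) b] by blast
  have "\<exists>d. eigen (poly_act b l' p) b' d" if b': "b' \<in> insert b B" for b'
  proof (cases "b' = b")
    case False
    then obtain e where "eigen l' b' e" using l'(3) b' by blast
    then show ?thesis using eigen_poly_act[OF _ _ b(1)] insert.prems(1) b' by blast
  qed (use pd in blast)
  then show ?case using pd(1) eigen_poly_act[OF l'(2) l(3) b(1)] by blast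
qed

end

lemma rat_vector_space: "vector_space (\<lambda>(r :: rat) (x :: complex). of_rat r * x)"
  by unfold_locales (auto simp: algebra_simps of_rat_add of_rat_mult)

text \<open>The coordinate functional of the top power \<open>y ^ (d - 1)\<close>, extended from the
  independent powers of \<open>y\<close> to all complex numbers. A polynomial of degree
  \<open>d - 1\<close> acting on it takes its leading coefficient as value at 1, which guarantees
  nonvanishing.\<close>

lemma rat_functional_extension:
  fixes y :: complex
  assumes indep: "\<And>p :: rat poly. degree p < d \<Longrightarrow> poly (map_poly of_rat p) y = 0 \<Longrightarrow> p = 0"
  shows "\<exists>l :: complex \<Rightarrow> complex. (\<forall>u v. l (u + v) = l u + l v) \<and>
    (\<forall>i<d. l (y ^ i) = (if Suc i = d then 1 else 0))"
proof -
  interpret V: vector_space "\<lambda>(r :: rat) (x :: complex). of_rat r * x" by (rule rat_vector_space)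
  interpret VV: vector_space_pair "\<lambda>(r :: rat) (x :: complex). of_rat r * x" "\<lambda>(r :: rat) (x :: complex). of_rat r * x"
    by unfold_locales
  have poly_sum: "poly (map_poly of_rat p) y = (\<Sum>i<d. of_rat (coeff p i) * y ^ i)" if "degree p < d" for p :: "rat poly"
  proof -
    have "poly (map_poly of_rat p) y = (\<Sum>i\<le>degree p. of_rat (coeff p i) * y ^ i)"
      by (simp add: poly_altdef coeff_map_poly)
    also have "\<dots> = (\<Sum>i<d. of_rat (coeff p i) * y ^ i)"
      using that by (intro sum.mono_neutral_left) (auto simp: coeff_eq_0)
    finally show ?thesis .
  qed
  have lin: "\<forall>i<d. r i = 0" if "(\<Sum>i<d. of_rat (r i) * y ^ i) = 0" for r :: "nat \<Rightarrow> rat"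
  proof (cases "d = 0")
    case False
    define p where "p = (\<Sum>i<d. monom (r i) i)"
    have co: "coeff p i = (if i < d then r i else 0)" for i
      unfolding p_def by (simp add: coeff_sum sum.delta)
    have deg: "degree p < d" using False by (intro degree_lessI) (auto simp: co)
    have "poly (map_poly of_rat p) y = 0" unfolding poly_sum[OF deg] using that by (simp add: co)
    from indep[OF deg this] show ?thesis using co by (metis coeff_0)
  qed simp
  have inj: "inj_on (\<lambda>i. y ^ i) {..<d}"
  proof (rule inj_onI)
    fix i j assume ij: "i \<in> {..<d}" "j \<in> {..<d}" "y ^ i = y ^ j"
    show "i = j"
    proof (rule ccontr)
      assume "i \<noteq> j"
      have "(\<Sum>m<d. of_rat ((if m = i then 1 else 0) - (if m = j then 1 else 0)) * y ^ m)
          = (\<Sum>m<d. (if m = i then y ^ m else 0)) - (\<Sum>m<d. (if m = j then y ^ m else 0))"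
        unfolding sum_subtractf[symmetric] by (rule sum.cong) auto
      also have "\<dots> = 0" using ij by (simp add: sum.delta)
      finally show False using lin[of "\<lambda>m. (if m = i then 1 else 0) - (if m = j then 1 else 0)"] ij \<open>i \<noteq> j\<close> by auto
    qed
  qed
  let ?B = "(\<lambda>i. y ^ i) ` {..<d}"
  have "V.independent ?B"
    unfolding V.dependent_finite[OF finite_imageI[OF finite_lessThan]]
  proof
    assume "\<exists>u. (\<exists>v\<in>?B. u v \<noteq> 0) \<and> (\<Sum>v\<in>?B. of_rat (u v) * v) = 0"
    then obtain u where u: "\<exists>i<d. u (y ^ i) \<noteq> 0" "(\<Sum>v\<in>?B. of_rat (u v) * v) = 0" by auto
    have "(\<Sum>i<d. of_rat (u (y ^ i)) * y ^ i) = 0" using u(2) sum.reindex[OF inj, of "\<lambda>v. of_rat (u v) * v"] by simp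
    then show False using lin[of "\<lambda>i. u (y ^ i)"] u(1) by blast
  qed
  then obtain g where g: "Vector_Spaces.linear (\<lambda>(r :: rat) (x :: complex). of_rat r * x) (\<lambda>(r :: rat) (x :: complex). of_rat r * x) g"
    "\<And>x. x \<in> ?B \<Longrightarrow> g x = (if x = y ^ (d - 1) then 1 else 0)"
    using VV.linear_independent_extend[of ?B "\<lambda>x. if x = y ^ (d - 1) then 1 else 0"] by blast
  show ?thesis
  proof (intro exI[of _ g] conjI allI impI)
    show "g (u + v) = g u + g v" for u v using g(1) by (rule VV.linear_add)
    fix i assume i: "i < d"
    then have "y ^ i = y ^ (d - 1) \<longleftrightarrow> i = d - 1" using inj by (auto simp: inj_on_def)
    then show "g (y ^ i) = (if Suc i = d then 1 else 0)" using g(2)[of "y ^ i"] i by auto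
  qed
qed

context num_field
begin

text \<open>Every complex root \<open>c\<close> of the minimal polynomial of \<open>y\<close> is an
  image of \<open>y\<close>. With the polynomial factored as \<open>(X - c) * q\<close>, the action
  of \<open>q\<close> on the coordinate functional is a nonzero eigenvector for \<open>y\<close>
  with eigenvalue \<open>c\<close>. Refining it to a common eigenvector of a spanning family fixes
  the values on all of \<open>K\<close>.\<close>

lemma embedding_through_root:
  fixes p :: "rat poly"
  assumes y: "y \<in> K" and p: "p \<noteq> 0"
    and min: "\<And>q :: rat poly. degree q < degree p \<Longrightarrow> poly (map_poly of_rat q) y = 0 \<Longrightarrow> q = 0"
    and root: "poly (map_poly of_rat p) y = 0" and c: "poly (map_poly of_rat p) c = 0"
  obtains \<phi> where "embedding K \<phi>" "\<phi> y = c"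
proof -
  define d where "d = degree p"
  let ?P = "\<lambda>l :: complex \<Rightarrow> complex. (\<forall>u v. l (u + v) = l u + l v) \<and> (\<forall>i<d. l (y ^ i) = (if Suc i = d then 1 else 0))"
  define l where "l = (SOME l. ?P l)"
  have "\<exists>l. ?P l" by (rule rat_functional_extension[OF min[folded d_def]])
  then have Pl: "?P l" unfolding l_def by (rule someI_ex[of ?P])
  then have l: "\<And>u v. l (u + v) = l u + l v" "\<And>i. i < d \<Longrightarrow> l (y ^ i) = (if Suc i = d then 1 else 0)"
    by blast+
  obtain q where q: "map_poly of_rat p = [:-c, 1:] * q" using c by (metis poly_eq_0_iff_dvd dvdE)
  have q0: "q \<noteq> 0"
  proof
    assume "q = 0"
    from q have "map_poly of_rat p = [:-c, 1:] * (0 :: complex poly)" unfolding \<open>q = 0\<close> .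
    then have "coeff (map_poly of_rat p) i = (0 :: complex)" for i by (simp only: mult_zero_right coeff_0)
    then have "coeff p i = 0" for i by (simp add: coeff_map_poly)
    then show False using p by (simp add: poly_eq_iff)
  qed
  then have "degree (map_poly of_rat p :: complex poly) = Suc (degree q)" unfolding q using q0 by (subst degree_mult_eq) auto
  then have dq: "d = Suc (degree q)" unfolding d_def by simp
  have act_sum: "poly_act x l r z = (\<Sum>i\<le>degree r. coeff r i * l (x ^ i * z))" for x r z
  proof -
    have "poly_act x l r z = (\<Sum>i\<le>n. coeff r i * l (x ^ i * z))" if "degree r \<le> n" for n
      using that
    proof (induction r arbitrary: z n)
      case (pCons a r)
      show ?case
      proof (cases "r = 0")
        case True
        then have "(\<Sum>i\<le>n. coeff (pCons a r) i * l (x ^ i * z)) = (\<Sum>i\<in>{0}. coeff (pCons a r) i * l (x ^ i * z))"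
          by (intro sum.mono_neutral_right) (auto simp: coeff_pCons split: nat.splits)
        then show ?thesis using True by simp
      next
        case False
        then obtain m where m: "n = Suc m" "degree r \<le> m" using pCons.prems by (cases n) auto
        have "(\<Sum>i\<le>Suc m. coeff (pCons a r) i * l (x ^ i * z)) = a * l z + (\<Sum>i\<le>m. coeff r i * l (x ^ i * (x * z)))"
          by (subst sum.atMost_Suc_shift) (simp add: mult_ac)
        then show ?thesis using pCons.IH[OF m(2)] m by simp
      qed
    qed simp
    then show ?thesis by blast
  qed
  define l1 where "l1 = poly_act y l q"
  have yK: "y ^ i \<in> K" for i using y by blast
  \<comment> \<open>As \<open>degree q = d - 1\<close>, only the leading coefficient of
    \<open>q\<close> survives.\<close>
  have "l1 1 = (\<Sum>i\<le>degree q. coeff q i * (if Suc i = d then 1 else 0))"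
    unfolding l1_def act_sum using l(2) dq by (intro sum.cong) auto
  also have "\<dots> = coeff q (degree q)" unfolding dq by (simp add: if_distrib sum.delta cong: if_cong)
  finally have l11: "l1 1 \<noteq> 0" using q0 by simp
  have l1f: "functional l1"
    unfolding functional_def l1_def using poly_act_additive[OF l(1) y] l11 unfolding l1_def by blast
  have l1e: "eigen l1 y c"
    unfolding eigen_def
  proof
    fix z assume "z \<in> K"
    then have "poly_act y l (map_poly of_rat p) z = 0"
      using poly_act_of_rat_poly[OF l(1) y, of z p] root l(1)[of 0 0] by simp
    then show "l1 (y * z) = c * l1 z" unfolding q poly_act_root l1_def by simp
  qed
  obtain n where "spans K \<rat> n" using number_field unfolding number_field_def by blast
  then obtain b where b: "\<And>i. i < n \<Longrightarrow> b i \<in> K" "K = {\<Sum>i<n. c i * b i | c. \<forall>i<n. c i \<in> \<rat>}"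
    unfolding spans_def by blast
  have alg: "\<exists>q :: rat poly. q \<noteq> 0 \<and> poly (map_poly of_rat q) x = 0" if x: "x \<in> K" for x
  proof -
    obtain q :: "rat poly" where q: "lead_coeff q = 1" "poly (map_poly of_rat q) x = 0"
      using char_poly_rat x by metis
    have "q \<noteq> 0" using q(1) by auto
    then show ?thesis using q(2) by blast
  qed
  have "finite (b ` {..<n})" "b ` {..<n} \<subseteq> K" using b(1) by auto
  then have "\<exists>l'. functional l' \<and> eigen l' y c \<and> (\<forall>x\<in>b ` {..<n}. \<exists>d. eigen l' x d)"
    using alg by (intro common_eigen[OF _ _ _ l1f l1e y]) blast+
  then obtain l' where l': "functional l'" "eigen l' y c" "\<And>i. i < n \<Longrightarrow> \<exists>d. eigen l' (b i) d"
    by blast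
  obtain z0 where z0: "z0 \<in> K" "l' z0 \<noteq> 0" using l'(1) unfolding functional_def by blast
  have add: "\<And>x y. x \<in> K \<Longrightarrow> y \<in> K \<Longrightarrow> l' (x + y) = l' x + l' y" using l'(1) unfolding functional_def by blast
  have l0: "l' 0 = 0" using add[of 0 0] by simp
  \<comment> \<open>Being an eigenvector passes from the spanning family to its rational
    combinations, with eigenvalues combined in the same way.\<close>
  have all_eigen: "\<exists>e. eigen l' x e" if x: "x \<in> K" for x
  proof -
    obtain r where r: "\<And>i. i < n \<Longrightarrow> r i \<in> \<rat>" "x = (\<Sum>i<n. r i * b i)" using b(2) x by blast
    have ex: "\<exists>e. eigen l' (\<Sum>i<m. r i * b i) e" if "m \<le> n" for m
      using that
    proof (induction m)
      case 0
      then show ?case using l0 by (auto simp: eigen_def intro!: exI[of _ 0])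
    next
      case (Suc m)
      then obtain e where e: "eigen l' (\<Sum>i<m. r i * b i) e" by auto
      have m: "m < n" using Suc.prems by simp
      obtain f where f: "eigen l' (b m) f" using l'(3)[OF m] by blast
      obtain s where s: "r m = of_rat s" using r(1)[OF m] by (rule Rats_cases)
      have sK: "(\<Sum>i<m. r i * b i) \<in> K" using r(1) b(1) Rats_subset Suc.prems by (intro sum_mem mult_mem) auto
      have bK: "b m \<in> K" "of_rat s \<in> K" using b(1) Suc.prems Rats_subset by auto
      have "eigen l' (\<Sum>i<Suc m. r i * b i) (e + of_rat s * f)"
        unfolding eigen_def
      proof
        fix z assume z: "z \<in> K"
        have "l' ((\<Sum>i<Suc m. r i * b i) * z) = l' ((\<Sum>i<m. r i * b i) * z + of_rat s * (b m * z))"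
          by (simp add: s algebra_simps)
        also have "\<dots> = l' ((\<Sum>i<m. r i * b i) * z) + l' (of_rat s * (b m * z))"
          using sK z bK by (intro add mult_mem)
        also have "\<dots> = e * l' z + of_rat s * (f * l' z)"
          using e f z additive_of_rat[where l=l', OF add mult_mem[OF bK(1) z], of s] by (simp add: eigen_def)
        finally show "l' ((\<Sum>i<Suc m. r i * b i) * z) = (e + of_rat s * f) * l' z" by (simp add: algebra_simps)
      qed
      then show ?case by blast
    qed
    from ex[of n] show ?thesis unfolding r(2) by simp
  qed
  \<comment> \<open>This is the eigenvalue of \<open>x\<close>. It depends additively and
    multiplicatively on \<open>x\<close> because eigenvalues of sums and products of commuting
    operators do so.\<close>
  define \<phi> where "\<phi> x = l' (x * z0) / l' z0" for x
  have ph: "l' (x * z) = \<phi> x * l' z" if x: "x \<in> K" and z: "z \<in> K" for x z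
  proof -
    obtain e where "eigen l' x e" using all_eigen[OF x] by blast
    then show ?thesis using z z0 unfolding \<phi>_def eigen_def by simp
  qed
  show ?thesis
  proof (rule that)
    show "\<phi> y = c" using l'(2) z0 unfolding \<phi>_def eigen_def by simp
    have "\<phi> (u + v) = \<phi> u + \<phi> v" if "u \<in> K" "v \<in> K" for u v
    proof -
      have "l' ((u + v) * z0) = l' (u * z0) + l' (v * z0)"
        unfolding distrib_right using that z0 by (intro add mult_mem)
      then show ?thesis by (simp add: \<phi>_def add_divide_distrib)
    qed
    moreover have "\<phi> (u * v) = \<phi> u * \<phi> v" if "u \<in> K" "v \<in> K" for u v
    proof -
      have "l' ((u * v) * z0) = \<phi> u * (\<phi> v * l' z0)"
        using ph[OF that(1), of "v * z0"] ph[OF that(2) z0(1)] that z0 by (auto simp: mult.assoc)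
      then show ?thesis using z0 by (simp add: \<phi>_def)
    qed
    ultimately show "embedding K \<phi>" using z0 unfolding embedding_def by (auto simp: \<phi>_def)
  qed
qed

end

section \<open>Polynomials with bounded roots and Kronecker's theorem\<close>

lemma norm_coeff_prod_linear:
  fixes as :: "complex list"
  assumes "\<And>a. a \<in> set as \<Longrightarrow> norm a \<le> 1"
  shows "norm (coeff (\<Prod>a\<leftarrow>as. [:- a, 1:]) i) \<le> 2 ^ length as"
  using assms
proof (induction as arbitrary: i)
  case Nil
  then show ?case by (cases i) (auto simp: coeff_1)
next
  case (Cons a as)
  let ?q = "\<Prod>a\<leftarrow>as. [:- a, 1:]"
  have IH: "norm (coeff ?q j) \<le> 2 ^ length as" for j using Cons by simp
  have a: "norm a \<le> 1" using Cons.prems by simp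
  have m: "norm (a * coeff ?q j) \<le> 2 ^ length as" for j
    unfolding norm_mult using mult_mono[OF a IH[of j]] by simp
  have "[:- a, 1:] * ?q = Polynomial.smult (- a) ?q + pCons 0 ?q" by (simp add: mult_pCons_left)
  then have eq: "coeff (\<Prod>a\<leftarrow>a # as. [:- a, 1:]) i = - (a * coeff ?q i) + coeff (pCons 0 ?q) i"
    by (simp only: list.map prod_list.Cons coeff_add coeff_smult) simp
  have "norm (coeff (pCons 0 ?q) i) \<le> 2 ^ length as" using IH by (cases i) auto
  then show ?case unfolding eq using m[of i] norm_triangle_ineq[of "- (a * coeff ?q i)" "coeff (pCons 0 ?q) i"] by simp
qed

lemma alg_integer_coeff_prod_linear:
  fixes as :: "complex list"
  assumes "\<And>a. a \<in> set as \<Longrightarrow> alg_integer a"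
  shows "alg_integer (coeff (\<Prod>a\<leftarrow>as. [:- a, 1:]) i)"
  using assms
proof (induction as arbitrary: i)
  case Nil
  then show ?case by (cases i) (auto simp: coeff_1 alg_integer_0 alg_integer_1)
next
  case (Cons a as)
  let ?q = "\<Prod>a\<leftarrow>as. [:- a, 1:]"
  have IH: "alg_integer (coeff ?q j)" for j using Cons by simp
  have "[:- a, 1:] * ?q = Polynomial.smult (- a) ?q + pCons 0 ?q" by (simp add: mult_pCons_left)
  then have eq: "coeff (\<Prod>a\<leftarrow>a # as. [:- a, 1:]) i = - (a * coeff ?q i) + coeff (pCons 0 ?q) i"
    by (simp only: list.map prod_list.Cons coeff_add coeff_smult) simp
  have "alg_integer (coeff (pCons 0 ?q) i)" using IH alg_integer_0 by (cases i) auto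
  then show ?case unfolding eq using Cons.prems IH by (intro alg_integer_add alg_integer_uminus alg_integer_mult) auto
qed

lemma finite_bounded_int_poly_roots:
  "finite {x :: complex. \<exists>p. p \<noteq> 0 \<and> degree p \<le> n \<and> (\<forall>i. coeff p i \<in> of_int ` {- M..M}) \<and> poly p x = 0}"
    (is "finite ?R")
proof -
  let ?C = "of_int ` {- M..M} :: complex set"
  let ?L = "{xs. set xs \<subseteq> ?C \<and> length xs \<le> Suc n}"
  have fin: "finite ?L" by (rule finite_lists_length_le) simp
  have "?R \<subseteq> (\<Union>xs\<in>{xs \<in> ?L. Poly xs \<noteq> 0}. {x. poly (Poly xs) x = 0})"
  proof
    fix x assume "x \<in> ?R"
    then obtain p where p: "p \<noteq> 0" "degree p \<le> n" "\<And>i. coeff p i \<in> ?C" "poly p x = 0" by blast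
    have "set (coeffs p) \<subseteq> ?C" using p(3) by (auto simp: coeffs_def)
    moreover have "length (coeffs p) \<le> Suc n" using p(1,2) by (simp add: length_coeffs_degree)
    ultimately show "x \<in> (\<Union>xs\<in>{xs \<in> ?L. Poly xs \<noteq> 0}. {x. poly (Poly xs) x = 0})"
      using p by (intro UN_I[of "coeffs p"]) auto
  qed
  moreover have "finite (\<Union>xs\<in>{xs \<in> ?L. Poly xs \<noteq> 0}. {x. poly (Poly xs) x = 0})"
    by (rule finite_UN_I[OF finite_subset[OF _ fin]]) (auto intro: poly_roots_finite)
  ultimately show ?thesis by (rule finite_subset)
qed

text \<open>All powers of \<open>y\<close> are roots of nonzero integer polynomials of degree at
  most \<open>n\<close> with coefficients bounded by \<open>2 ^ n\<close>. There are finitely many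
  such roots, so two powers coincide.\<close>

lemma (in num_field) kronecker:
  assumes y: "y \<in> OK K" "y \<noteq> 0" and abs: "\<And>\<phi>. embedding K \<phi> \<Longrightarrow> norm (\<phi> y) = 1"
  shows "\<exists>n>0. y ^ n = 1"
proof -
  obtain n where n: "\<And>x. x \<in> K \<Longrightarrow> \<exists>p :: rat poly. lead_coeff p = 1 \<and> degree p = n \<and> poly (map_poly of_rat p) x = 0"
    using char_poly_rat by metis
  define M :: int where "M = 2 ^ n"
  let ?R = "{x :: complex. \<exists>p. p \<noteq> 0 \<and> degree p \<le> n \<and> (\<forall>i. coeff p i \<in> of_int ` {- M..M}) \<and> poly p x = 0}"
  have inR: "y ^ m \<in> ?R" for m
  proof -
    define x where "x = y ^ m"
    have xO: "x \<in> OK K" and xK: "x \<in> K" unfolding x_def using y(1) OK_mem_field by auto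
    have xabs: "norm (\<phi> x) = 1" if "embedding K \<phi>" for \<phi>
      unfolding x_def using emb_power[OF that OK_mem_field[OF y(1)]] abs[OF that] by (simp add: norm_power)
    define D where "D d \<longleftrightarrow> (\<exists>p :: rat poly. p \<noteq> 0 \<and> degree p = d \<and> poly (map_poly of_rat p) x = 0)" for d
    obtain p0 :: "rat poly" where p0: "lead_coeff p0 = 1" "degree p0 = n" "poly (map_poly of_rat p0) x = 0"
      using n[OF xK] by blast
    have "p0 \<noteq> 0" using p0(1) by auto
    then have Dn: "D n" unfolding D_def using p0 by blast
    define d where "d = (LEAST d. D d)"
    have "D d" unfolding d_def by (rule LeastI[of D n]) (rule Dn)
    then obtain p :: "rat poly" where p: "p \<noteq> 0" "degree p = d" "poly (map_poly of_rat p) x = 0" unfolding D_def by blast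
    have min: "q = 0" if q: "degree q < degree p" "poly (map_poly of_rat q) x = 0" for q :: "rat poly"
    proof (rule ccontr)
      assume "q \<noteq> 0"
      then have "D (degree q)" unfolding D_def using q by blast
      then have "d \<le> degree q" unfolding d_def by (rule Least_le)
      then show False using q p by simp
    qed
    have dn: "d \<le> n" unfolding d_def using Dn by (rule Least_le)
    define f :: "complex poly" where "f = map_poly of_rat p"
    define a where "a = lead_coeff p"
    have a0: "a \<noteq> 0" unfolding a_def leading_coeff_0_iff by (rule p(1))
    obtain as where as: "Polynomial.smult (lead_coeff f) (\<Prod>a\<leftarrow>as. [:- a, 1:]) = f" "length as = degree f"
      using fundamental_theorem_algebra_factorized by blast
    have lf: "lead_coeff f = of_rat a" unfolding f_def a_def by simp
    define g where "g = (\<Prod>a\<leftarrow>as. [:- a, 1:])"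
    have len: "length as \<le> n" using as(2) dn p(2) by (simp add: f_def)
    have fg: "f = Polynomial.smult (of_rat a) g" using as(1) unfolding lf g_def by simp
    have g0: "g \<noteq> 0" using p(1) fg unfolding f_def by auto
    \<comment> \<open>The roots of the monic minimal polynomial \<open>g\<close> are conjugates of
      \<open>x\<close>. Being algebraic integers they make the rational coefficients of
      \<open>g\<close> integers; being of absolute value 1 they bound them.\<close>
    have conj: "\<exists>\<phi>. embedding K \<phi> \<and> \<phi> x = c" if c: "c \<in> set as" for c
    proof -
      have "poly g c = 0" using c unfolding g_def by (induction as) auto
      then have "poly (map_poly of_rat p) c = 0" unfolding f_def[symmetric] fg by simp
      from embedding_through_root[OF xK p(1) min p(3) this] show ?thesis by blast
    qed
    have coeffs: "coeff g i \<in> of_int ` {- M..M}" for i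
    proof -
      have "alg_integer (coeff g i)"
        unfolding g_def
      proof (rule alg_integer_coeff_prod_linear)
        fix c assume "c \<in> set as"
        then obtain \<phi> where "embedding K \<phi>" "\<phi> x = c" using conj by blast
        then show "alg_integer c" using emb_alg_integer xO by blast
      qed
      moreover have "coeff g i \<in> \<rat>"
      proof -
        have "of_rat (coeff p i) = of_rat a * coeff g i"
          using fg unfolding f_def by (metis coeff_map_poly coeff_smult of_rat_0)
        then have "coeff g i = of_rat (coeff p i / a)" using a0 by (simp add: of_rat_divide field_simps)
        then show ?thesis by simp
      qed
      ultimately have "coeff g i \<in> \<int>" by (rule alg_integer_Rats_imp_Ints)
      then obtain c where c: "coeff g i = of_int c" by (auto elim: Ints_cases)
      have "norm (coeff g i) \<le> 2 ^ length as"
        unfolding g_def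
      proof (rule norm_coeff_prod_linear)
        fix c assume "c \<in> set as"
        then obtain \<phi> where "embedding K \<phi>" "\<phi> x = c" using conj by blast
        then show "norm c \<le> 1" using xabs by force
      qed
      also have "(2 :: real) ^ length as \<le> 2 ^ n" using len by (intro power_increasing) auto
      finally have "\<bar>real_of_int c\<bar> \<le> real_of_int M" unfolding c M_def by simp
      then have "c \<in> {- M..M}" by (simp add: abs_le_iff flip: of_int_abs of_int_minus)
      then show ?thesis using c by blast
    qed
    have "poly g x = 0" using p(3) a0 unfolding f_def[symmetric] fg by simp
    moreover have "degree g \<le> n"
    proof -
      have "degree g = degree f" unfolding fg using a0 by simp
      then show ?thesis using dn p(2) by (simp add: f_def)
    qed
    ultimately have "x \<in> ?R" using g0 coeffs by (intro CollectI exI[of _ g]) simp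
    then show ?thesis unfolding x_def .
  qed
  have "finite (range (\<lambda>m. y ^ m))"
    by (rule finite_subset[OF _ finite_bounded_int_poly_roots[of n M]]) (use inR in blast)
  then have "\<not> inj (\<lambda>m. y ^ m)" using finite_imageD[of "\<lambda>m. y ^ m" UNIV] by auto
  then obtain i j where ij: "i \<noteq> j" "y ^ i = y ^ j" unfolding inj_def by blast
  have "\<exists>i j. i < j \<and> y ^ i = y ^ j" using ij by (metis nat_neq_iff)
  then obtain i j where ij: "i < j" "y ^ i = y ^ j" by blast
  have "y ^ i * y ^ (j - i) = y ^ (i + (j - i))" by (simp only: power_add)
  also have "\<dots> = y ^ i * 1" using ij by simp
  finally have "y ^ (j - i) = 1" using y(2) by simp
  then show ?thesis using ij by (intro exI[of _ "j - i"]) simp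
qed

subsection \<open>The monoid of ideal classes\<close>

lemma ideal_prodI: "x \<in> I \<Longrightarrow> y \<in> J \<Longrightarrow> x * y \<in> ideal_prod I J"
  unfolding ideal_prod_def
  by (intro CollectI exI[of _ 1] exI[of _ "\<lambda>_. x"] exI[of _ "\<lambda>_. y"]) auto

lemma ideal_prod_least:
  assumes "\<And>x y. x \<in> I \<Longrightarrow> y \<in> J \<Longrightarrow> x * y \<in> M" "0 \<in> M" "\<And>x y. x \<in> M \<Longrightarrow> y \<in> M \<Longrightarrow> x + y \<in> M"
  shows "ideal_prod I J \<subseteq> M"
proof
  fix x assume "x \<in> ideal_prod I J"
  then obtain n :: nat and a b where x: "\<forall>i<n. a i \<in> I \<and> b i \<in> J" "x = (\<Sum>i<n. a i * b i)"
    unfolding ideal_prod_def by blast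
  have "(\<Sum>i<m. a i * b i) \<in> M" if "m \<le> n" for m
    using that by (induction m) (use x(1) assms in auto)
  then show "x \<in> M" using x(2) by blast
qed

lemma ideal_prod_commute: "ideal_prod I J = ideal_prod J I"
proof -
  have "ideal_prod I J \<subseteq> ideal_prod J I" for I J
  proof (rule ideal_prod_least)
    show "x * y \<in> ideal_prod J I" if "x \<in> I" "y \<in> J" for x y
      using ideal_prodI[OF that(2,1)] by (simp add: mult.commute)
  qed (auto simp: ideal_prod_0 ideal_prod_add)
  then show ?thesis by blast
qed

text \<open>One inclusion suffices; commutativity converts it into the other.\<close>

lemma ideal_prod_assoc: "ideal_prod (ideal_prod I J) L = ideal_prod I (ideal_prod J L)"
proof -
  have sub: "ideal_prod (ideal_prod I J) L \<subseteq> ideal_prod I (ideal_prod J L)" for I J L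
  proof (rule ideal_prod_least)
    fix x l assume x: "x \<in> ideal_prod I J" and l: "l \<in> L"
    have "ideal_prod I J \<subseteq> {x. x * l \<in> ideal_prod I (ideal_prod J L)}"
      by (rule ideal_prod_least) (use l in \<open>auto simp: ideal_prod_0 mult.assoc distrib_right intro: ideal_prodI ideal_prod_add\<close>)
    then show "x * l \<in> ideal_prod I (ideal_prod J L)" using x by blast
  qed (auto simp: ideal_prod_0 ideal_prod_add)
  have "ideal_prod I (ideal_prod J L) = ideal_prod (ideal_prod L J) I"
    by (metis ideal_prod_commute)
  also have "\<dots> \<subseteq> ideal_prod L (ideal_prod J I)" by (rule sub)
  also have "\<dots> = ideal_prod (ideal_prod I J) L" by (metis ideal_prod_commute)
  finally show ?thesis using sub by blast
qed

lemma ideal_prod_image_scale: "ideal_prod ((\<lambda>x. a * x) ` I) ((\<lambda>x. b * x) ` J) = (\<lambda>x. (a * b) * x) ` ideal_prod I J"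
proof
  show "ideal_prod ((\<lambda>x. a * x) ` I) ((\<lambda>x. b * x) ` J) \<subseteq> (\<lambda>x. (a * b) * x) ` ideal_prod I J"
  proof (rule ideal_prod_least)
    fix x y assume "x \<in> (\<lambda>x. a * x) ` I" "y \<in> (\<lambda>x. b * x) ` J"
    then obtain i j where "i \<in> I" "j \<in> J" "x = a * i" "y = b * j" by blast
    then show "x * y \<in> (\<lambda>x. (a * b) * x) ` ideal_prod I J"
      by (intro image_eqI[of _ _ "i * j"]) (auto intro: ideal_prodI)
  next
    show "0 \<in> (\<lambda>x. (a * b) * x) ` ideal_prod I J"
      by (rule image_eqI[of _ _ 0]) (auto simp: ideal_prod_0)
  next
    fix x y assume "x \<in> (\<lambda>x. (a * b) * x) ` ideal_prod I J" "y \<in> (\<lambda>x. (a * b) * x) ` ideal_prod I J"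
    then obtain u v where "u \<in> ideal_prod I J" "v \<in> ideal_prod I J" "x = (a * b) * u" "y = (a * b) * v" by blast
    then show "x + y \<in> (\<lambda>x. (a * b) * x) ` ideal_prod I J"
      by (intro image_eqI[of _ _ "u + v"]) (auto simp: distrib_left ideal_prod_add)
  qed
next
  have "ideal_prod I J \<subseteq> {x. (a * b) * x \<in> ideal_prod ((\<lambda>x. a * x) ` I) ((\<lambda>x. b * x) ` J)}"
  proof (rule ideal_prod_least)
    fix x y assume "x \<in> I" "y \<in> J"
    then have "(a * x) * (b * y) \<in> ideal_prod ((\<lambda>x. a * x) ` I) ((\<lambda>x. b * x) ` J)"
      by (intro ideal_prodI) auto
    then show "x * y \<in> {x. (a * b) * x \<in> ideal_prod ((\<lambda>x. a * x) ` I) ((\<lambda>x. b * x) ` J)}"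
      by (simp add: mult_ac)
  qed (auto simp: ideal_prod_0 distrib_left intro: ideal_prod_add)
  then show "(\<lambda>x. (a * b) * x) ` ideal_prod I J \<subseteq> ideal_prod ((\<lambda>x. a * x) ` I) ((\<lambda>x. b * x) ` J)" by blast
qed

context num_field
begin

lemma frac_ideal_OK: "frac_ideal K (OK K)"
proof -
  have "OK K \<noteq> {0}" using OK_1 by (metis singletonD zero_neq_one)
  then show ?thesis unfolding frac_ideal_def using OK_mem_field by (auto intro!: bexI[of _ 1])
qed

lemma ideal_prod_OK: assumes "frac_ideal K I" shows "ideal_prod (OK K) I = I"
proof
  show "ideal_prod (OK K) I \<subseteq> I" by (rule ideal_prod_least) (use frac_idealD[OF assms] in auto)
  show "I \<subseteq> ideal_prod (OK K) I" using ideal_prodI[OF OK_1] by force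
qed

lemma frac_ideal_prod:
  assumes I: "frac_ideal K I" and J: "frac_ideal K J" shows "frac_ideal K (ideal_prod I J)"
  unfolding frac_ideal_def
proof (intro conjI ballI)
  show "ideal_prod I J \<subseteq> K"
    by (rule ideal_prod_least) (use frac_idealD(1)[OF I] frac_idealD(1)[OF J] in auto)
  show "0 \<in> ideal_prod I J" by (rule ideal_prod_0)
  obtain i j where ij: "i \<in> I" "i \<noteq> 0" "j \<in> J" "j \<noteq> 0" using frac_idealD(5) I J by metis
  then have "i * j \<in> ideal_prod I J" "i * j \<noteq> 0" by (auto intro: ideal_prodI)
  then show "ideal_prod I J \<noteq> {0}" by blast
  show "x + y \<in> ideal_prod I J" if "x \<in> ideal_prod I J" "y \<in> ideal_prod I J" for x y
    using that by (rule ideal_prod_add)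
  show "r * x \<in> ideal_prod I J" if "r \<in> OK K" "x \<in> ideal_prod I J" for r x
    using that(2) by (rule ideal_prod_scale[rotated]) (use frac_idealD(4)[OF I that(1)] in blast)
  obtain d where d: "d \<in> OK K" "d \<noteq> 0" "\<And>x. x \<in> I \<Longrightarrow> d * x \<in> OK K" using frac_idealD(6)[OF I] by blast
  obtain e where e: "e \<in> OK K" "e \<noteq> 0" "\<And>x. x \<in> J \<Longrightarrow> e * x \<in> OK K" using frac_idealD(6)[OF J] by blast
  have "ideal_prod I J \<subseteq> {x. (d * e) * x \<in> OK K}"
  proof (rule ideal_prod_least)
    fix x y assume "x \<in> I" "y \<in> J"
    then have "(d * x) * (e * y) \<in> OK K" using d e by blast
    then show "x * y \<in> {x. (d * e) * x \<in> OK K}" by (simp add: mult_ac)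
  qed (auto simp: distrib_left)
  then show "\<exists>d\<in>OK K. d \<noteq> 0 \<and> (\<forall>x\<in>ideal_prod I J. d * x \<in> OK K)"
    using d e by (intro bexI[of _ "d * e"]) auto
qed

lemma ideal_class_refl: "frac_ideal K I \<Longrightarrow> I \<in> ideal_class K I"
  unfolding ideal_class_def by (auto intro!: bexI[of _ 1])

lemma ideal_class_eq_iff:
  assumes I: "frac_ideal K I" and J: "frac_ideal K J"
  shows "ideal_class K I = ideal_class K J \<longleftrightarrow> (\<exists>a\<in>K. a \<noteq> 0 \<and> J = (\<lambda>x. a * x) ` I)"
proof
  assume "ideal_class K I = ideal_class K J"
  then have "J \<in> ideal_class K I" using ideal_class_refl[OF J] by simp
  then show "\<exists>a\<in>K. a \<noteq> 0 \<and> J = (\<lambda>x. a * x) ` I" unfolding ideal_class_def by simp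
next
  assume "\<exists>a\<in>K. a \<noteq> 0 \<and> J = (\<lambda>x. a * x) ` I"
  then obtain a where a: "a \<in> K" "a \<noteq> 0" "J = (\<lambda>x. a * x) ` I" by blast
  have "(\<exists>c\<in>K. c \<noteq> 0 \<and> L = (\<lambda>x. c * x) ` I) \<longleftrightarrow> (\<exists>c\<in>K. c \<noteq> 0 \<and> L = (\<lambda>x. c * x) ` J)" for L
  proof
    assume "\<exists>c\<in>K. c \<noteq> 0 \<and> L = (\<lambda>x. c * x) ` I"
    then obtain c where c: "c \<in> K" "c \<noteq> 0" "L = (\<lambda>x. c * x) ` I" by blast
    have "L = (\<lambda>x. (c / a) * x) ` J" unfolding a(3) c(3) image_image using a(2) by simp
    then show "\<exists>c\<in>K. c \<noteq> 0 \<and> L = (\<lambda>x. c * x) ` J" using a c by (intro bexI[of _ "c / a"]) auto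
  next
    assume "\<exists>c\<in>K. c \<noteq> 0 \<and> L = (\<lambda>x. c * x) ` J"
    then obtain c where c: "c \<in> K" "c \<noteq> 0" "L = (\<lambda>x. c * x) ` J" by blast
    have "L = (\<lambda>x. (c * a) * x) ` I" unfolding c(3) a(3) image_image by (simp add: mult.assoc)
    then show "\<exists>c\<in>K. c \<noteq> 0 \<and> L = (\<lambda>x. c * x) ` I" using a c by (intro bexI[of _ "c * a"]) auto
  qed
  then show "ideal_class K I = ideal_class K J" unfolding ideal_class_def by simp
qed

lemma ideal_class_memD: "J \<in> ideal_class K I \<Longrightarrow> frac_ideal K J"
  unfolding ideal_class_def by simp

lemma ideal_class_of_member:
  assumes "frac_ideal K I" "J \<in> ideal_class K I" shows "ideal_class K J = ideal_class K I"
proof -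
  have "ideal_class K I = ideal_class K J"
    unfolding ideal_class_eq_iff[OF assms(1) ideal_class_memD[OF assms(2)]]
    using assms(2) unfolding ideal_class_def by simp
  then show ?thesis ..
qed

lemma ideal_class_rep:
  assumes "frac_ideal K I"
  obtains a where "a \<in> K" "a \<noteq> 0" "(SOME J. J \<in> ideal_class K I) = (\<lambda>x. a * x) ` I"
    "frac_ideal K (SOME J. J \<in> ideal_class K I)"
proof -
  have "(SOME J. J \<in> ideal_class K I) \<in> ideal_class K I"
    by (rule someI[of "\<lambda>J. J \<in> ideal_class K I"]) (rule ideal_class_refl[OF assms])
  then show ?thesis using that unfolding ideal_class_def by blast
qed

lemma Cl_mult:
  assumes I: "frac_ideal K I" and J: "frac_ideal K J"
  shows "ideal_class K I \<otimes>\<^bsub>Cl K\<^esub> ideal_class K J = ideal_class K (ideal_prod I J)"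
proof -
  let ?I = "SOME L. L \<in> ideal_class K I" and ?J = "SOME L. L \<in> ideal_class K J"
  obtain a where a: "a \<in> K" "a \<noteq> 0" "?I = (\<lambda>x. a * x) ` I" "frac_ideal K ?I"
    using ideal_class_rep[OF I] by blast
  obtain b where b: "b \<in> K" "b \<noteq> 0" "?J = (\<lambda>x. b * x) ` J" "frac_ideal K ?J"
    using ideal_class_rep[OF J] by blast
  have "ideal_prod ?I ?J = (\<lambda>x. (a * b) * x) ` ideal_prod I J"
    unfolding a(3) b(3) by (rule ideal_prod_image_scale)
  moreover have "a * b \<in> K" "a * b \<noteq> 0" using a b by auto
  ultimately have "ideal_class K (ideal_prod I J) = ideal_class K (ideal_prod ?I ?J)"
    unfolding ideal_class_eq_iff[OF frac_ideal_prod[OF I J] frac_ideal_prod[OF a(4) b(4)]] by blast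
  then show ?thesis unfolding Cl_def by simp
qed

lemma Cl_carrier_iff: "C \<in> carrier (Cl K) \<longleftrightarrow> (\<exists>I. frac_ideal K I \<and> C = ideal_class K I)"
  unfolding Cl_def by auto

lemma Cl_one: "\<one>\<^bsub>Cl K\<^esub> = ideal_class K (OK K)"
  unfolding Cl_def by simp

text \<open>Inverses are supplied later for the individual classes that occur, as powers of classes
  of finite order.\<close>

lemma Cl_comm_monoid: "comm_monoid (Cl K)"
proof (rule comm_monoidI)
  fix C D E assume "C \<in> carrier (Cl K)" "D \<in> carrier (Cl K)" "E \<in> carrier (Cl K)"
  then obtain I J L where *: "frac_ideal K I" "C = ideal_class K I" "frac_ideal K J" "D = ideal_class K J"
    "frac_ideal K L" "E = ideal_class K L" unfolding Cl_carrier_iff by blast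
  show "C \<otimes>\<^bsub>Cl K\<^esub> D \<otimes>\<^bsub>Cl K\<^esub> E = C \<otimes>\<^bsub>Cl K\<^esub> (D \<otimes>\<^bsub>Cl K\<^esub> E)"
    using * by (simp add: Cl_mult frac_ideal_prod ideal_prod_assoc)
next
  fix C D assume "C \<in> carrier (Cl K)" "D \<in> carrier (Cl K)"
  then obtain I J where *: "frac_ideal K I" "C = ideal_class K I" "frac_ideal K J" "D = ideal_class K J"
    unfolding Cl_carrier_iff by blast
  show "C \<otimes>\<^bsub>Cl K\<^esub> D \<in> carrier (Cl K)"
    unfolding Cl_carrier_iff *(2,4) Cl_mult[OF *(1,3)] using frac_ideal_prod[OF *(1,3)] by blast
  show "C \<otimes>\<^bsub>Cl K\<^esub> D = D \<otimes>\<^bsub>Cl K\<^esub> C"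
    unfolding *(2,4) Cl_mult[OF *(1,3)] Cl_mult[OF *(3,1)] ideal_prod_commute[of I J] ..
next
  show "\<one>\<^bsub>Cl K\<^esub> \<in> carrier (Cl K)" unfolding Cl_carrier_iff Cl_one using frac_ideal_OK by blast
next
  fix C assume "C \<in> carrier (Cl K)"
  then obtain I where *: "frac_ideal K I" "C = ideal_class K I" unfolding Cl_carrier_iff by blast
  show "\<one>\<^bsub>Cl K\<^esub> \<otimes>\<^bsub>Cl K\<^esub> C = C"
    unfolding Cl_one *(2) Cl_mult[OF frac_ideal_OK *(1)] ideal_prod_OK[OF *(1)] ..
qed

end

subsection \<open>Classes of ideals that become principal\<close>

context num_field_ext
begin

abbreviation contraction :: "complex \<Rightarrow> complex set" where
  "contraction b \<equiv> principal_ideal K b \<inter> k"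

text \<open>For a descending \<open>b\<close> this is the class of the ideal of \<open>k\<close>
  whose extension is generated by \<open>b\<close>, so it capitulates in \<open>K\<close>.\<close>

definition kappa :: "complex \<Rightarrow> complex set set" where
  "kappa b = ideal_class k (contraction b)"

definition unit :: "complex \<Rightarrow> bool" where
  "unit u \<longleftrightarrow> u \<in> OK K \<and> inverse u \<in> OK K \<and> u \<noteq> 0"

lemma ext_ideal_add: "x \<in> ext_ideal K I \<Longrightarrow> y \<in> ext_ideal K I \<Longrightarrow> x + y \<in> ext_ideal K I"
  unfolding ext_ideal_def by (rule ideal_prod_add)

lemma ext_ideal_mult: assumes "r \<in> OK K" "x \<in> ext_ideal K I" shows "r * x \<in> ext_ideal K I"
  using assms(2) unfolding ext_ideal_def by (rule ideal_prod_scale[rotated]) (use assms(1) in blast)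

lemma ext_ideal_0: "0 \<in> ext_ideal K I"
  unfolding ext_ideal_def by (rule ideal_prod_0)

lemma ext_ideal_base: "x \<in> I \<Longrightarrow> x \<in> ext_ideal K I"
  using ext_idealI[OF top.OK_1] by force

lemma principal_ideal_self: "b \<noteq> 0 \<Longrightarrow> b \<in> principal_ideal K b"
  by (simp add: principal_ideal_iff)

lemma principal_subset_ext:
  assumes "b \<in> ext_ideal K I" shows "principal_ideal K b \<subseteq> ext_ideal K I"
  unfolding principal_ideal_def using ext_ideal_mult[OF _ assms] by (auto simp: mult.commute[of b])

lemma ext_contraction_subset: "b \<noteq> 0 \<Longrightarrow> ext_ideal K (contraction b) \<subseteq> principal_ideal K b"
  by (rule ext_ideal_least)
    (auto simp: principal_ideal_add principal_ideal_mult, simp add: principal_ideal_iff)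

text \<open>The extension of the contraction always lies in the ideal of \<open>b\<close>, so
  equality is decided by membership of the generator alone.\<close>

lemma descends_iff: "descends b \<longleftrightarrow> b \<in> K \<and> b \<noteq> 0 \<and> b \<in> ext_ideal K (contraction b)"
proof
  assume "descends b"
  then show "b \<in> K \<and> b \<noteq> 0 \<and> b \<in> ext_ideal K (contraction b)"
    using principal_ideal_self unfolding descends_def by simp
next
  assume b: "b \<in> K \<and> b \<noteq> 0 \<and> b \<in> ext_ideal K (contraction b)"
  then have "ext_ideal K (contraction b) = principal_ideal K b"
    using ext_contraction_subset[of b] principal_subset_ext[of b "contraction b"] by (intro equalityI) auto
  then show "descends b" unfolding descends_def using b by blast
qed

lemma descendsD: "descends b \<Longrightarrow> b \<in> K" "descends b \<Longrightarrow> b \<noteq> 0"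
  "descends b \<Longrightarrow> ext_ideal K (contraction b) = principal_ideal K b"
  "descends b \<Longrightarrow> frac_ideal k (contraction b)"
  unfolding descends_def using contraction_frac_ideal by auto

lemma descends_of_principal:
  assumes I: "frac_ideal k I" and b: "b \<in> K" "b \<noteq> 0" "ext_ideal K I = principal_ideal K b"
  shows "descends b" "contraction b = I"
proof -
  show "contraction b = I" using ext_ideal_contract[OF I] b by simp
  then show "descends b" unfolding descends_def using b by simp
qed

text \<open>The product of the two contractions extends to the ideal of \<open>b * c\<close>, and an
  ideal of \<open>k\<close> is determined by its extension. The inclusion of \<open>b * c\<close> is
  checked by extending one factor at a time.\<close>

lemma descends_mult:
  assumes b: "descends b" and c: "descends c"
  shows "descends (b * c)" "kappa (b * c) = kappa b \<otimes>\<^bsub>Cl k\<^esub> kappa c"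
proof -
  note bD = descendsD[OF b] and cD = descendsD[OF c]
  let ?I = "contraction b" and ?J = "contraction c"
  have IJ: "frac_ideal k (ideal_prod ?I ?J)" by (rule base.frac_ideal_prod[OF bD(4) cD(4)])
  have bc: "b * c \<in> K" "b * c \<noteq> 0" using bD cD by auto
  have "ext_ideal K (ideal_prod ?I ?J) = principal_ideal K (b * c)"
  proof
    have "ideal_prod ?I ?J \<subseteq> principal_ideal K (b * c)"
    proof (rule ideal_prod_least)
      fix x y assume "x \<in> ?I" "y \<in> ?J"
      then have "(x / b) * (y / c) \<in> OK K" using bD cD by (intro top.OK_mult) (auto simp: principal_ideal_iff)
      then show "x * y \<in> principal_ideal K (b * c)" using bc by (simp add: principal_ideal_iff)
    qed (use principal_ideal_add[OF bc(2)] bc in \<open>auto simp: principal_ideal_iff\<close>)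
    then show "ext_ideal K (ideal_prod ?I ?J) \<subseteq> principal_ideal K (b * c)"
      by (intro ext_ideal_least) (use principal_ideal_add[OF bc(2)] principal_ideal_mult[OF bc(2)] bc in \<open>auto simp: principal_ideal_iff\<close>)
  next
    let ?E = "ext_ideal K (ideal_prod ?I ?J)"
    have 1: "x * w \<in> ?E" if x: "x \<in> ?I" and w: "w \<in> ext_ideal K ?J" for x w
    proof -
      have "ext_ideal K ?J \<subseteq> {w. x * w \<in> ?E}"
      proof (rule ext_ideal_least)
        show "y \<in> {w. x * w \<in> ?E}" if "y \<in> ?J" for y using ext_ideal_base ideal_prodI[OF x that] by blast
        show "r * y \<in> {w. x * w \<in> ?E}" if "r \<in> OK K" "y \<in> {w. x * w \<in> ?E}" for r y
          using ext_ideal_mult[OF that(1), of "x * y"] that(2) by (simp add: mult.left_commute)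
      qed (auto simp: distrib_left intro: ext_ideal_0 ext_ideal_add)
      then show ?thesis using w by blast
    qed
    have 2: "z * w \<in> ?E" if z: "z \<in> ext_ideal K ?I" and w: "w \<in> ext_ideal K ?J" for z w
    proof -
      have "ext_ideal K ?I \<subseteq> {z. z * w \<in> ?E}"
      proof (rule ext_ideal_least)
        show "y \<in> {z. z * w \<in> ?E}" if "y \<in> ?I" for y using 1[OF that w] by simp
        show "r * y \<in> {z. z * w \<in> ?E}" if "r \<in> OK K" "y \<in> {z. z * w \<in> ?E}" for r y
          using ext_ideal_mult[OF that(1), of "y * w"] that(2) by (simp add: mult.assoc)
      qed (auto simp: distrib_right intro: ext_ideal_0 ext_ideal_add)
      then show ?thesis using z by blast
    qed
    have "b * c \<in> ?E" using b c unfolding descends_iff by (intro 2) auto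
    then show "principal_ideal K (b * c) \<subseteq> ?E" by (rule principal_subset_ext)
  qed
  from descends_of_principal[OF IJ bc this]
  show "descends (b * c)" "kappa (b * c) = kappa b \<otimes>\<^bsub>Cl k\<^esub> kappa c"
    unfolding kappa_def base.Cl_mult[OF bD(4) cD(4)] by auto
qed

lemma principal_ideal_unit:
  assumes u: "unit u" shows "principal_ideal K (u * b) = principal_ideal K b"
proof (cases "b = 0")
  case False
  have "x / (u * b) \<in> OK K \<longleftrightarrow> x / b \<in> OK K" for x
  proof
    assume "x / (u * b) \<in> OK K"
    then have "u * (x / (u * b)) \<in> OK K" using u unfolding unit_def by blast
    then show "x / b \<in> OK K" using u unfolding unit_def by simp
  next
    assume "x / b \<in> OK K"
    then have "inverse u * (x / b) \<in> OK K" using u unfolding unit_def by blast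
    then show "x / (u * b) \<in> OK K" by (simp add: field_simps)
  qed
  then show ?thesis using False u unfolding unit_def by (auto simp: principal_ideal_iff)
qed simp

lemma unit_mult: "unit u \<Longrightarrow> unit v \<Longrightarrow> unit (u * v)"
  unfolding unit_def by auto

lemma unit_inverse: "unit u \<Longrightarrow> unit (inverse u)"
  unfolding unit_def by auto

lemma unit_mem: "unit u \<Longrightarrow> u \<in> K"
  unfolding unit_def using top.OK_mem_field by blast

lemma kappa_unit: "unit u \<Longrightarrow> kappa (u * b) = kappa b"
  unfolding kappa_def by (simp add: principal_ideal_unit)

lemma contraction_base:
  assumes c: "c \<in> k" "c \<noteq> 0" shows "contraction c = (\<lambda>x. c * x) ` OK k"
proof
  show "contraction c \<subseteq> (\<lambda>x. c * x) ` OK k"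
  proof
    fix x assume x: "x \<in> contraction c"
    then have "x / c \<in> OK k" using c by (auto simp: OK_base_iff principal_ideal_iff)
    then show "x \<in> (\<lambda>x. c * x) ` OK k" using c by (intro image_eqI[of _ _ "x / c"]) auto
  qed
  show "(\<lambda>x. c * x) ` OK k \<subseteq> contraction c"
    using c base.OK_mem_field by (auto simp: principal_ideal_iff OK_base_iff)
qed

lemma descends_base:
  assumes c: "c \<in> k" "c \<noteq> 0" shows "descends c" "kappa c = \<one>\<^bsub>Cl k\<^esub>"
proof -
  have "c \<in> contraction c" using c principal_ideal_self by blast
  then show "descends c" unfolding descends_iff using c k_subset ext_ideal_base by blast
  have "contraction c = (\<lambda>x. c * x) ` OK k" by (rule contraction_base[OF c])
  then have "ideal_class k (OK k) = ideal_class k (contraction c)"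
    using base.ideal_class_eq_iff[OF base.frac_ideal_OK contraction_frac_ideal, of c] c k_subset by blast
  then show "kappa c = \<one>\<^bsub>Cl k\<^esub>" unfolding kappa_def base.Cl_one by simp
qed

lemma kappa_carrier: "descends b \<Longrightarrow> kappa b \<in> carrier (Cl k)"
  unfolding kappa_def base.Cl_carrier_iff using descendsD(4) by blast

lemma descends_power:
  assumes "descends b" shows "descends (b ^ n)" "kappa (b ^ n) = kappa b [^]\<^bsub>Cl k\<^esub> n"
proof -
  interpret C: comm_monoid "Cl k" by (rule base.Cl_comm_monoid)
  have "descends (b ^ n) \<and> kappa (b ^ n) = kappa b [^]\<^bsub>Cl k\<^esub> n"
  proof (induction n)
    case 0
    then show ?case using descends_base[of 1] by simp
  next
    case (Suc n)
    then show ?case using descends_mult[OF _ assms, of "b ^ n"] by (simp add: mult.commute)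
  qed
  then show "descends (b ^ n)" "kappa (b ^ n) = kappa b [^]\<^bsub>Cl k\<^esub> n" by auto
qed

text \<open>The fibres of \<open>kappa\<close> are cosets of nonzero elements of \<open>k\<close>
  times units of \<open>K\<close>. Equal classes scale the contractions by some \<open>c\<close> in
  \<open>k\<close>; after extension \<open>b'\<close> and \<open>c * b\<close> generate the same
  ideal.\<close>

lemma kappa_eqD:
  assumes b: "descends b" and b': "descends b'" and eq: "kappa b = kappa b'"
  obtains c u where "c \<in> k" "c \<noteq> 0" "unit u" "b' = c * u * b"
proof -
  note bD = descendsD[OF b] and b'D = descendsD[OF b']
  obtain c where c: "c \<in> k" "c \<noteq> 0" "contraction b' = (\<lambda>x. c * x) ` contraction b"
    using eq unfolding kappa_def base.ideal_class_eq_iff[OF bD(4) b'D(4)] by blast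
  have cb: "c * b \<in> K" "c * b \<noteq> 0" using c bD k_subset by auto
  have "contraction b' = contraction (c * b)"
    unfolding c(3)
  proof
    show "(\<lambda>x. c * x) ` contraction b \<subseteq> contraction (c * b)"
      using c bD(2) by (auto simp: principal_ideal_iff)
    show "contraction (c * b) \<subseteq> (\<lambda>x. c * x) ` contraction b"
    proof
      fix x assume x: "x \<in> contraction (c * b)"
      then have "x / c \<in> contraction b" using c bD(2) by (auto simp: principal_ideal_iff)
      then show "x \<in> (\<lambda>x. c * x) ` contraction b" using c by (intro image_eqI[of _ _ "x / c"]) auto
    qed
  qed
  then have "ext_ideal K (contraction b') = ext_ideal K (contraction (c * b))" by (rule arg_cong)
  then have eqP: "principal_ideal K b' = principal_ideal K (c * b)"
    unfolding b'D(3) descendsD(3)[OF descends_mult(1)[OF descends_base(1)[OF c(1,2)] b]] .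
  define u where "u = b' / (c * b)"
  have "b' \<in> principal_ideal K (c * b)" "c * b \<in> principal_ideal K b'"
    using eqP principal_ideal_self[OF b'D(2)] principal_ideal_self[OF cb(2)] by auto
  then have "unit u" unfolding unit_def u_def using cb b'D(2) by (auto simp: principal_ideal_iff)
  moreover have "b' = c * u * b" unfolding u_def using cb by simp
  ultimately show ?thesis using that c by blast
qed

text \<open>A generator of the extended ideal provides \<open>b\<close>; contraction recovers the
  ideal from it.\<close>

lemma Cap_iff: "C \<in> Cap k K \<longleftrightarrow> (\<exists>b. descends b \<and> C = kappa b)"
proof
  assume "C \<in> Cap k K"
  then obtain I L where I: "I \<in> C" "is_principal K (ext_ideal K I)" and L: "frac_ideal k L" "C = ideal_class k L"
    unfolding Cap_def base.Cl_carrier_iff by blast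
  have fI: "frac_ideal k I" using I(1) unfolding L(2) by (rule base.ideal_class_memD)
  obtain b where b: "b \<in> K" "b \<noteq> 0" "ext_ideal K I = principal_ideal K b"
    using I(2) unfolding is_principal_def by blast
  have "C = ideal_class k I" using base.ideal_class_of_member[OF L(1)] I(1) L(2) by simp
  then show "\<exists>b. descends b \<and> C = kappa b"
    using descends_of_principal[OF fI b] unfolding kappa_def by auto
next
  assume "\<exists>b. descends b \<and> C = kappa b"
  then obtain b where b: "descends b" "C = kappa b" by blast
  have "contraction b \<in> C" unfolding b(2) kappa_def by (rule base.ideal_class_refl[OF descendsD(4)[OF b(1)]])
  moreover have "is_principal K (ext_ideal K (contraction b))"
    unfolding is_principal_def using descendsD[OF b(1)] by blast
  ultimately show "C \<in> Cap k K" unfolding Cap_def using kappa_carrier[OF b(1)] b(2) by blast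
qed

end

context conj_galois_ext
begin

lemma unit_cocycle_alt: "unit_cocycle a \<longleftrightarrow> a \<in> K \<and> a \<noteq> 0 \<and> (\<forall>\<sigma>\<in>Gal K k. unit (\<sigma> a / a))"
  using Gal_nonzero unfolding unit_cocycle_def unit_def by auto

text \<open>An ideal extended from \<open>k\<close> is Galois stable: the preimage of
  \<open>(b)\<close> under \<open>\<sigma>\<close> is an \<open>OK K\<close>-module which contains
  the contraction, hence its extension, hence \<open>b\<close>. Integrality of
  \<open>b / \<sigma> b\<close> comes from the same statement for the inverse of
  \<open>\<sigma>\<close>.\<close>

lemma descends_unit_cocycle:
  assumes b: "descends b" shows "unit_cocycle b"
proof -
  note bD = descendsD[OF b]
  have key: "\<sigma> b / b \<in> OK K" if \<sigma>: "\<sigma> \<in> Gal K k" for \<sigma>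
  proof -
    let ?M = "{x \<in> K. \<sigma> x \<in> principal_ideal K b}"
    have PK: "principal_ideal K b \<subseteq> K"
      unfolding principal_ideal_def using bD(1) top.OK_mem_field by blast
    have "ext_ideal K (contraction b) \<subseteq> ?M"
    proof (rule ext_ideal_least)
      show "x \<in> ?M" if "x \<in> contraction b" for x
        using that Gal_base[OF \<sigma>, of x] k_subset by auto
      show "0 \<in> ?M" using Gal_zero[OF \<sigma>] bD(2) by (simp add: principal_ideal_iff)
      show "x + y \<in> ?M" if "x \<in> ?M" "y \<in> ?M" for x y
        using that Gal_add[OF \<sigma>, of x y] principal_ideal_add[OF bD(2)] by auto
      show "r * x \<in> ?M" if "r \<in> OK K" "x \<in> ?M" for r x
        using that Gal_mult[OF \<sigma>, of r x] principal_ideal_mult[OF bD(2) top.Gal_OK[OF \<sigma>]] top.OK_mem_field by auto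
    qed
    then have "b \<in> ?M" using b unfolding descends_iff by blast
    then show ?thesis using bD(2) by (simp add: principal_ideal_iff)
  qed
  have "b / \<sigma> b \<in> OK K" if \<sigma>: "\<sigma> \<in> Gal K k" for \<sigma>
  proof -
    obtain \<rho> where \<rho>: "\<rho> \<in> Gal K k" "\<forall>x. \<sigma> (\<rho> x) = x" using Gal_inv[OF \<sigma>] by blast
    have "\<sigma> (\<rho> b / b) \<in> OK K" by (rule top.Gal_OK[OF \<sigma> key[OF \<rho>(1)]])
    then show ?thesis using Gal_divide[OF \<sigma> Gal_closed[OF \<rho>(1) bD(1)] bD(1)] \<rho>(2) by simp
  qed
  then show ?thesis unfolding unit_cocycle_def using bD key by blast
qed

lemma unit_cnj: "unit u \<Longrightarrow> unit (cnj u)"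
  unfolding unit_def using OK_cnj[of u] OK_cnj[of "inverse u"] by simp

lemma contraction_cnj: assumes b: "b \<noteq> 0" shows "contraction (cnj b) = cnj ` contraction b"
proof
  show "cnj ` contraction b \<subseteq> contraction (cnj b)"
  proof
    fix x assume "x \<in> cnj ` contraction b"
    then obtain y where y: "y \<in> contraction b" "x = cnj y" by blast
    then have "cnj (y / b) \<in> OK K" using b by (intro OK_cnj) (simp add: principal_ideal_iff)
    then show "x \<in> contraction (cnj b)" using y b cnj_base by (simp add: principal_ideal_iff)
  qed
  show "contraction (cnj b) \<subseteq> cnj ` contraction b"
  proof
    fix x assume x: "x \<in> contraction (cnj b)"
    then have "cnj (x / cnj b) \<in> OK K" using b by (intro OK_cnj) (simp add: principal_ideal_iff)
    then have "cnj x \<in> contraction b" using x b cnj_base by (simp add: principal_ideal_iff)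
    then show "x \<in> cnj ` contraction b" by (intro image_eqI[of _ _ "cnj x"]) auto
  qed
qed

lemma descends_cnj: assumes b: "descends b" shows "descends (cnj b)"
proof -
  have "ext_ideal K (contraction b) \<subseteq> {x. cnj x \<in> ext_ideal K (contraction (cnj b))}"
  proof (rule ext_ideal_least)
    show "x \<in> {x. cnj x \<in> ext_ideal K (contraction (cnj b))}" if "x \<in> contraction b" for x
      using that contraction_cnj[OF descendsD(2)[OF b]] ext_ideal_base by blast
    show "r * x \<in> {x. cnj x \<in> ext_ideal K (contraction (cnj b))}"
      if "r \<in> OK K" "x \<in> {x. cnj x \<in> ext_ideal K (contraction (cnj b))}" for r x
      using that ext_ideal_mult[OF OK_cnj] by simp
  qed (auto intro: ext_ideal_0 ext_ideal_add)
  then show ?thesis using b cnj_top unfolding descends_iff by auto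
qed

text \<open>The chosen representative is the contraction times some \<open>a\<close> in
  \<open>k\<close>; conjugation turns this factor into \<open>cnj a\<close>, which the class
  ignores.\<close>

lemma tau_class_kappa: assumes b: "descends b" shows "tau_class k (kappa b) = kappa (cnj b)"
proof -
  note bD = descendsD[OF b]
  let ?J = "SOME J. J \<in> ideal_class k (contraction b)"
  obtain a where a: "a \<in> k" "a \<noteq> 0" "?J = (\<lambda>x. a * x) ` contraction b" "frac_ideal k ?J"
    using base.ideal_class_rep[OF bD(4)] by blast
  have img: "cnj ` ?J = (\<lambda>x. cnj a * x) ` contraction (cnj b)"
    unfolding a(3) contraction_cnj[OF bD(2)] image_image by simp
  have ab: "descends (a * b)" by (rule descends_mult(1)[OF descends_base(1)[OF a(1,2)] b])
  have "frac_ideal k (contraction (cnj (a * b)))" by (rule descendsD(4)[OF descends_cnj[OF ab]])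
  moreover have "contraction (cnj (a * b)) = cnj ` ?J"
  proof -
    have "contraction (a * b) = ?J"
      unfolding a(3)
    proof
      show "(\<lambda>x. a * x) ` contraction b \<subseteq> contraction (a * b)"
        using a(1,2) bD(2) by (auto simp: principal_ideal_iff)
      show "contraction (a * b) \<subseteq> (\<lambda>x. a * x) ` contraction b"
      proof
        fix x assume x: "x \<in> contraction (a * b)"
        then have "x / a \<in> contraction b" using a(1,2) bD(2) by (auto simp: principal_ideal_iff)
        then show "x \<in> (\<lambda>x. a * x) ` contraction b" using a(2) by (intro image_eqI[of _ _ "x / a"]) auto
      qed
    qed
    then show ?thesis using contraction_cnj[OF descendsD(2)[OF ab]] by simp
  qed
  ultimately have fJ: "frac_ideal k (cnj ` ?J)" by simp
  have "ideal_class k (contraction (cnj b)) = ideal_class k (cnj ` ?J)"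
    unfolding base.ideal_class_eq_iff[OF descendsD(4)[OF descends_cnj[OF b]] fJ]
    using img cnj_base[OF a(1)] a(2) by (intro bexI[of _ "cnj a"]) auto
  then show ?thesis unfolding tau_class_def kappa_def by simp
qed

text \<open>An odd-order class \<open>kappa b\<close> gives \<open>b ^ n = c * u\<close> with
  \<open>c\<close> in \<open>k\<close> and \<open>u\<close> a unit. Conjugating this equation bounds
  the order of \<open>kappa (cnj b)\<close>, and dividing the two equations bounds that of the
  ratio.\<close>

lemma kappa_conj_ratio:
  assumes b: "descends b" and n: "odd (n :: nat)" "kappa b [^]\<^bsub>Cl k\<^esub> n = \<one>\<^bsub>Cl k\<^esub>"
  shows "descends (b / cnj b)" "kappa b \<otimes>\<^bsub>Cl k\<^esub> inv\<^bsub>Cl k\<^esub> kappa (cnj b) = kappa (b / cnj b)"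
    "kappa (b / cnj b) [^]\<^bsub>Cl k\<^esub> n = \<one>\<^bsub>Cl k\<^esub>"
proof -
  interpret C: comm_monoid "Cl k" by (rule base.Cl_comm_monoid)
  note bD = descendsD[OF b] and b'D = descendsD[OF descends_cnj[OF b]]
  show d: "descends (b / cnj b)" by (rule descends_ratio[OF descends_unit_cocycle[OF b]])
  have "kappa (b ^ n) = kappa 1" using n(2) descends_power[OF b] descends_base[of 1] by simp
  then obtain c u where cu: "c \<in> k" "c \<noteq> 0" "unit u" "b ^ n = c * u * 1"
    using kappa_eqD[OF descends_base(1)[of 1] descends_power(1)[OF b, of n]] by (metis base.one_mem zero_neq_one)
  have cn: "cnj b ^ n = cnj u * cnj c"
    using arg_cong[OF cu(4), of cnj] by (simp add: mult.commute)
  have kn: "kappa (cnj b ^ n) = \<one>\<^bsub>Cl k\<^esub>"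
    unfolding cn kappa_unit[OF unit_cnj[OF cu(3)]] using cu cnj_base by (intro descends_base) auto
  \<comment> \<open>The power \<open>n - 1\<close> of \<open>kappa (cnj b)\<close> is its inverse in
    the monoid. Multiplying by it differs from dividing by \<open>cnj b\<close> only by
    \<open>cnj b ^ n\<close>, whose class is trivial.\<close>
  obtain m where m: "n = Suc m" using n(1) by (cases n) auto
  let ?y = "kappa (cnj b ^ m)"
  have y: "kappa (cnj b) \<otimes>\<^bsub>Cl k\<^esub> ?y = \<one>\<^bsub>Cl k\<^esub>"
    using descends_mult(2)[OF descends_cnj[OF b] descends_power(1)[OF descends_cnj[OF b]], of m] kn m by simp
  have inv: "inv\<^bsub>Cl k\<^esub> kappa (cnj b) = ?y"
    by (rule C.comm_inv_char[OF kappa_carrier[OF descends_cnj[OF b]] kappa_carrier[OF descends_power(1)[OF descends_cnj[OF b]]] y])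
  have "kappa b \<otimes>\<^bsub>Cl k\<^esub> ?y = kappa (b * cnj b ^ m)"
    using descends_mult(2)[OF b descends_power(1)[OF descends_cnj[OF b]]] by simp
  also have "b * cnj b ^ m = (b / cnj b) * cnj b ^ n" using b'D(2) m by simp
  also have "kappa \<dots> = kappa (b / cnj b) \<otimes>\<^bsub>Cl k\<^esub> \<one>\<^bsub>Cl k\<^esub>"
    using descends_mult(2)[OF d descends_power(1)[OF descends_cnj[OF b]], of n] kn by simp
  also have "\<dots> = kappa (b / cnj b)" using kappa_carrier[OF d] by simp
  finally show "kappa b \<otimes>\<^bsub>Cl k\<^esub> inv\<^bsub>Cl k\<^esub> kappa (cnj b) = kappa (b / cnj b)" unfolding inv .
  have "(b / cnj b) ^ n = (u * inverse (cnj u)) * (c / cnj c)"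
    unfolding power_divide cu(4) cn using cu(2,3) by (simp add: field_simps unit_def)
  then have "kappa ((b / cnj b) ^ n) = kappa ((u * inverse (cnj u)) * (c / cnj c))" by (rule arg_cong)
  also have "\<dots> = kappa (c / cnj c)"
    by (rule kappa_unit[OF unit_mult[OF cu(3) unit_inverse[OF unit_cnj[OF cu(3)]]]])
  also have "\<dots> = \<one>\<^bsub>Cl k\<^esub>" using cu cnj_base by (intro descends_base) auto
  finally show "kappa (b / cnj b) [^]\<^bsub>Cl k\<^esub> n = \<one>\<^bsub>Cl k\<^esub>" using descends_power(2)[OF d] by simp
qed

lemma Cap_hat_minus_carrier:
  "carrier (Cap_hat_minus k K) = {kappa (b / cnj b) | b. descends b \<and> (\<exists>n :: nat. odd n \<and> kappa b [^]\<^bsub>Cl k\<^esub> n = \<one>\<^bsub>Cl k\<^esub>)}"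
proof -
  have "C \<in> carrier (Cap_hat_minus k K) \<longleftrightarrow>
      (\<exists>b. C = kappa (b / cnj b) \<and> descends b \<and> (\<exists>n :: nat. odd n \<and> kappa b [^]\<^bsub>Cl k\<^esub> n = \<one>\<^bsub>Cl k\<^esub>))" for C
  proof
    assume "C \<in> carrier (Cap_hat_minus k K)"
    then obtain D n where D: "C = D \<otimes>\<^bsub>Cl k\<^esub> inv\<^bsub>Cl k\<^esub> (tau_class k D)" "D \<in> Cap k K" "odd (n :: nat)" "D [^]\<^bsub>Cl k\<^esub> n = \<one>\<^bsub>Cl k\<^esub>"
      unfolding Cap_hat_minus_def Cap_hat_def by auto
    then obtain b where b: "descends b" "D = kappa b" unfolding Cap_iff by blast
    have "C = kappa (b / cnj b)" unfolding D(1) b(2) tau_class_kappa[OF b(1)]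
      by (rule kappa_conj_ratio(2)[OF b(1) D(3)]) (use D b in simp)
    then show "\<exists>b. C = kappa (b / cnj b) \<and> descends b \<and> (\<exists>n :: nat. odd n \<and> kappa b [^]\<^bsub>Cl k\<^esub> n = \<one>\<^bsub>Cl k\<^esub>)"
      using b D by blast
  next
    assume "\<exists>b. C = kappa (b / cnj b) \<and> descends b \<and> (\<exists>n :: nat. odd n \<and> kappa b [^]\<^bsub>Cl k\<^esub> n = \<one>\<^bsub>Cl k\<^esub>)"
    then obtain b n where b: "C = kappa (b / cnj b)" "descends b" "odd (n :: nat)" "kappa b [^]\<^bsub>Cl k\<^esub> n = \<one>\<^bsub>Cl k\<^esub>" by blast
    have "kappa b \<in> Cap_hat k K" unfolding Cap_hat_def using b Cap_iff by blast
    moreover have "C = kappa b \<otimes>\<^bsub>Cl k\<^esub> inv\<^bsub>Cl k\<^esub> (tau_class k (kappa b))"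
      unfolding tau_class_kappa[OF b(2)] kappa_conj_ratio(2)[OF b(2,3,4)] by (rule b(1))
    moreover have "carrier (Cap_hat_minus k K) = {D \<otimes>\<^bsub>Cl k\<^esub> inv\<^bsub>Cl k\<^esub> (tau_class k D) | D. D \<in> Cap_hat k K}"
      unfolding Cap_hat_minus_def by simp
    ultimately show "C \<in> carrier (Cap_hat_minus k K)" by blast
  qed
  note iff = this
  show ?thesis
  proof (rule Set.set_eqI)
    fix C
    show "C \<in> carrier (Cap_hat_minus k K) \<longleftrightarrow> C \<in> {kappa (b / cnj b) | b. descends b \<and> (\<exists>n :: nat. odd n \<and> kappa b [^]\<^bsub>Cl k\<^esub> n = \<one>\<^bsub>Cl k\<^esub>)}"
      unfolding mem_Collect_eq by (rule iff)
  qed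
qed

end

subsection \<open>The isomorphism\<close>

text \<open>Half of \<open>n + 1\<close> inverts 2 modulo the odd number \<open>n\<close>; its
  \<open>s\<close>-th power is the witness.\<close>

lemma inverse_power_mod_odd:
  fixes n :: nat assumes "odd n" obtains t j where "2 ^ s * t = Suc (n * j)"
proof -
  obtain h where h: "Suc n = 2 * h" using assms by (metis even_Suc evenE)
  have "\<exists>j. Suc n ^ s = Suc (n * j)"
  proof (induction s)
    case (Suc s)
    then obtain j where "Suc n ^ s = Suc (n * j)" by blast
    then have "Suc n ^ Suc s = Suc (n * (1 + j + n * j))" by (simp add: algebra_simps)
    then show ?case by blast
  qed (rule exI[of _ 0], simp)
  then obtain j where "2 ^ s * h ^ s = Suc (n * j)" unfolding h power_mult_distrib by blast
  then show ?thesis by (rule that)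
qed

lemma even_odd_decomposition:
  assumes "(e :: nat) > 0" obtains s m where "odd m" "e = 2 ^ s * m"
proof -
  have "\<exists>s m. odd m \<and> e = 2 ^ s * m"
    using assms
  proof (induction e rule: less_induct)
    case (less e)
    show ?case
    proof (cases "odd e")
      case True
      then show ?thesis by (intro exI[of _ 0] exI[of _ e]) simp
    next
      case False
      then obtain f where f: "e = 2 * f" by (auto elim: evenE)
      then have "f < e" "0 < f" using less.prems by auto
      then obtain s m where "odd m" "f = 2 ^ s * m" using less.IH by blast
      then show ?thesis using f by (intro exI[of _ "Suc s"] exI[of _ m]) simp
    qed
  qed
  then show ?thesis using that by blast
qed

lemma alg_integer_root_of_unity: assumes "z ^ n = 1" "n > 0" shows "alg_integer z"
  unfolding alg_integer_iff_algebraic_int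
  by (rule algebraic_int_root[of 1 "monom 1 n"]) (use assms in \<open>auto simp: poly_monom degree_monom_eq coeff_monom\<close>)

lemma norm_root_of_unity: assumes "(z :: complex) ^ n = 1" "n > 0" shows "norm z = 1"
  using assms by (metis norm_one norm_power power_eq_1_iff norm_ge_zero gr_implies_not0 abs_norm_cancel real_norm_def)

text \<open>The added assumption is the form in which Kronecker's theorem enters: if conjugation
  commutes with all embeddings, \<open>u * cnj u = 1\<close> puts every conjugate of
  \<open>u\<close> on the unit circle.\<close>

locale cm_galois_ext = conj_galois_ext +
  assumes unitary_unit: "\<And>u. u \<in> OK K \<Longrightarrow> u * cnj u = 1 \<Longrightarrow> \<exists>n>0. u ^ n = 1"
begin

abbreviation G where "G \<equiv> Gal K k"
abbreviation M where "M \<equiv> mu_hat K"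

lemma mu_hat_unit: assumes "z \<in> M" shows "unit z" "z * cnj z = 1" "cnj z = inverse z"
proof -
  obtain n :: nat where n: "odd n" "z ^ n = 1" "z \<in> K" using assms unfolding mu_hat_def by blast
  have n0: "n > 0" using n(1) by (cases n) auto
  have z0: "z \<noteq> 0" using n n0 by (auto simp: power_0_left)
  have "inverse z ^ n = 1" using n(2) by (simp add: power_inverse)
  then show "unit z"
    unfolding unit_def OK_def using alg_integer_root_of_unity[OF _ n0] n z0 by auto
  have "norm z = 1" by (rule norm_root_of_unity[OF n(2) n0])
  then show "z * cnj z = 1" by (simp add: complex_norm_square[symmetric])
  then show "cnj z = inverse z" by (metis inverse_unique)
qed

lemma mu_hat_mult: assumes "x \<in> M" "y \<in> M" shows "x * y \<in> M"
proof -
  obtain n m :: nat where "odd n" "x ^ n = 1" "x \<in> K" "odd m" "y ^ m = 1" "y \<in> K"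
    using assms unfolding mu_hat_def by blast
  moreover have "(x * y) ^ (n * m) = (x ^ n) ^ m * (y ^ m) ^ n"
    by (simp add: power_mult_distrib power_mult mult.commute flip: power_mult)
  ultimately show ?thesis unfolding mu_hat_def by (auto intro!: exI[of _ "n * m"])
qed

lemma mu_hat_inverse: assumes "v \<in> M" shows "inverse v \<in> M"
proof -
  obtain n :: nat where "odd n" "v ^ n = 1" "v \<in> K" using assms unfolding mu_hat_def by blast
  then show ?thesis unfolding mu_hat_def by (auto simp: power_inverse intro!: exI[of _ n])
qed

lemma mu_hat_1: "1 \<in> M" unfolding mu_hat_def by (auto intro!: exI[of _ 1])

section \<open>Cocycles, their Hilbert 90 elements and cohomology classes\<close>

definition trivializes :: "((complex \<Rightarrow> complex) \<Rightarrow> complex) \<Rightarrow> complex \<Rightarrow> bool" where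
  "trivializes f a \<longleftrightarrow> f \<in> cocycles G M \<and> a \<in> K \<and> a \<noteq> 0 \<and> (\<forall>\<sigma>\<in>G. f \<sigma> = \<sigma> a / a)"

lemma exists_trivialization: assumes f: "f \<in> cocycles G M" shows "\<exists>a. trivializes f a"
proof -
  have fM: "f \<sigma> \<in> M" if "\<sigma> \<in> G" for \<sigma> using f that unfolding cocycles_def by blast
  have fK: "f \<sigma> \<in> K" "f \<sigma> \<noteq> 0" if "\<sigma> \<in> G" for \<sigma>
    using mu_hat_unit(1)[OF fM[OF that]] unit_mem unfolding unit_def by auto
  have coc: "f (\<sigma> \<circ> \<rho>) = f \<sigma> * \<sigma> (f \<rho>)" if "\<sigma> \<in> G" "\<rho> \<in> G" for \<sigma> \<rho>
    using f that unfolding cocycles_def by blast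
  have "G \<noteq> {}" using top.Gal_id[OF k_subset] by blast
  then obtain a where "a \<in> K" "a \<noteq> 0" "\<And>\<sigma>. \<sigma> \<in> G \<Longrightarrow> f \<sigma> = \<sigma> a / a"
    using top.hilbert90[OF finite_Gal fK coc] by blast
  then show ?thesis unfolding trivializes_def using f by blast
qed

lemma trivializesI:
  assumes a: "a \<in> K" "a \<noteq> 0" and "\<And>\<sigma>. \<sigma> \<in> G \<Longrightarrow> \<sigma> a / a \<in> M"
  shows "trivializes (\<lambda>\<sigma>. if \<sigma> \<in> G then \<sigma> a / a else 1) a"
proof -
  have "(\<sigma> \<circ> \<rho>) a / a = (\<sigma> a / a) * \<sigma> (\<rho> a / a)" if s: "\<sigma> \<in> G" "\<rho> \<in> G" for \<sigma> \<rho>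
    using Gal_divide[OF s(1) Gal_closed[OF s(2) a(1)] a(1)] Gal_nonzero[OF s(1) a] a(2) by simp
  then show ?thesis unfolding trivializes_def cocycles_def using assms top.Gal_comp by auto
qed

lemma trivializes_mem: "trivializes f a \<Longrightarrow> \<sigma> \<in> G \<Longrightarrow> f \<sigma> \<in> M"
  unfolding trivializes_def cocycles_def by blast

lemma trivializes_unit_cocycle: assumes "trivializes f a" shows "unit_cocycle a"
  unfolding unit_cocycle_alt
  using assms mu_hat_unit(1)[OF trivializes_mem[OF assms]] unfolding trivializes_def by auto

lemma trivializes_descends: "trivializes f a \<Longrightarrow> descends (a / cnj a)"
  by (rule descends_ratio[OF trivializes_unit_cocycle])

lemma trivializes_mult:
  assumes f: "trivializes f a" and g: "trivializes g b"
  shows "trivializes (\<lambda>\<sigma>. f \<sigma> * g \<sigma>) (a * b)"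
proof -
  have ab: "a \<in> K" "a \<noteq> 0" "b \<in> K" "b \<noteq> 0" using f g unfolding trivializes_def by auto
  have 1: "f \<sigma> * g \<sigma> = \<sigma> (a * b) / (a * b)" if "\<sigma> \<in> G" for \<sigma>
    using f g that Gal_mult[OF that ab(1,3)] unfolding trivializes_def by simp
  have 2: "f \<sigma> * g \<sigma> = 1" if "\<sigma> \<notin> G" for \<sigma>
    using f g that unfolding trivializes_def cocycles_def by simp
  have "trivializes (\<lambda>\<sigma>. if \<sigma> \<in> G then \<sigma> (a * b) / (a * b) else 1) (a * b)"
  proof (rule trivializesI)
    show "\<sigma> (a * b) / (a * b) \<in> M" if "\<sigma> \<in> G" for \<sigma>
      unfolding 1[OF that, symmetric] using trivializes_mem[OF f that] trivializes_mem[OF g that] by (rule mu_hat_mult)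
  qed (use ab in auto)
  also have "(\<lambda>\<sigma>. if \<sigma> \<in> G then \<sigma> (a * b) / (a * b) else 1) = (\<lambda>\<sigma>. f \<sigma> * g \<sigma>)"
    by (rule ext) (use 1 2 in auto)
  finally show ?thesis .
qed

definition cls :: "((complex \<Rightarrow> complex) \<Rightarrow> complex) \<Rightarrow> ((complex \<Rightarrow> complex) \<Rightarrow> complex) set" where
  "cls f = {g \<in> cocycles G M. \<exists>b\<in>coboundaries G M. g = (\<lambda>\<sigma>. f \<sigma> * b \<sigma>)}"

lemma coboundary_iff: "b \<in> coboundaries G M \<longleftrightarrow> (\<exists>v\<in>M. b = (\<lambda>\<sigma>. if \<sigma> \<in> G then \<sigma> v / v else 1))"
  unfolding coboundaries_def by blast

lemma cls_iff:
  "g \<in> cls f \<longleftrightarrow> g \<in> cocycles G M \<and> (\<exists>v\<in>M. g = (\<lambda>\<sigma>. f \<sigma> * (if \<sigma> \<in> G then \<sigma> v / v else 1)))"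
proof -
  have "(\<exists>b\<in>coboundaries G M. P b) \<longleftrightarrow> (\<exists>v\<in>M. P (\<lambda>\<sigma>. if \<sigma> \<in> G then \<sigma> v / v else 1))" for P
    unfolding coboundaries_def by blast
  then show ?thesis unfolding cls_def mem_Collect_eq by (simp only:)
qed

lemma cls_refl: assumes "f \<in> cocycles G M" shows "f \<in> cls f"
proof -
  have "\<sigma> 1 = 1" if "\<sigma> \<in> G" for \<sigma> using top.emb_1[OF Gal_emb[OF that]] .
  then have "f = (\<lambda>\<sigma>. f \<sigma> * (if \<sigma> \<in> G then \<sigma> 1 / 1 else 1))" by auto
  then show ?thesis unfolding cls_iff using assms mu_hat_1 by blast
qed

lemma coboundary_mult: assumes "v \<in> M" "w \<in> M" "\<sigma> \<in> G"
  shows "\<sigma> (v * w) / (v * w) = (\<sigma> v / v) * (\<sigma> w / w)"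
  using Gal_mult[OF assms(3), of v w] assms unit_mem mu_hat_unit(1) by simp

lemma cls_trans: assumes "g \<in> cls f" "h \<in> cls g" shows "h \<in> cls f"
proof -
  obtain v w where vw: "v \<in> M" "w \<in> M" "g = (\<lambda>\<sigma>. f \<sigma> * (if \<sigma> \<in> G then \<sigma> v / v else 1))"
    "h = (\<lambda>\<sigma>. g \<sigma> * (if \<sigma> \<in> G then \<sigma> w / w else 1))" "h \<in> cocycles G M"
    using assms unfolding cls_iff by blast
  have "h = (\<lambda>\<sigma>. f \<sigma> * (if \<sigma> \<in> G then \<sigma> (v * w) / (v * w) else 1))"
  proof (rule ext)
    fix \<sigma>
    show "h \<sigma> = f \<sigma> * (if \<sigma> \<in> G then \<sigma> (v * w) / (v * w) else 1)"
    proof (cases "\<sigma> \<in> G")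
      case True
      show ?thesis using coboundary_mult[OF vw(1,2) True] True by (simp only: vw(3,4) if_True mult.assoc)
    qed (simp add: vw(3,4))
  qed
  then show ?thesis unfolding cls_iff using vw mu_hat_mult by blast
qed

lemma cls_sym: assumes "g \<in> cls f" "f \<in> cocycles G M" shows "f \<in> cls g"
proof -
  obtain v where v: "v \<in> M" "g = (\<lambda>\<sigma>. f \<sigma> * (if \<sigma> \<in> G then \<sigma> v / v else 1))"
    using assms unfolding cls_iff by blast
  have vK: "v \<in> K" "v \<noteq> 0" using mu_hat_unit(1)[OF v(1)] unit_mem unfolding unit_def by auto
  have "f = (\<lambda>\<sigma>. g \<sigma> * (if \<sigma> \<in> G then \<sigma> (inverse v) / inverse v else 1))"
  proof (rule ext)
    fix \<sigma>
    show "f \<sigma> = g \<sigma> * (if \<sigma> \<in> G then \<sigma> (inverse v) / inverse v else 1)"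
    proof (cases "\<sigma> \<in> G")
      case True
      then show ?thesis
        using Gal_inverse_eq[OF True vK(1)] Gal_nonzero[OF True vK] vK(2) by (simp add: v(2) field_simps)
    qed (simp add: v(2))
  qed
  then show ?thesis unfolding cls_iff using assms(2) mu_hat_inverse[OF v(1)] by blast
qed

lemma cls_eq_iff: assumes "f \<in> cocycles G M" "g \<in> cocycles G M" shows "cls f = cls g \<longleftrightarrow> g \<in> cls f"
  using cls_refl cls_trans cls_sym assms by blast

lemma H1_carrier: "carrier (H1 G M) = cls ` cocycles G M"
proof -
  have "carrier (H1 G M) = {cls f | f. f \<in> cocycles G M}" 
    unfolding H1_def cls_def partial_object.select_convs ..
  also have "\<dots> = cls ` cocycles G M" by blast
  finally show ?thesis .
qed

lemma H1_mult:
  assumes f: "f \<in> cocycles G M" and g: "g \<in> cocycles G M"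
  shows "cls f \<otimes>\<^bsub>H1 G M\<^esub> cls g = cls (\<lambda>\<sigma>. f \<sigma> * g \<sigma>)"
proof -
  have "h \<in> cls (\<lambda>\<sigma>. f \<sigma> * g \<sigma>) \<longleftrightarrow> h \<in> cocycles G M \<and>
      (\<exists>f'\<in>cls f. \<exists>g'\<in>cls g. \<exists>b\<in>coboundaries G M. h = (\<lambda>\<sigma>. f' \<sigma> * g' \<sigma> * b \<sigma>))" (is "_ \<longleftrightarrow> ?R") for h
  proof
    assume "h \<in> cls (\<lambda>\<sigma>. f \<sigma> * g \<sigma>)"
    then show ?R using cls_refl[OF f] cls_refl[OF g] unfolding cls_def by blast
  next
    assume ?R
    then obtain v w x where *: "v \<in> M" "w \<in> M" "x \<in> M" "h \<in> cocycles G M"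
      "h = (\<lambda>\<sigma>. (f \<sigma> * (if \<sigma> \<in> G then \<sigma> v / v else 1)) * (g \<sigma> * (if \<sigma> \<in> G then \<sigma> w / w else 1)) * (if \<sigma> \<in> G then \<sigma> x / x else 1))"
    proof -
      from \<open>?R\<close> obtain f' g' b where 1: "f' \<in> cls f" "g' \<in> cls g" "b \<in> coboundaries G M"
        "h \<in> cocycles G M" "h = (\<lambda>\<sigma>. f' \<sigma> * g' \<sigma> * b \<sigma>)" by blast
      obtain v where v: "v \<in> M" "f' = (\<lambda>\<sigma>. f \<sigma> * (if \<sigma> \<in> G then \<sigma> v / v else 1))" using 1(1) unfolding cls_iff by blast
      obtain w where w: "w \<in> M" "g' = (\<lambda>\<sigma>. g \<sigma> * (if \<sigma> \<in> G then \<sigma> w / w else 1))" using 1(2) unfolding cls_iff by blast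
      obtain x where x: "x \<in> M" "b = (\<lambda>\<sigma>. if \<sigma> \<in> G then \<sigma> x / x else 1)" using 1(3) unfolding coboundary_iff by blast
      show ?thesis using that[OF v(1) w(1) x(1) 1(4)] 1(5) unfolding v(2) w(2) x(2) by simp
    qed
    have "\<sigma> (v * w * x) / (v * w * x) = (\<sigma> v / v) * (\<sigma> w / w) * (\<sigma> x / x)" if "\<sigma> \<in> G" for \<sigma>
      using coboundary_mult[OF mu_hat_mult[OF *(1,2)] *(3) that] coboundary_mult[OF *(1,2) that] by simp
    note split = this
    have "h = (\<lambda>\<sigma>. (f \<sigma> * g \<sigma>) * (if \<sigma> \<in> G then \<sigma> (v * w * x) / (v * w * x) else 1))"
    proof (rule ext)
      fix \<sigma>
      show "h \<sigma> = (f \<sigma> * g \<sigma>) * (if \<sigma> \<in> G then \<sigma> (v * w * x) / (v * w * x) else 1)"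
      proof (cases "\<sigma> \<in> G")
        case True
        then show ?thesis unfolding *(5) using split[OF True] by (simp only: if_True mult_ac)
      qed (simp add: *(5))
    qed
    then show "h \<in> cls (\<lambda>\<sigma>. f \<sigma> * g \<sigma>)" unfolding cls_iff using * mu_hat_mult by blast
  qed
  note memb = this
  show ?thesis
  proof (rule Set.set_eqI)
    fix h
    show "h \<in> cls f \<otimes>\<^bsub>H1 G M\<^esub> cls g \<longleftrightarrow> h \<in> cls (\<lambda>\<sigma>. f \<sigma> * g \<sigma>)"
      unfolding memb unfolding H1_def monoid.select_convs mem_Collect_eq ..
  qed
qed

text \<open>Independence of all choices: \<open>c = b / (a * v)\<close> is fixed by the Galois group
  and so lies in \<open>k\<close>. Passing to the ratio changes it by the unit
  \<open>v / cnj v\<close> and by \<open>c / cnj c\<close> in \<open>k\<close>, neither of which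
  affects \<open>kappa\<close>.\<close>

lemma trivializes_ratio_unique:
  assumes f: "trivializes f a" and g: "trivializes g b" and fg: "g \<in> cls f"
  shows "kappa (a / cnj a) = kappa (b / cnj b)"
proof -
  have ab: "a \<in> K" "a \<noteq> 0" "b \<in> K" "b \<noteq> 0" using f g unfolding trivializes_def by auto
  obtain v where v: "v \<in> M" "g = (\<lambda>\<sigma>. f \<sigma> * (if \<sigma> \<in> G then \<sigma> v / v else 1))" using fg unfolding cls_iff by blast
  have uv: "unit v" by (rule mu_hat_unit(1)[OF v(1)])
  have vK: "v \<in> K" "v \<noteq> 0" using uv unit_mem unfolding unit_def by auto
  define c where "c = b / (a * v)"
  have ck: "c \<in> k"
  proof (rule Gal_fixed)
    show "c \<in> K" unfolding c_def using ab vK by blast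
    fix \<sigma> assume s: "\<sigma> \<in> G"
    have "\<sigma> b / b = (\<sigma> a / a) * (\<sigma> v / v)" using f g v(2) s unfolding trivializes_def by auto
    then have sb: "\<sigma> b = b * ((\<sigma> a / a) * (\<sigma> v / v))" using ab(4) by (simp add: field_simps)
    have "\<sigma> c = \<sigma> b / (\<sigma> a * \<sigma> v)"
      unfolding c_def using Gal_divide[OF s ab(3), of "a * v"] Gal_mult[OF s ab(1) vK(1)] ab vK by auto
    then show "\<sigma> c = c"
      unfolding sb unfolding c_def using Gal_nonzero[OF s ab(1,2)] Gal_nonzero[OF s vK] by simp
  qed
  have c0: "c \<noteq> 0" using ab vK by (simp add: c_def)
  have b: "b = c * (a * v)" unfolding c_def using ab vK by simp
  have cc: "c / cnj c \<in> k" "c / cnj c \<noteq> 0" using ck c0 cnj_base by auto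
  have "b / cnj b = (v * inverse (cnj v)) * ((c / cnj c) * (a / cnj a))"
    unfolding b by (simp add: field_simps)
  then have "kappa (b / cnj b) = kappa ((v * inverse (cnj v)) * ((c / cnj c) * (a / cnj a)))" by (rule arg_cong)
  also have "\<dots> = kappa ((c / cnj c) * (a / cnj a))"
    by (rule kappa_unit[OF unit_mult[OF uv unit_inverse[OF unit_cnj[OF uv]]]])
  also have "\<dots> = \<one>\<^bsub>Cl k\<^esub> \<otimes>\<^bsub>Cl k\<^esub> kappa (a / cnj a)"
    using descends_mult(2)[OF descends_base(1)[OF cc] trivializes_descends[OF f]] descends_base(2)[OF cc] by simp
  also have "\<dots> = kappa (a / cnj a)"
  proof -
    interpret C: comm_monoid "Cl k" by (rule base.Cl_comm_monoid)
    show ?thesis using kappa_carrier[OF trivializes_descends[OF f]] by simp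
  qed
  finally show ?thesis ..
qed

lemma odd_exponent:
  assumes f: "trivializes f a" shows "\<exists>n :: nat. odd n \<and> (\<forall>\<sigma>\<in>G. f \<sigma> ^ n = 1)"
proof -
  have "\<forall>\<sigma>. \<exists>n :: nat. \<sigma> \<in> G \<longrightarrow> odd n \<and> f \<sigma> ^ n = 1"
    using trivializes_mem[OF f] unfolding mu_hat_def by blast
  from choice[OF this] obtain N :: "(complex \<Rightarrow> complex) \<Rightarrow> nat"
    where N: "\<And>\<sigma>. \<sigma> \<in> G \<Longrightarrow> odd (N \<sigma>) \<and> f \<sigma> ^ N \<sigma> = 1" by blast
  define n where "n = (\<Prod>\<sigma>\<in>G. N \<sigma>)"
  have "odd n"
  proof -
    have "odd (prod N S)" if "finite S" "S \<subseteq> G" for S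
      using that by (induction S rule: finite_induct) (use N in auto)
    then show ?thesis unfolding n_def using finite_Gal by blast
  qed
  moreover have "f \<sigma> ^ n = 1" if "\<sigma> \<in> G" for \<sigma>
  proof -
    have "n = N \<sigma> * prod N (G - {\<sigma>})" unfolding n_def by (rule prod.remove[OF finite_Gal that])
    then show ?thesis using N[OF that] by (simp add: power_mult)
  qed
  ultimately show ?thesis by blast
qed

text \<open>The square appears because conjugation inverts the root of unity
  \<open>f \<sigma>\<close>.\<close>

lemma ratio_cocycle:
  assumes f: "trivializes f a" and s: "\<sigma> \<in> G"
  shows "\<sigma> (a / cnj a) = f \<sigma> ^ 2 * (a / cnj a)"
proof -
  have a: "a \<in> K" "a \<noteq> 0" and fs: "f \<sigma> = \<sigma> a / a" using f s unfolding trivializes_def by auto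
  have "\<sigma> (a / cnj a) = \<sigma> a / cnj (\<sigma> a)"
    using Gal_divide[OF s a(1) cnj_top[OF a(1)]] cnj_commute[OF s a(1)] by simp
  also have "\<dots> = (f \<sigma> * a) / cnj (f \<sigma> * a)" using fs a by simp
  also have "\<dots> = (f \<sigma> / cnj (f \<sigma>)) * (a / cnj a)" by simp
  also have "f \<sigma> / cnj (f \<sigma>) = f \<sigma> ^ 2"
    using mu_hat_unit(3)[OF trivializes_mem[OF f s]] by (simp add: power2_eq_square divide_inverse)
  finally show ?thesis .
qed

text \<open>If \<open>n\<close> is an odd exponent of \<open>f\<close>, then \<open>c ^ n\<close> is
  Galois invariant, so the class of \<open>c\<close> has odd order dividing \<open>n\<close>. It
  remains to present it as a minus class, which requires halving.\<close>

lemma trivializes_Cap: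
  assumes f: "trivializes f a" shows "kappa (a / cnj a) \<in> carrier (Cap_hat_minus k K)"
proof -
  interpret C: comm_monoid "Cl k" by (rule base.Cl_comm_monoid)
  define c where "c = a / cnj a"
  have dc: "descends c" unfolding c_def by (rule trivializes_descends[OF f])
  note cD = descendsD[OF dc]
  obtain n :: nat where n: "odd n" "\<forall>\<sigma>\<in>G. f \<sigma> ^ n = 1" using odd_exponent[OF f] by blast
  have cn: "c ^ n \<in> k"
  proof (rule Gal_fixed)
    show "c ^ n \<in> K" using cD by blast
    fix \<sigma> assume s: "\<sigma> \<in> G"
    have "\<sigma> (c ^ n) = (f \<sigma> ^ 2 * c) ^ n"
      using Gal_power[OF s cD(1)] ratio_cocycle[OF f s] by (simp add: c_def)
    also have "\<dots> = (f \<sigma> ^ n) ^ 2 * c ^ n" by (simp add: power_mult_distrib mult.commute flip: power_mult)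
    finally show "\<sigma> (c ^ n) = c ^ n" using bspec[OF n(2) s] by simp
  qed
  have kn: "kappa c [^]\<^bsub>Cl k\<^esub> n = \<one>\<^bsub>Cl k\<^esub>"
    using descends_power(2)[OF dc, of n] descends_base(2)[OF cn] cD(2) by simp
  \<comment> \<open>Since \<open>cnj c = inverse c\<close>, passing from \<open>z\<close> to
    \<open>z / cnj z\<close> squares powers of \<open>c\<close>. With \<open>m = (n + 1) / 2\<close>
    the power \<open>c ^ m\<close> is sent to \<open>c * c ^ n\<close>, which has the class of
    \<open>c\<close>.\<close>
  obtain m where m: "Suc n = 2 * m" using n(1) by (metis even_Suc evenE)
  have cc: "cnj c = inverse c" unfolding c_def by simp
  have "cnj (c ^ m) = inverse (c ^ m)" by (simp only: complex_cnj_power cc power_inverse)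
  then have "c ^ m / cnj (c ^ m) = c ^ (2 * m)"
    by (simp only: divide_inverse inverse_inverse_eq mult_2 power_add)
  also have "\<dots> = c * c ^ n" unfolding m[symmetric] by simp
  finally have "kappa (c ^ m / cnj (c ^ m)) = kappa c \<otimes>\<^bsub>Cl k\<^esub> \<one>\<^bsub>Cl k\<^esub>"
    using descends_mult(2)[OF dc descends_power(1)[OF dc], of n] descends_base(2)[OF cn] cD(2) by simp
  then have eq: "kappa c = kappa (c ^ m / cnj (c ^ m))" using kappa_carrier[OF dc] by simp
  have "kappa (c ^ m) [^]\<^bsub>Cl k\<^esub> n = (kappa c [^]\<^bsub>Cl k\<^esub> n) [^]\<^bsub>Cl k\<^esub> m"
    using descends_power(2)[OF dc, of m] kappa_carrier[OF dc] by (simp add: C.nat_pow_pow mult.commute)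
  then have "kappa (c ^ m) [^]\<^bsub>Cl k\<^esub> n = \<one>\<^bsub>Cl k\<^esub>" unfolding kn by simp
  then show ?thesis
    unfolding Cap_hat_minus_carrier c_def[symmetric] using eq n(1) descends_power(1)[OF dc, of m] by blast
qed

lemma unitary_of_unit:
  assumes "unit u" obtains n where "n > 0" "(u / cnj u) ^ n = 1"
proof -
  have 1: "unit (u * inverse (cnj u))" using assms unit_mult unit_inverse unit_cnj by blast
  have "u / cnj u \<in> OK K" using 1 unfolding unit_def by (simp add: divide_inverse)
  moreover have "u / cnj u * cnj (u / cnj u) = 1" using assms unfolding unit_def by simp
  ultimately show ?thesis using unitary_unit that by blast
qed

text \<open>The quotient \<open>x\<close> of the two ratios equals \<open>c * u\<close>, and
  \<open>cnj x = inverse x\<close> gives \<open>x ^ 2 = (c / cnj c) * v\<close> with the root of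
  unity \<open>v = u / cnj u\<close>. The action on \<open>x ^ 2\<close> shows that the fourth power
  of \<open>h = g / f\<close> is the coboundary of \<open>v\<close>. As \<open>h\<close> has odd
  exponent, 4 can be inverted.\<close>

lemma kappa_injective:
  assumes f: "trivializes f a" and g: "trivializes g b"
    and eq: "kappa (a / cnj a) = kappa (b / cnj b)"
  shows "g \<in> cls f"
proof -
  have ab: "a \<in> K" "a \<noteq> 0" "b \<in> K" "b \<noteq> 0" using f g unfolding trivializes_def by auto
  obtain c u where cu: "c \<in> k" "c \<noteq> 0" "unit u" "b / cnj b = c * u * (a / cnj a)"
    using kappa_eqD[OF trivializes_descends[OF f] trivializes_descends[OF g] eq] by blast
  obtain e where e: "e > 0" "(u / cnj u) ^ e = 1" using unitary_of_unit[OF cu(3)] by blast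
  define v where "v = u / cnj u"
  have uK: "u \<in> K" "u \<noteq> 0" using cu(3) unit_mem unfolding unit_def by auto
  have vK: "v \<in> K" "v \<noteq> 0" using uK cnj_top unfolding v_def by auto
  define x where "x = b / cnj b / (a / cnj a)"
  have x: "x = c * u" unfolding x_def cu(4) using ab by simp
  have xx: "x ^ 2 = (c / cnj c) * v"
  proof -
    have "cnj x = inverse x" unfolding x_def by simp
    then have "x ^ 2 = x / cnj x" by (simp add: power2_eq_square divide_inverse)
    also have "\<dots> = (c / cnj c) * v" unfolding x v_def by simp
    finally show ?thesis .
  qed
  define h where "h \<sigma> = g \<sigma> / f \<sigma>" for \<sigma>
  have h4: "h \<sigma> ^ 4 = \<sigma> v / v" if s: "\<sigma> \<in> G" for \<sigma>
  proof -
    have f0: "f \<sigma> \<noteq> 0" using mu_hat_unit(1)[OF trivializes_mem[OF f s]] unfolding unit_def by blast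
    have xK: "x \<in> K" "x \<noteq> 0" using x cu uK k_subset by auto
    have rK: "b / cnj b \<in> K" "a / cnj a \<in> K" using ab cnj_top by auto
    have "\<sigma> x = h \<sigma> ^ 2 * x"
      unfolding x_def Gal_divide[OF s rK] ratio_cocycle[OF f s] ratio_cocycle[OF g s] h_def
      by (simp add: power_divide mult_ac)
    then have "\<sigma> (x ^ 2) = (h \<sigma> ^ 2 * x) ^ 2" using Gal_power[OF s xK(1)] by simp
    also have "\<dots> = h \<sigma> ^ 4 * x ^ 2" by (simp add: power_mult_distrib flip: power_mult)
    finally have 1: "\<sigma> ((c / cnj c) * v) = h \<sigma> ^ 4 * ((c / cnj c) * v)" unfolding xx .
    have cc: "c / cnj c \<in> k" "c / cnj c \<noteq> 0" using cu cnj_base by auto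
    have "\<sigma> ((c / cnj c) * v) = (c / cnj c) * \<sigma> v"
      unfolding Gal_mult[OF s subsetD[OF k_subset cc(1)] vK(1)] Gal_base[OF s cc(1)] ..
    with 1 cc(2) vK(2) show ?thesis by (simp add: field_simps)
  qed
  obtain n1 :: nat where n1: "odd n1" "\<forall>\<sigma>\<in>G. f \<sigma> ^ n1 = 1" using odd_exponent[OF f] by blast
  obtain n2 :: nat where n2: "odd n2" "\<forall>\<sigma>\<in>G. g \<sigma> ^ n2 = 1" using odd_exponent[OF g] by blast
  define n where "n = n1 * n2"
  have hn: "h \<sigma> ^ n = 1" if s: "\<sigma> \<in> G" for \<sigma>
  proof -
    have "f \<sigma> ^ n = 1" unfolding n_def power_mult bspec[OF n1(2) s] by simp
    moreover have "g \<sigma> ^ n = 1" unfolding n_def mult.commute[of n1 n2] power_mult bspec[OF n2(2) s] by simp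
    ultimately show ?thesis by (simp add: h_def power_divide)
  qed
  obtain s0 m where s0: "odd m" "e = 2 ^ s0 * m" using even_odd_decomposition[OF e(1)] by blast
  \<comment> \<open>The exponent collects \<open>2 ^ 2\<close> from \<open>h \<sigma> ^ 4\<close>
    and \<open>2 ^ s0\<close> from the 2-part of the order bound \<open>e\<close>. The power
    \<open>w\<close> then satisfies \<open>w ^ m = 1\<close> with \<open>m\<close> odd, so it lies
    in \<open>M\<close>, and its coboundary is
    \<open>h \<sigma> ^ Suc (n * j) = h \<sigma>\<close>.\<close>
  obtain t j where tj: "2 ^ (s0 + 2) * t = Suc (n * j)"
  proof (rule inverse_power_mod_odd[of n "s0 + 2"])
    show "odd n" unfolding n_def using n1(1) n2(1) by simp
  qed
  define w where "w = v ^ (2 ^ s0 * t)"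
  have wM: "w \<in> M"
  proof -
    have "w ^ m = (v ^ e) ^ t" unfolding w_def s0(2) by (simp add: mult_ac flip: power_mult)
    also have "\<dots> = 1" using e(2) unfolding v_def by simp
    finally show ?thesis unfolding mu_hat_def w_def using s0(1) vK by auto
  qed
  have "g \<sigma> = f \<sigma> * (if \<sigma> \<in> G then \<sigma> w / w else 1)" for \<sigma>
  proof (cases "\<sigma> \<in> G")
    case True
    have f0: "f \<sigma> \<noteq> 0" using mu_hat_unit(1)[OF trivializes_mem[OF f True]] unfolding unit_def by blast
    have "\<sigma> w / w = (\<sigma> v / v) ^ (2 ^ s0 * t)"
      unfolding w_def Gal_power[OF True vK(1)] by (simp add: power_divide)
    also have "\<dots> = h \<sigma> ^ (4 * (2 ^ s0 * t))" unfolding h4[OF True, symmetric] by (simp add: power_mult)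
    also have "4 * (2 ^ s0 * t) = Suc (n * j)" using tj by (simp add: power_add)
    also have "h \<sigma> ^ Suc (n * j) = h \<sigma>" using hn[OF True] by (simp add: power_mult)
    finally show ?thesis using True f0 by (simp add: h_def)
  next
    case False
    then show ?thesis using f g unfolding trivializes_def cocycles_def by simp
  qed
  then show ?thesis unfolding cls_iff using wM g unfolding trivializes_def by blast
qed

text \<open>For \<open>x = b / cnj b\<close> the quotient \<open>\<sigma> x / x\<close> is a unit
  divided by its conjugate, hence a root of unity, possibly of even order. A power of
  \<open>x\<close> removes the 2-part and becomes the element \<open>a\<close>.\<close>

lemma kappa_surjective:
  assumes C: "C \<in> carrier (Cap_hat_minus k K)"
  shows "\<exists>f a. trivializes f a \<and> C = kappa (a / cnj a)"
proof -
  interpret Cm: comm_monoid "Cl k" by (rule base.Cl_comm_monoid)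
  obtain b and n :: nat where b: "C = kappa (b / cnj b)" "descends b" "odd n" "kappa b [^]\<^bsub>Cl k\<^esub> n = \<one>\<^bsub>Cl k\<^esub>"
    using C unfolding Cap_hat_minus_carrier by blast
  note bD = descendsD[OF b(2)]
  define x where "x = b / cnj b"
  have x: "descends x" "kappa x [^]\<^bsub>Cl k\<^esub> n = \<one>\<^bsub>Cl k\<^esub>"
    unfolding x_def using kappa_conj_ratio(1,3)[OF b(2,3,4)] by auto
  note xD = descendsD[OF x(1)]
  have bu: "unit (\<sigma> b / b)" if "\<sigma> \<in> G" for \<sigma>
    using descends_unit_cocycle[OF b(2)] that unfolding unit_cocycle_alt by blast
  have sx: "\<sigma> x / x = (\<sigma> b / b) / cnj (\<sigma> b / b)" if s: "\<sigma> \<in> G" for \<sigma>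
    unfolding x_def using Gal_divide[OF s bD(1) cnj_top[OF bD(1)]] cnj_commute[OF s bD(1)] by simp
  have "\<forall>\<sigma>. \<exists>e :: nat. \<sigma> \<in> G \<longrightarrow> e > 0 \<and> (\<sigma> x / x) ^ e = 1"
    using unitary_of_unit[OF bu] sx by metis
  from choice[OF this] obtain E :: "(complex \<Rightarrow> complex) \<Rightarrow> nat"
    where E: "\<And>\<sigma>. \<sigma> \<in> G \<Longrightarrow> E \<sigma> > 0 \<and> (\<sigma> x / x) ^ E \<sigma> = 1" by blast
  define e where "e = (\<Prod>\<sigma>\<in>G. E \<sigma>)"
  have e0: "e > 0" unfolding e_def using E by (intro prod_pos) auto
  have se: "(\<sigma> x / x) ^ e = 1" if "\<sigma> \<in> G" for \<sigma>
  proof -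
    have "e = E \<sigma> * prod E (G - {\<sigma>})" unfolding e_def by (rule prod.remove[OF finite_Gal that])
    then show ?thesis using E[OF that] by (simp only: power_mult) simp
  qed
  obtain s0 m where s0: "odd m" "e = 2 ^ s0 * m" using even_odd_decomposition[OF e0] by blast
  \<comment> \<open>The additional factor 2 accounts for \<open>a / cnj a = a ^ 2\<close>. The ratio
    is thus \<open>x ^ (n * j + 1)\<close>, which has the class of \<open>x\<close> since that class
    has exponent \<open>n\<close>.\<close>
  obtain t j where tj: "2 ^ (s0 + 1) * t = Suc (n * j)"
    by (rule inverse_power_mod_odd[OF b(3), of "s0 + 1"])
  define a where "a = x ^ (2 ^ s0 * t)"
  have a: "a \<in> K" "a \<noteq> 0" unfolding a_def using xD by auto
  have triv: "trivializes (\<lambda>\<sigma>. if \<sigma> \<in> G then \<sigma> a / a else 1) a"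
  proof (rule trivializesI[OF a])
    fix \<sigma> assume s: "\<sigma> \<in> G"
    have "(\<sigma> a / a) = (\<sigma> x / x) ^ (2 ^ s0 * t)"
      unfolding a_def Gal_power[OF s xD(1)] by (simp add: power_divide)
    then have "(\<sigma> a / a) ^ m = ((\<sigma> x / x) ^ e) ^ t" unfolding s0(2) by (simp only: mult_ac flip: power_mult)
    then have "(\<sigma> a / a) ^ m = 1" using se[OF s] by simp
    then show "\<sigma> a / a \<in> M" unfolding mu_hat_def using s0(1) Gal_closed[OF s a(1)] a by blast
  qed
  have "cnj x = inverse x" unfolding x_def by simp
  then have "cnj a = inverse a" unfolding a_def by (simp only: complex_cnj_power power_inverse)
  then have "a / cnj a = x ^ (2 * (2 ^ s0 * t))"
    unfolding a_def by (simp only: divide_inverse inverse_inverse_eq mult_2 power_add)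
  also have "2 * (2 ^ s0 * t) = Suc (n * j)" using tj by simp
  finally have "kappa (a / cnj a) = kappa (x ^ Suc (n * j))" by (rule arg_cong)
  also have "\<dots> = kappa x [^]\<^bsub>Cl k\<^esub> Suc (n * j)" by (rule descends_power(2)[OF x(1)])
  also have "\<dots> = (kappa x [^]\<^bsub>Cl k\<^esub> n) [^]\<^bsub>Cl k\<^esub> j \<otimes>\<^bsub>Cl k\<^esub> kappa x"
    using kappa_carrier[OF x(1)] by (simp add: Cm.nat_pow_pow)
  also have "\<dots> = C" unfolding x(2) b(1) x_def[symmetric] using kappa_carrier[OF x(1)] by simp
  finally show ?thesis using triv by blast
qed

theorem capitulation_iso: "Cap_hat_minus k K \<cong> H1 G M"
proof -
  interpret C: comm_monoid "Cl k" by (rule base.Cl_comm_monoid)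
  \<comment> \<open>The map runs from ideal classes to cohomology, inverse to the assignment on
    cocycles. \<open>kappa_injective\<close> makes the choice independent of the pair
    \<open>f\<close>, \<open>a\<close>; \<open>trivializes_ratio_unique\<close> later gives
    injectivity.\<close>
  define \<Phi> where "\<Phi> C = (SOME X. \<exists>f a. trivializes f a \<and> C = kappa (a / cnj a) \<and> X = cls f)" for C
  have \<Phi>: "\<Phi> (kappa (a / cnj a)) = cls f" if f: "trivializes f a" for f a
  proof -
    have "\<exists>X. \<exists>f' a'. trivializes f' a' \<and> kappa (a / cnj a) = kappa (a' / cnj a') \<and> X = cls f'" using f by blast
    from someI_ex[OF this] obtain f' a' where f': "trivializes f' a'" "kappa (a / cnj a) = kappa (a' / cnj a')"
      "\<Phi> (kappa (a / cnj a)) = cls f'" unfolding \<Phi>_def by blast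
    have "f' \<in> cls f" by (rule kappa_injective[OF f f'(1,2)])
    then have "cls f = cls f'" using cls_eq_iff f f'(1) unfolding trivializes_def by blast
    then show ?thesis using f'(3) by simp
  qed
  have "\<Phi> \<in> iso (Cap_hat_minus k K) (H1 G M)"
  proof (rule isoI)
    show "\<Phi> \<in> hom (Cap_hat_minus k K) (H1 G M)"
    proof (rule homI)
      fix C assume "C \<in> carrier (Cap_hat_minus k K)"
      then obtain f a where f: "trivializes f a" "C = kappa (a / cnj a)" using kappa_surjective by blast
      then show "\<Phi> C \<in> carrier (H1 G M)" using \<Phi>[OF f(1)] unfolding H1_carrier trivializes_def by auto
    next
      fix C D assume CD: "C \<in> carrier (Cap_hat_minus k K)" "D \<in> carrier (Cap_hat_minus k K)"
      obtain f a where f: "trivializes f a" "C = kappa (a / cnj a)" using kappa_surjective[OF CD(1)] by blast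
      obtain g b where g: "trivializes g b" "D = kappa (b / cnj b)" using kappa_surjective[OF CD(2)] by blast
      have "C \<otimes>\<^bsub>Cap_hat_minus k K\<^esub> D = kappa ((a / cnj a) * (b / cnj b))"
        unfolding f(2) g(2) Cap_hat_minus_def
        using descends_mult(2)[OF trivializes_descends[OF f(1)] trivializes_descends[OF g(1)]] by simp
      also have "(a / cnj a) * (b / cnj b) = (a * b) / cnj (a * b)" by simp
      finally have "\<Phi> (C \<otimes>\<^bsub>Cap_hat_minus k K\<^esub> D) = cls (\<lambda>\<sigma>. f \<sigma> * g \<sigma>)"
        using \<Phi>[OF trivializes_mult[OF f(1) g(1)]] by simp
      also have "\<dots> = cls f \<otimes>\<^bsub>H1 G M\<^esub> cls g"
        using H1_mult f(1) g(1) unfolding trivializes_def by simp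
      finally show "\<Phi> (C \<otimes>\<^bsub>Cap_hat_minus k K\<^esub> D) = \<Phi> C \<otimes>\<^bsub>H1 G M\<^esub> \<Phi> D"
        using \<Phi>[OF f(1)] \<Phi>[OF g(1)] f(2) g(2) by simp
    qed
    show "bij_betw \<Phi> (carrier (Cap_hat_minus k K)) (carrier (H1 G M))"
      unfolding bij_betw_def
    proof
      show "inj_on \<Phi> (carrier (Cap_hat_minus k K))"
      proof (rule inj_onI)
        fix C D assume CD: "C \<in> carrier (Cap_hat_minus k K)" "D \<in> carrier (Cap_hat_minus k K)" "\<Phi> C = \<Phi> D"
        obtain f a where f: "trivializes f a" "C = kappa (a / cnj a)" using kappa_surjective[OF CD(1)] by blast
        obtain g b where g: "trivializes g b" "D = kappa (b / cnj b)" using kappa_surjective[OF CD(2)] by blast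
        have "cls f = cls g" using CD(3) \<Phi>[OF f(1)] \<Phi>[OF g(1)] f(2) g(2) by simp
        then have "g \<in> cls f" using cls_refl g(1) unfolding trivializes_def by blast
        then show "C = D" unfolding f(2) g(2) by (rule trivializes_ratio_unique[OF f(1) g(1)])
      qed
      show "\<Phi> ` carrier (Cap_hat_minus k K) = carrier (H1 G M)"
      proof
        show "\<Phi> ` carrier (Cap_hat_minus k K) \<subseteq> carrier (H1 G M)"
        proof
          fix X assume "X \<in> \<Phi> ` carrier (Cap_hat_minus k K)"
          then obtain f a where f: "trivializes f a" "X = \<Phi> (kappa (a / cnj a))" using kappa_surjective by blast
          then show "X \<in> carrier (H1 G M)" using \<Phi>[OF f(1)] unfolding H1_carrier trivializes_def by auto
        qed
        show "carrier (H1 G M) \<subseteq> \<Phi> ` carrier (Cap_hat_minus k K)"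
        proof
          fix X assume "X \<in> carrier (H1 G M)"
          then obtain f where f: "f \<in> cocycles G M" "X = cls f" unfolding H1_carrier by blast
          obtain a where a: "trivializes f a" using exists_trivialization[OF f(1)] by blast
          show "X \<in> \<Phi> ` carrier (Cap_hat_minus k K)"
            by (rule image_eqI[OF _ trivializes_Cap[OF a]]) (use \<Phi>[OF a] f(2) in simp)
        qed
      qed
    qed
  qed
  then show ?thesis by (rule is_isoI)
qed

end

subsection \<open>CM extensions\<close>

locale cm_setting =
  fixes Kp kp k K :: "complex set"
  assumes nf_Kp: "number_field Kp" and nf_kp: "number_field kp" and nf_k: "number_field k"
    and real_Kp: "totally_real Kp" and kp_Kp: "kp \<subseteq> Kp" and gal_Kp: "galois_ext Kp kp"
    and kp_k: "kp \<subseteq> k" and deg_k: "field_deg k kp = 2" and imag_k: "totally_imaginary k"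
    and K_def: "K = compositum Kp k"
begin

sublocale Kp: num_field Kp by unfold_locales (rule nf_Kp)
sublocale kp: num_field kp by unfold_locales (rule nf_kp)
sublocale k: num_field k by unfold_locales (rule nf_k)

lemma embedding_subset: "embedding L \<sigma> \<Longrightarrow> F \<subseteq> L \<Longrightarrow> embedding F \<sigma>"
  unfolding embedding_def by blast

lemma Kp_real: "x \<in> Kp \<Longrightarrow> cnj x = x"
proof -
  have "embedding Kp id" unfolding embedding_def by simp
  then have "id ` Kp \<subseteq> \<real>" using real_Kp unfolding totally_real_def by blast
  then show "x \<in> Kp \<Longrightarrow> cnj x = x" by (auto simp: Reals_cnj_iff)
qed

text \<open>\<open>field_deg\<close> is a least number, so a spanning family of some length must be
  exhibited before it carries information.\<close>

lemma spans_mono: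
  assumes F: "\<rat> \<subseteq> F" "F \<subseteq> L" and L: "complex_field L" and sp: "spans L \<rat> n"
  shows "spans L F n"
proof -
  interpret L: complex_field L by (rule L)
  obtain b where b: "\<forall>i<n. b i \<in> L" "L = {\<Sum>i<n. c i * b i | c. \<forall>i<n. c i \<in> \<rat>}"
    using sp unfolding spans_def by blast
  have "L = {\<Sum>i<n. c i * b i | c. \<forall>i<n. c i \<in> F}"
  proof
    have "{\<Sum>i<n. c i * b i | c. \<forall>i<n. c i \<in> \<rat>} \<subseteq> {\<Sum>i<n. c i * b i | c. \<forall>i<n. c i \<in> F}"
      using F(1) by blast
    then show "L \<subseteq> {\<Sum>i<n. c i * b i | c. \<forall>i<n. c i \<in> F}" using b(2) by simp
    show "{\<Sum>i<n. c i * b i | c. \<forall>i<n. c i \<in> F} \<subseteq> L"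
    proof
      fix x assume "x \<in> {\<Sum>i<n. c i * b i | c. \<forall>i<n. c i \<in> F}"
      then obtain c where c: "x = (\<Sum>i<n. c i * b i)" "\<forall>i<n. c i \<in> F" by blast
      show "x \<in> L" unfolding c(1) using c(2) b(1) F(2) by (intro L.sum_mem L.mult_mem) auto
    qed
  qed
  then show ?thesis unfolding spans_def using b(1) by blast
qed

text \<open>A spanning pair can be exchanged for one that contains 1: writing
  \<open>1 = p * u + q * v\<close>, whichever member has a nonzero coefficient is
  eliminated.\<close>

lemma k_generator: "\<exists>y\<in>k. \<forall>x\<in>k. \<exists>a\<in>kp. \<exists>b\<in>kp. x = a + b * y"
proof -
  obtain n where "spans k \<rat> n" using nf_k unfolding number_field_def by blast
  then have "spans k kp n" by (rule spans_mono[OF kp.Rats_subset kp_k k.complex_field_axioms])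
  then have "spans k kp (field_deg k kp)" unfolding field_deg_def by (rule LeastI)
  then have "spans k kp 2" unfolding deg_k .
  then obtain b where b: "\<forall>i<2::nat. b i \<in> k" "k = {\<Sum>i<2::nat. c i * b i | c. \<forall>i<2. c i \<in> kp}"
    unfolding spans_def by blast
  have rep: "\<exists>a\<in>kp. \<exists>c\<in>kp. x = a * b 0 + c * b 1" if x: "x \<in> k" for x
  proof -
    obtain c where c: "\<forall>i<2::nat. c i \<in> kp" "x = (\<Sum>i<2::nat. c i * b i)" using b(2) x by blast
    have "x = c 0 * b 0 + c 1 * b 1" unfolding c(2) by (simp add: numeral_2_eq_2)
    moreover have "c 0 \<in> kp" "c 1 \<in> kp" using c(1) by auto
    ultimately show ?thesis by blast
  qed
  have bk: "b 0 \<in> k" "b 1 \<in> k" using b(1) by auto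
  have main: "\<exists>y\<in>k. \<forall>x\<in>k. \<exists>a\<in>kp. \<exists>b\<in>kp. x = a + b * y"
    if rep: "\<And>x. x \<in> k \<Longrightarrow> \<exists>a\<in>kp. \<exists>c\<in>kp. x = a * u + c * v" and v: "v \<in> k"
      and one: "1 = p * u + q * v" "p \<in> kp" "q \<in> kp" "p \<noteq> 0" for u v p q
  proof (rule bexI[OF _ v], rule ballI)
    fix x assume "x \<in> k"
    then obtain a c where ac: "a \<in> kp" "c \<in> kp" "x = a * u + c * v" using rep by blast
    have "p * u = 1 - q * v" using one(1) by (simp add: algebra_simps)
    then have u: "u = (1 - q * v) / p" using one(4) by (metis nonzero_mult_div_cancel_left)
    have "x = a / p + (c - a * q / p) * v" unfolding ac(3) u by (simp add: algebra_simps diff_divide_distrib)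
    moreover have "a / p \<in> kp" "c - a * q / p \<in> kp" using ac one by auto
    ultimately show "\<exists>a\<in>kp. \<exists>b\<in>kp. x = a + b * v" by blast
  qed
  obtain p q where pq: "p \<in> kp" "q \<in> kp" "1 = p * b 0 + q * b 1" using rep[of 1] by auto
  show ?thesis
  proof (cases "p = 0")
    case False
    then show ?thesis using main[OF rep bk(2) pq(3,1,2)] by blast
  next
    case True
    then have "q \<noteq> 0" using pq by auto
    have rep': "\<exists>a\<in>kp. \<exists>c\<in>kp. x = a * b 1 + c * b 0" if "x \<in> k" for x
      using rep[OF that] by (metis add.commute)
    have one': "1 = q * b 1 + p * b 0" using pq(3) by (simp only: add.commute)
    show ?thesis using main[OF rep' bk(1) one' pq(2,1) \<open>q \<noteq> 0\<close>] by blast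
  qed
qed

text \<open>Completing the square for the generator \<open>y\<close> gives \<open>d\<close> with
  \<open>d ^ 2\<close> in the real field \<open>kp\<close>. If \<open>d\<close> were real, so would
  be all of \<open>k\<close>, against the identity embedding being nonreal; hence \<open>d\<close>
  is purely imaginary.\<close>

lemma exists_delta: "\<exists>d\<in>k. d ^ 2 \<in> kp \<and> cnj d = - d \<and> d \<noteq> 0 \<and> (\<forall>x\<in>k. \<exists>a\<in>kp. \<exists>b\<in>kp. x = a + b * d)"
proof -
  obtain y where y: "y \<in> k" "\<And>x. x \<in> k \<Longrightarrow> \<exists>a\<in>kp. \<exists>b\<in>kp. x = a + b * y" using k_generator by blast
  have "y ^ 2 \<in> k" using y(1) by blast
  then obtain p q where pq: "p \<in> kp" "q \<in> kp" "y ^ 2 = p + q * y" using y(2) by blast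
  define d where "d = y - q / 2"
  have two: "2 \<in> kp" using kp.of_nat_mem[of 2] by simp
  have dk: "d \<in> k" unfolding d_def using y(1) pq(2) two kp_k by blast
  have "d ^ 2 = p + (q / 2) ^ 2" unfolding d_def power2_diff pq(3) by (simp add: field_simps power2_eq_square)
  then have d2: "d ^ 2 \<in> kp" using pq two by auto
  have rep: "\<exists>a\<in>kp. \<exists>b\<in>kp. x = a + b * d" if x: "x \<in> k" for x
  proof -
    obtain a b where ab: "a \<in> kp" "b \<in> kp" "x = a + b * y" using y(2)[OF x] by blast
    have "x = (a + b * (q / 2)) + b * d" unfolding ab(3) d_def by (simp add: algebra_simps)
    moreover have "a + b * (q / 2) \<in> kp" using ab pq two by auto
    ultimately show ?thesis using ab(2) by blast
  qed
  have nr: "cnj d \<noteq> d"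
  proof
    assume dd: "cnj d = d"
    have "id ` k \<subseteq> \<real>"
    proof
      fix x assume "x \<in> id ` k"
      then have "x \<in> k" by simp
      then obtain a b where ab: "a \<in> kp" "b \<in> kp" "x = a + b * d" using rep by blast
      have "cnj a = a" "cnj b = b" using ab kp_Kp by (auto intro: Kp_real)
      then have "cnj x = x" using dd unfolding ab(3) by simp
      then show "x \<in> \<real>" by (simp add: Reals_cnj_iff)
    qed
    moreover have "embedding k id" unfolding embedding_def by simp
    ultimately show False using imag_k unfolding totally_imaginary_def by blast
  qed
  have "cnj (d ^ 2) = d ^ 2" by (rule Kp_real) (use d2 kp_Kp in blast)
  then have "(cnj d) ^ 2 = d ^ 2" by (simp only: complex_cnj_power)
  then have "cnj d = - d" using nr unfolding power2_eq_iff by blast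
  moreover have "d \<noteq> 0" using nr by auto
  ultimately show ?thesis using dk d2 rep by blast
qed

definition \<delta> where "\<delta> = (SOME d. d \<in> k \<and> d ^ 2 \<in> kp \<and> cnj d = - d \<and> d \<noteq> 0 \<and> (\<forall>x\<in>k. \<exists>a\<in>kp. \<exists>b\<in>kp. x = a + b * d))"

lemma delta: "\<delta> \<in> k" "\<delta> ^ 2 \<in> kp" "cnj \<delta> = - \<delta>" "\<delta> \<noteq> 0" "\<And>x. x \<in> k \<Longrightarrow> \<exists>a\<in>kp. \<exists>b\<in>kp. x = a + b * \<delta>"
proof -
  have "\<exists>d. d \<in> k \<and> d ^ 2 \<in> kp \<and> cnj d = - d \<and> d \<noteq> 0 \<and> (\<forall>x\<in>k. \<exists>a\<in>kp. \<exists>b\<in>kp. x = a + b * d)"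
    using exists_delta by blast
  from someI_ex[OF this, folded \<delta>_def]
  show "\<delta> \<in> k" "\<delta> ^ 2 \<in> kp" "cnj \<delta> = - \<delta>" "\<delta> \<noteq> 0" "\<And>x. x \<in> k \<Longrightarrow> \<exists>a\<in>kp. \<exists>b\<in>kp. x = a + b * \<delta>"
    by blast+
qed

definition plus_part :: "complex \<Rightarrow> complex" where "plus_part x = (x + cnj x) / 2"
definition minus_part :: "complex \<Rightarrow> complex" where "minus_part x = (x - cnj x) / (2 * \<delta>)"

lemma parts_eq: assumes "a \<in> Kp" "b \<in> Kp" shows "plus_part (a + b * \<delta>) = a" "minus_part (a + b * \<delta>) = b"
  unfolding plus_part_def minus_part_def using Kp_real[OF assms(1)] Kp_real[OF assms(2)] delta(3,4)
  by (simp_all add: field_simps)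

definition L where "L = {a + b * \<delta> | a b. a \<in> Kp \<and> b \<in> Kp}"

lemma LI: "a \<in> Kp \<Longrightarrow> b \<in> Kp \<Longrightarrow> a + b * \<delta> \<in> L"
  unfolding L_def by blast

lemma delta_sq: "\<delta> * \<delta> \<in> Kp"
  using delta(2) kp_Kp by (auto simp: power2_eq_square)

lemma L_mult_form: "(a + b * \<delta>) * (c + d * \<delta>) = (a * c + b * d * (\<delta> * \<delta>)) + (a * d + b * c) * \<delta>"
  by (simp add: algebra_simps)

lemma L_subfield: "subfield_C L"
  unfolding subfield_C_def
proof (intro conjI ballI impI)
  show "0 \<in> L" "1 \<in> L" using LI[of 0 0] LI[of 1 0] by auto
  fix x assume "x \<in> L"
  then obtain a b where x: "a \<in> Kp" "b \<in> Kp" "x = a + b * \<delta>" unfolding L_def by blast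
  have "- a + (- b) * \<delta> \<in> L" using x by (intro LI) auto
  then show "- x \<in> L" unfolding x(3) by simp
  {
    fix y assume "y \<in> L"
    then obtain c d where y: "c \<in> Kp" "d \<in> Kp" "y = c + d * \<delta>" unfolding L_def by blast
    have "(a + c) + (b + d) * \<delta> \<in> L" using x y by (intro LI) auto
    then show "x + y \<in> L" unfolding x(3) y(3) by (simp add: algebra_simps)
    have "b * d \<in> Kp" "a * c \<in> Kp" "a * d \<in> Kp" "b * c \<in> Kp" using x y by auto
    then show "x * y \<in> L" unfolding x(3) y(3) L_mult_form
      by (intro LI Kp.add_mem Kp.mult_mem[OF _ delta_sq])
  }
  assume x0: "x \<noteq> 0"
  \<comment> \<open>The relative norm \<open>x * cnj x\<close> down to \<open>Kp\<close>, nonzero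
    because both factors are.\<close>
  define n where "n = a * a - b * b * (\<delta> * \<delta>)"
  have nx: "x * (a - b * \<delta>) = n" unfolding x(3) n_def by (simp add: algebra_simps)
  have "cnj x = a - b * \<delta>" unfolding x(3) using Kp_real[OF x(1)] Kp_real[OF x(2)] delta(3) by simp
  then have n0: "n \<noteq> 0" using nx x0 by (metis complex_cnj_zero_iff no_zero_divisors)
  have nK: "n \<in> Kp" unfolding n_def
    by (rule Kp.diff_mem[OF Kp.mult_mem[OF x(1,1)] Kp.mult_mem[OF Kp.mult_mem[OF x(2,2)] delta_sq]])
  have "a / n + (- b / n) * \<delta> \<in> L" using x nK by (intro LI) auto
  moreover have "inverse x = a / n + (- b / n) * \<delta>"
  proof -
    have "x * ((a - b * \<delta>) / n) = 1" using nx n0 by simp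
    then have "inverse x = (a - b * \<delta>) / n" by (rule inverse_unique)
    then show ?thesis by (simp add: diff_divide_distrib)
  qed
  ultimately show "inverse x \<in> L" by simp
qed

lemma Kp_L: "Kp \<subseteq> L" using LI[of _ 0] by auto

lemma k_L: "k \<subseteq> L"
proof
  fix x assume "x \<in> k"
  then show "x \<in> L" using delta(5)[of x] kp_Kp unfolding L_def by blast
qed

lemma K_eq_L: "K = L"
proof
  show "K \<subseteq> L" unfolding K_def compositum_def using L_subfield Kp_L k_L by blast
  show "L \<subseteq> K"
  proof
    fix x assume "x \<in> L"
    then obtain a b where x: "a \<in> Kp" "b \<in> Kp" "x = a + b * \<delta>" unfolding L_def by blast
    show "x \<in> K" unfolding K_def compositum_def
    proof (intro InterI)
      fix F assume "F \<in> {F. subfield_C F \<and> Kp \<subseteq> F \<and> k \<subseteq> F}"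
      then have F: "complex_field F" "Kp \<subseteq> F" "k \<subseteq> F" by (auto simp: complex_field_def)
      interpret F: complex_field F by (rule F(1))
      show "x \<in> F" unfolding x(3) using x(1,2) delta(1) F(2,3) by (intro F.add_mem F.mult_mem) auto
    qed
  qed
qed

lemma K_number_field: "number_field K"
proof -
  obtain n where "spans Kp \<rat> n" using nf_Kp unfolding number_field_def by blast
  then obtain b where b: "\<forall>i<n. b i \<in> Kp" "Kp = {\<Sum>i<n. c i * b i | c. \<forall>i<n. c i \<in> \<rat>}"
    unfolding spans_def by blast
  define e where "e i = (if i < n then b i else b (i - n) * \<delta>)" for i
  have sum_e: "(\<Sum>i<n+n. c i * e i) = (\<Sum>i<n. c i * b i) + (\<Sum>i<n. c (n + i) * b i) * \<delta>" for c
    unfolding sum_lessThan_add by (simp add: e_def sum_distrib_right mult.assoc)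
  have "L = {\<Sum>i<n+n. c i * e i | c. \<forall>i<n+n. c i \<in> \<rat>}"
  proof
    show "L \<subseteq> {\<Sum>i<n+n. c i * e i | c. \<forall>i<n+n. c i \<in> \<rat>}"
    proof
      fix x assume "x \<in> L"
      then obtain u v where x: "u \<in> Kp" "v \<in> Kp" "x = u + v * \<delta>" unfolding L_def by blast
      obtain c where c: "\<forall>i<n. c i \<in> \<rat>" "u = (\<Sum>i<n. c i * b i)" using x(1) b(2) by blast
      obtain d where d: "\<forall>i<n. d i \<in> \<rat>" "v = (\<Sum>i<n. d i * b i)" using x(2) b(2) by blast
      define f where "f i = (if i < n then c i else d (i - n))" for i
      have "x = (\<Sum>i<n+n. f i * e i)" unfolding sum_e x(3) c(2) d(2) by (simp add: f_def)
      moreover have "\<forall>i<n+n. f i \<in> \<rat>" using c(1) d(1) by (auto simp: f_def)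
      ultimately show "x \<in> {\<Sum>i<n+n. c i * e i | c. \<forall>i<n+n. c i \<in> \<rat>}" by blast
    qed
    show "{\<Sum>i<n+n. c i * e i | c. \<forall>i<n+n. c i \<in> \<rat>} \<subseteq> L"
    proof
      fix x assume "x \<in> {\<Sum>i<n+n. c i * e i | c. \<forall>i<n+n. c i \<in> \<rat>}"
      then obtain c where c: "\<forall>i<n+n. c i \<in> \<rat>" "x = (\<Sum>i<n+n. c i * e i)" by blast
      have "c i \<in> Kp" if "i < n + n" for i using c(1) that Kp.Rats_subset by blast
      then show "x \<in> L" unfolding c(2) sum_e
        using b(1) by (intro LI Kp.sum_mem Kp.mult_mem) auto
    qed
  qed
  moreover have "\<forall>i<n+n. e i \<in> L"
  proof (intro allI impI)
    fix i assume "i < n + n"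
    then show "e i \<in> L" using b(1) LI[of "b i" 0] LI[of 0 "b (i - n)"] by (auto simp: e_def)
  qed
  ultimately have "spans L \<rat> (n+n)" unfolding spans_def by blast
  then show ?thesis unfolding number_field_def K_eq_L using L_subfield by blast
qed

sublocale num_field_ext k K
  by unfold_locales (use K_number_field k_L K_eq_L in auto)

lemma Kp_K: "Kp \<subseteq> K" using Kp_L K_eq_L by simp

lemma K_rep: "x \<in> K \<Longrightarrow> \<exists>a\<in>Kp. \<exists>b\<in>Kp. x = a + b * \<delta>"
  unfolding K_eq_L L_def by blast

lemma cnj_rep: "a \<in> Kp \<Longrightarrow> b \<in> Kp \<Longrightarrow> cnj (a + b * \<delta>) = a + (- b) * \<delta>"
  using Kp_real delta(3) by simp

lemma cnj_K: assumes "x \<in> K" shows "cnj x \<in> K"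
proof -
  obtain a b where ab: "a \<in> Kp" "b \<in> Kp" "x = a + b * \<delta>" using K_rep[OF assms] by blast
  have "cnj x \<in> L" using LI[OF ab(1) Kp.uminus_mem[OF ab(2)]] cnj_rep[OF ab(1,2)] ab(3) by simp
  then show ?thesis using K_eq_L by blast
qed

lemma cnj_k: assumes "x \<in> k" shows "cnj x \<in> k"
proof -
  obtain a b where ab: "a \<in> kp" "b \<in> kp" "x = a + b * \<delta>" using delta(5)[OF assms] by blast
  have "cnj x = a + (- b) * \<delta>" unfolding ab(3) using ab(1,2) kp_Kp by (intro cnj_rep) auto
  also have "\<dots> \<in> k" using ab(1,2) kp_k delta(1) by (intro k.add_mem k.mult_mem k.uminus_mem) auto
  finally show ?thesis .
qed

lemma real_in_Kp: assumes "x \<in> K" "cnj x = x" shows "x \<in> Kp"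
proof -
  obtain a b where ab: "a \<in> Kp" "b \<in> Kp" "x = a + b * \<delta>" using K_rep[OF assms(1)] by blast
  have "plus_part x = x" unfolding plus_part_def using assms(2) by simp
  moreover have "plus_part x = a" unfolding ab(3) by (rule parts_eq(1)[OF ab(1,2)])
  ultimately show ?thesis using ab(1) by metis
qed

text \<open>The CM property. Any embedding sends \<open>Kp\<close> and \<open>\<delta> ^ 2\<close>
  to real numbers but not \<open>\<delta>\<close>, as otherwise it would make \<open>k\<close> real.
  So the image of \<open>\<delta>\<close> is again purely imaginary, and conjugation acts on the
  coordinates in the same way before and after \<open>\<sigma>\<close>.\<close>

lemma embedding_cnj_commute:
  assumes \<sigma>: "embedding K \<sigma>" and x: "x \<in> K" shows "\<sigma> (cnj x) = cnj (\<sigma> x)"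
proof -
  have dK: "\<delta> \<in> K" using delta(1) k_subset by blast
  have real: "cnj (\<sigma> a) = \<sigma> a" if "a \<in> Kp" for a
  proof -
    have "\<sigma> ` Kp \<subseteq> \<real>" using real_Kp embedding_subset[OF \<sigma> Kp_K] unfolding totally_real_def by blast
    then show ?thesis using that by (auto simp: Reals_cnj_iff)
  qed
  have nr: "cnj (\<sigma> \<delta>) \<noteq> \<sigma> \<delta>"
  proof
    assume dd: "cnj (\<sigma> \<delta>) = \<sigma> \<delta>"
    have "\<sigma> ` k \<subseteq> \<real>"
    proof
      fix y assume "y \<in> \<sigma> ` k"
      then obtain z where z: "z \<in> k" "y = \<sigma> z" by blast
      obtain a b where ab: "a \<in> kp" "b \<in> kp" "z = a + b * \<delta>" using delta(5)[OF z(1)] by blast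
      have abK: "a \<in> Kp" "b \<in> Kp" "a \<in> K" "b \<in> K" using ab kp_Kp Kp_K by auto
      have "y = \<sigma> a + \<sigma> b * \<sigma> \<delta>" unfolding z(2) ab(3)
        using top.emb_add[OF \<sigma> abK(3) top.mult_mem[OF abK(4) dK]] top.emb_mult[OF \<sigma> abK(4) dK] by simp
      then have "cnj y = y" using dd real abK by simp
      then show "y \<in> \<real>" by (simp add: Reals_cnj_iff)
    qed
    then show False using imag_k embedding_subset[OF \<sigma> k_subset] unfolding totally_imaginary_def by blast
  qed
  have "(\<sigma> \<delta>) ^ 2 = \<sigma> (\<delta> ^ 2)" using top.emb_power[OF \<sigma> dK] by simp
  moreover have "cnj (\<sigma> (\<delta> ^ 2)) = \<sigma> (\<delta> ^ 2)" using real[of "\<delta> ^ 2"] delta(2) kp_Kp by blast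
  ultimately have "(cnj (\<sigma> \<delta>)) ^ 2 = (\<sigma> \<delta>) ^ 2" by (metis complex_cnj_power)
  then have sd: "cnj (\<sigma> \<delta>) = - \<sigma> \<delta>" using nr unfolding power2_eq_iff by blast
  obtain a b where ab: "a \<in> Kp" "b \<in> Kp" "x = a + b * \<delta>" using K_rep[OF x] by blast
  have abK: "a \<in> K" "b \<in> K" "- b \<in> K" using ab Kp_K by auto
  have "\<sigma> (cnj x) = \<sigma> a + \<sigma> (- b) * \<sigma> \<delta>"
    unfolding ab(3) cnj_rep[OF ab(1,2)]
    using top.emb_add[OF \<sigma> abK(1) top.mult_mem[OF abK(3) dK]] top.emb_mult[OF \<sigma> abK(3) dK] by simp
  also have "\<dots> = \<sigma> a - \<sigma> b * \<sigma> \<delta>" using top.emb_uminus[OF \<sigma> abK(2)] by simp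
  also have "\<dots> = cnj (\<sigma> a + \<sigma> b * \<sigma> \<delta>)" using real ab(1,2) sd by simp
  also have "\<sigma> a + \<sigma> b * \<sigma> \<delta> = \<sigma> x"
    unfolding ab(3) using top.emb_add[OF \<sigma> abK(1) top.mult_mem[OF abK(2) dK]] top.emb_mult[OF \<sigma> abK(2) dK] by simp
  finally show ?thesis .
qed

definition res :: "(complex \<Rightarrow> complex) \<Rightarrow> complex \<Rightarrow> complex" where
  "res \<sigma> x = (if x \<in> Kp then \<sigma> x else x)"

text \<open>\<open>Kp\<close> is the set of elements of \<open>K\<close> fixed by conjugation. As
  \<open>\<sigma>\<close> commutes with conjugation, it preserves \<open>Kp\<close>, and so do
  preimages.\<close>

lemma res_Gal: assumes \<sigma>: "\<sigma> \<in> Gal K k" shows "res \<sigma> \<in> Gal Kp kp"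
proof -
  have emb: "embedding K \<sigma>" by (rule top.Gal_embedding[OF \<sigma>])
  have closed: "\<sigma> x \<in> Kp" if x: "x \<in> Kp" for x
  proof (rule real_in_Kp)
    show "\<sigma> x \<in> K" using top.Gal_mem[OF \<sigma>] x Kp_K by blast
    show "cnj (\<sigma> x) = \<sigma> x" using embedding_cnj_commute[OF emb subsetD[OF Kp_K x]] Kp_real[OF x] by simp
  qed
  have surj: "\<exists>x\<in>Kp. y = \<sigma> x" if y: "y \<in> Kp" for y
  proof -
    have "y \<in> \<sigma> ` K" using top.Gal_bij[OF \<sigma>] y Kp_K unfolding bij_betw_def by auto
    then obtain x where x: "x \<in> K" "y = \<sigma> x" by blast
    have "\<sigma> (cnj x) = \<sigma> x" using embedding_cnj_commute[OF emb x(1)] Kp_real[OF y] x(2) by simp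
    then have "cnj x = x" using top.emb_inj_on[OF emb] cnj_K[OF x(1)] x(1) by (auto dest: inj_onD)
    then show ?thesis using real_in_Kp[OF x(1)] x(2) by blast
  qed
  have inj: "inj_on \<sigma> Kp" using top.emb_inj_on[OF emb] Kp_K by (rule inj_on_subset)
  show ?thesis
    unfolding Gal_def
  proof (intro CollectI conjI ballI allI impI)
    show "embedding Kp (res \<sigma>)"
      using embedding_subset[OF emb Kp_K] unfolding embedding_def res_def by auto
    show "bij_betw (res \<sigma>) Kp Kp"
    proof -
      have "bij_betw \<sigma> Kp Kp" unfolding bij_betw_def using inj closed surj by blast
      then show ?thesis by (rule bij_betw_cong[THEN iffD1, rotated]) (simp add: res_def)
    qed
    show "res \<sigma> x = x" if "x \<in> kp" for x
      using that kp_k top.Gal_fixes[OF \<sigma>, of x] unfolding res_def by auto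
    show "res \<sigma> x = x" if "x \<notin> Kp" for x using that unfolding res_def by simp
  qed
qed

lemma Gal_on_rep:
  assumes \<sigma>: "\<sigma> \<in> Gal K k" and ab: "a \<in> Kp" "b \<in> Kp"
  shows "\<sigma> (a + b * \<delta>) = \<sigma> a + \<sigma> b * \<delta>"
proof -
  have emb: "embedding K \<sigma>" by (rule top.Gal_embedding[OF \<sigma>])
  have mem: "a \<in> K" "b \<in> K" "\<delta> \<in> K" using ab Kp_K delta(1) k_subset by auto
  show ?thesis
    using top.emb_add[OF emb mem(1) top.mult_mem[OF mem(2,3)]] top.emb_mult[OF emb mem(2,3)]
      top.Gal_fixes[OF \<sigma> delta(1)] by simp
qed

text \<open>Restriction to \<open>Kp\<close> is injective because \<open>\<sigma>\<close> fixes
  \<open>\<delta>\<close>.\<close>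

lemma finite_Gal_K: "finite (Gal K k)"
proof (rule inj_on_finite)
  show "inj_on res (Gal K k)"
  proof (rule inj_onI)
    fix \<sigma> \<rho> assume s: "\<sigma> \<in> Gal K k" "\<rho> \<in> Gal K k" "res \<sigma> = res \<rho>"
    have eq: "\<sigma> a = \<rho> a" if "a \<in> Kp" for a using fun_cong[OF s(3), of a] that by (simp add: res_def)
    show "\<sigma> = \<rho>"
    proof (rule top.Gal_eqI[OF s(1,2)])
      fix x assume "x \<in> K"
      then obtain a b where ab: "a \<in> Kp" "b \<in> Kp" "x = a + b * \<delta>" using K_rep by blast
      show "\<sigma> x = \<rho> x" unfolding ab(3) Gal_on_rep[OF s(1) ab(1,2)] Gal_on_rep[OF s(2) ab(1,2)] eq[OF ab(1)] eq[OF ab(2)] ..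
    qed
  qed
  show "res ` Gal K k \<subseteq> Gal Kp kp" using res_Gal by blast
  show "finite (Gal Kp kp)" using gal_Kp unfolding galois_ext_def by blast
qed

text \<open>Extends an automorphism of \<open>Kp\<close> to \<open>K\<close> coordinatewise, fixing
  \<open>\<delta>\<close>.\<close>

definition lift :: "(complex \<Rightarrow> complex) \<Rightarrow> complex \<Rightarrow> complex" where
  "lift \<sigma> x = (if x \<in> K then \<sigma> (plus_part x) + \<sigma> (minus_part x) * \<delta> else x)"

lemma lift_rep: "a \<in> Kp \<Longrightarrow> b \<in> Kp \<Longrightarrow> lift \<sigma> (a + b * \<delta>) = \<sigma> a + \<sigma> b * \<delta>"
  unfolding lift_def using parts_eq[of a b] LI[of a b] K_eq_L by simp

lemma lift_Gal: assumes \<sigma>: "\<sigma> \<in> Gal Kp kp" shows "lift \<sigma> \<in> Gal K k"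
proof -
  have emb: "embedding Kp \<sigma>" by (rule Kp.Gal_embedding[OF \<sigma>])
  have cl: "\<sigma> a \<in> Kp" if "a \<in> Kp" for a using Kp.Gal_mem[OF \<sigma> that] .
  have dd: "\<sigma> (\<delta> * \<delta>) = \<delta> * \<delta>" using Kp.Gal_fixes[OF \<sigma> delta(2)] by (simp add: power2_eq_square)
  show ?thesis
    unfolding Gal_def
  proof (intro CollectI conjI ballI allI impI)
    show "embedding K (lift \<sigma>)"
      unfolding embedding_def
    proof (intro conjI ballI)
      show "lift \<sigma> 1 = 1" using lift_rep[of 1 0 \<sigma>] Kp.emb_0[OF emb] Kp.emb_1[OF emb] by simp
      fix x y assume "x \<in> K" "y \<in> K"
      then obtain a b c d where ab: "a \<in> Kp" "b \<in> Kp" "x = a + b * \<delta>" and cd: "c \<in> Kp" "d \<in> Kp" "y = c + d * \<delta>"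
        using K_rep by metis
      have "x + y = (a + c) + (b + d) * \<delta>" unfolding ab(3) cd(3) by (simp add: algebra_simps)
      then have "lift \<sigma> (x + y) = \<sigma> (a + c) + \<sigma> (b + d) * \<delta>"
        using lift_rep[OF Kp.add_mem[OF ab(1) cd(1)] Kp.add_mem[OF ab(2) cd(2)]] by simp
      also have "\<dots> = lift \<sigma> x + lift \<sigma> y"
        unfolding ab(3) cd(3) lift_rep[OF ab(1,2)] lift_rep[OF cd(1,2)]
          Kp.emb_add[OF emb ab(1) cd(1)] Kp.emb_add[OF emb ab(2) cd(2)] by (simp add: algebra_simps)
      finally show "lift \<sigma> (x + y) = lift \<sigma> x + lift \<sigma> y" .
      have m: "a * c \<in> Kp" "b * d \<in> Kp" "a * d \<in> Kp" "b * c \<in> Kp" using ab cd by auto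
      have m2: "b * d * (\<delta> * \<delta>) \<in> Kp" using m(2) delta_sq by (rule Kp.mult_mem)
      have "lift \<sigma> (x * y) = \<sigma> (a * c + b * d * (\<delta> * \<delta>)) + \<sigma> (a * d + b * c) * \<delta>"
        unfolding ab(3) cd(3) L_mult_form by (rule lift_rep[OF Kp.add_mem[OF m(1) m2] Kp.add_mem[OF m(3,4)]])
      also have "\<dots> = (\<sigma> a * \<sigma> c + \<sigma> b * \<sigma> d * (\<delta> * \<delta>)) + (\<sigma> a * \<sigma> d + \<sigma> b * \<sigma> c) * \<delta>"
        unfolding Kp.emb_add[OF emb m(1) m2] Kp.emb_add[OF emb m(3,4)] Kp.emb_mult[OF emb m(2) delta_sq] dd
          Kp.emb_mult[OF emb ab(1) cd(1)] Kp.emb_mult[OF emb ab(2) cd(2)] Kp.emb_mult[OF emb ab(1) cd(2)]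
          Kp.emb_mult[OF emb ab(2) cd(1)] ..
      also have "\<dots> = lift \<sigma> x * lift \<sigma> y"
        unfolding ab(3) cd(3) lift_rep[OF ab(1,2)] lift_rep[OF cd(1,2)] L_mult_form ..
      finally show "lift \<sigma> (x * y) = lift \<sigma> x * lift \<sigma> y" .
    qed
    then have inj: "inj_on (lift \<sigma>) K" by (rule top.emb_inj_on)
    have "lift \<sigma> ` K = K"
    proof
      show "lift \<sigma> ` K \<subseteq> K"
      proof
        fix y assume "y \<in> lift \<sigma> ` K"
        then obtain x where x: "x \<in> K" "y = lift \<sigma> x" by blast
        obtain a b where ab: "a \<in> Kp" "b \<in> Kp" "x = a + b * \<delta>" using K_rep[OF x(1)] by blast
        have "\<sigma> a + \<sigma> b * \<delta> \<in> L" by (rule LI[OF cl[OF ab(1)] cl[OF ab(2)]])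
        then show "y \<in> K" unfolding x(2) ab(3) lift_rep[OF ab(1,2)] using K_eq_L by blast
      qed
      show "K \<subseteq> lift \<sigma> ` K"
      proof
        fix y assume "y \<in> K"
        then obtain a b where ab: "a \<in> Kp" "b \<in> Kp" "y = a + b * \<delta>" using K_rep by blast
        have img: "\<sigma> ` Kp = Kp" by (rule bij_betw_imp_surj_on[OF Kp.Gal_bij[OF \<sigma>]])
        obtain a' where a': "a' \<in> Kp" "a = \<sigma> a'" using ab(1) img by blast
        obtain b' where b': "b' \<in> Kp" "b = \<sigma> b'" using ab(2) img by blast
        show "y \<in> lift \<sigma> ` K"
        proof (rule image_eqI)
          show "y = lift \<sigma> (a' + b' * \<delta>)" unfolding lift_rep[OF a'(1) b'(1)] ab(3) a'(2) b'(2) ..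
          show "a' + b' * \<delta> \<in> K" using LI[OF a'(1) b'(1)] K_eq_L by blast
        qed
      qed
    qed
    then show "bij_betw (lift \<sigma>) K K" unfolding bij_betw_def using inj by blast
    show "lift \<sigma> x = x" if xk: "x \<in> k" for x
    proof -
      obtain a b where ab: "a \<in> kp" "b \<in> kp" "x = a + b * \<delta>" using delta(5)[OF xk] by blast
      have abK: "a \<in> Kp" "b \<in> Kp" using ab kp_Kp by auto
      show ?thesis unfolding ab(3) lift_rep[OF abK] Kp.Gal_fixes[OF \<sigma> ab(1)] Kp.Gal_fixes[OF \<sigma> ab(2)] ..
    qed
    show "lift \<sigma> x = x" if "x \<notin> K" for x using that by (simp add: lift_def)
  qed
qed

text \<open>Being fixed by all lifts makes both coordinates of \<open>x\<close> invariant under the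
  group of \<open>Kp\<close> over \<open>kp\<close>, where \<open>galois_fixed_field\<close>
  applies.\<close>

lemma Gal_fixed_K:
  assumes x: "x \<in> K" and fixed: "\<And>\<sigma>. \<sigma> \<in> Gal K k \<Longrightarrow> \<sigma> x = x" shows "x \<in> k"
proof -
  obtain a b where ab: "a \<in> Kp" "b \<in> Kp" "x = a + b * \<delta>" using K_rep[OF x] by blast
  obtain n where "spans Kp \<rat> n" using nf_Kp unfolding number_field_def by blast
  then have sp: "spans Kp kp n" by (rule spans_mono[OF kp.Rats_subset kp_Kp Kp.complex_field_axioms])
  have fx: "\<sigma> a = a" "\<sigma> b = b" if \<sigma>: "\<sigma> \<in> Gal Kp kp" for \<sigma>
  proof -
    have "\<sigma> a + \<sigma> b * \<delta> = a + b * \<delta>"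
      using fixed[OF lift_Gal[OF \<sigma>]] unfolding ab(3) lift_rep[OF ab(1,2)] .
    then have "plus_part (\<sigma> a + \<sigma> b * \<delta>) = plus_part (a + b * \<delta>)" "minus_part (\<sigma> a + \<sigma> b * \<delta>) = minus_part (a + b * \<delta>)"
      by simp_all
    then show "\<sigma> a = a" "\<sigma> b = b"
      using parts_eq[OF ab(1,2)] parts_eq[OF Kp.Gal_mem[OF \<sigma> ab(1)] Kp.Gal_mem[OF \<sigma> ab(2)]] by simp_all
  qed
  have "a \<in> kp" by (rule Kp.galois_fixed_field[OF kp.complex_field_axioms gal_Kp sp ab(1)]) (rule fx(1))
  moreover have "b \<in> kp" by (rule Kp.galois_fixed_field[OF kp.complex_field_axioms gal_Kp sp ab(2)]) (rule fx(2))
  ultimately show ?thesis unfolding ab(3) using kp_k delta(1) by (intro k.add_mem k.mult_mem) auto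
qed

lemma unitary_unit_K: assumes u: "u \<in> OK K" "u * cnj u = 1" shows "\<exists>n>0. u ^ n = 1"
proof (rule top.kronecker[OF u(1)])
  show "u \<noteq> 0" using u(2) by auto
  fix \<phi> assume ph: "embedding K \<phi>"
  have uK: "u \<in> K" by (rule top.OK_mem_field[OF u(1)])
  have "\<phi> u * cnj (\<phi> u) = \<phi> (u * cnj u)"
    using top.emb_mult[OF ph uK cnj_K[OF uK]] embedding_cnj_commute[OF ph uK] by simp
  also have "\<dots> = 1" unfolding u(2) by (rule top.emb_1[OF ph])
  finally have "(norm (\<phi> u)) ^ 2 = 1" by (metis complex_norm_square of_real_eq_1_iff)
  then show "norm (\<phi> u) = 1" by (simp add: power2_eq_1_iff) (smt (verit) norm_ge_zero)
qed

end

theorem theorem6: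
  fixes Kp kp k K :: "complex set"
  assumes "number_field Kp" and "number_field kp" and "number_field k"
    and "totally_real Kp" and "totally_real kp"
    and "kp \<subseteq> Kp" and "galois_ext Kp kp"
    and "kp \<subseteq> k" and "field_deg k kp = 2" and "totally_imaginary k"
    and "K = compositum Kp k"
    and "field_deg K k = field_deg Kp kp"
    and "\<forall>P. prime_ideal k P \<and> ramified k K P \<longrightarrow> cnj ` P = P"
  shows "Cap_hat_minus k K \<cong> H1 (Gal K k) (mu_hat K)"
proof -
  interpret cm_setting Kp kp k K by unfold_locales (fact assms)+
  interpret cm_galois_ext k K
  proof unfold_locales
    show "\<sigma> (cnj x) = cnj (\<sigma> x)" if "\<sigma> \<in> Gal K k" "x \<in> K" for \<sigma> x
      by (rule embedding_cnj_commute[OF top.Gal_embedding[OF that(1)] that(2)])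
    show "cnj ` P = P" if "prime_ideal k P" "ramified k K P" for P using assms(13) that by blast
  qed (fact finite_Gal_K Gal_fixed_K cnj_K cnj_k unitary_unit_K)+
  show ?thesis by (rule capitulation_iso)
qed

end
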